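(* Let $\beta:\widetilde{\mathbb{C}^4}\to\mathbb{C}^4$ be the complex blow-up of $\mathbb{C}^4$ along $\{(0,z,0,z):z\in\mathbb{C}\}$, and let $$\mathcal{G}:=\widetilde{\mathbb{C}^4}\setminus\overline{\beta^{-1}\big[(\{0\}\times\mathbb{C}\times\mathbb{C}^*\times\mathbb{C})\cup(\mathbb{C}^*\times\mathbb{C}\times\{0\}\times\mathbb{C})\big]} .$$ Then the pair groupoid structure on $(\mathbb{C}^*\times\mathbb{C})^{\times2}$ (the pair groupoid of $\mathbb{C}^*\times\mathbb{C}$) extends uniquely to a Lie groupoid structure $\mathcal{G}\rightrightarrows\mathbb{C}^2$, under the diffeomorphism $\beta:\beta^{-1}[(\mathbb{C}^*\times\mathbb{C})^{\times2}]\to(\mathbb{C}^*\times\mathbb{C})^{\times 2}$, and this Lie groupoid integrates $\mathcal{A}$, the cotangent Lie algebroid of the elliptic Poisson structure with zero residue (in the local model on $\mathbb{R}^4\cong\mathbb{C}^2$ described in the context).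
   Context: $\mathcal{G}$ has global coordinates $\{(z,a,b,c)\in\mathbb{C}^4: b\neq0\}$ in which $\beta(z,a,b,c)=(a,z,ab,ac+z)$ (here $z$ is just a coordinate on $\mathcal{G}$). The pair groupoid of $X$ is $X\times X\rightrightarrows X$ with target the first and source the second projection. Local model of the elliptic Poisson structure with zero residue: $M=\mathbb{R}^4$ with coordinates $(x_1,x_2,x_3,x_4)$, $D=\{0\}\times\mathbb{R}^2=\{x_1=x_2=0\}$, and $(r,\theta)$ polar coordinates on the $(x_1,x_2)$-plane. The elliptic ideal is $\langle r^2\rangle$, and the elliptic tangent bundle $\mathcal{A}_{|D|}$, with anchor $\rho$, is the Lie algebroid whose sections are the vector fields preserving this ideal (generated by $r\partial_r,\partial_\theta,\partial_{x_3},\partial_{x_4}$). The elliptic symplectic form, a nondegenerate closed section of $\Lambda^2\mathcal{A}_{|D|}^*$, is $\omega=d\log r\wedge dx_3+d\theta\wedge dx_4$. The associated elliptic Poisson structure, given by $\pi^\sharp=\rho\circ(\omega^\flat)^{-1}\circ\rho^*$, is $\pi=r\partial_r\wedge\partial_{x_3}+\partial_\theta\wedge\partial_{x_4}$. Its cotangent Lie algebroid is $\mathcal{A}=(T^*M,\pi^\sharp,[-,-]_\pi)$, with $$\mathcal{A}\cong\mathrm{span}(x_1\partial_{x_3}+x_2\partial_{x_4},\ x_1\partial_{x_4}-x_2\partial_{x_3},\ r\partial_r,\ \partial_\theta).$$ Identifying $\mathbb{R}^4$ with $\mathbb{C}^2$ by complex coordinates $x_1+ix_2$ (first factor) and $x_3+ix_4$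 (second factor), $\mathcal{A}$ corresponds to the holomorphic Lie algebroid spanned by $\zeta\partial_\eta$ and $\zeta\partial_\zeta$, where $\zeta=x_1+ix_2$ and $\eta=x_3+ix_4$. The Lie algebroid of a Lie groupoid is $\ker(ds)$ at the units with anchor $dt$; a groupoid integrates $\mathcal{A}$ if its Lie algebroid is isomorphic to $\mathcal{A}$.
   Formalization: The isomorphism of the Lie algebroid of 𝒢 with 𝒜 covers the identification ζ=x₁+ix₂, η=x₃−ix₄ of ℝ⁴ with ℂ²; over the stated η=x₃+ix₄ it fails, since π♯ gives multiples of ζ̄∂_η and ζ̄ is not a smooth multiple of ζ near 0. *)

theory Defs
  imports "HOL-Analysis.Analysis"
begin

section \<open>Smooth manifolds\<close>

primrec Ck_on :: "nat \<Rightarrow> 'a::real_normed_vector set \<Rightarrow> ('a \<Rightarrow> 'b::real_normed_vector) \<Rightarrow> bool" where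
  "Ck_on 0 S f \<longleftrightarrow> continuous_on S f"
| "Ck_on (Suc k) S f \<longleftrightarrow>
     (\<forall>x\<in>S. f differentiable (at x)) \<and> (\<forall>v. Ck_on k S (\<lambda>x. frechet_derivative f (at x) v))"

text \<open>Only meant for open sets \<open>S\<close>.\<close>

definition smooth_on :: "'a::real_normed_vector set \<Rightarrow> ('a \<Rightarrow> 'b::real_normed_vector) \<Rightarrow> bool" where
  "smooth_on S f \<longleftrightarrow> (\<forall>k. Ck_on k S f)"

text \<open>
  A manifold is given by an atlas. The underlying set is the union of the chart domains, and
  the topology is the one for which the charts are homeomorphisms onto open sets.
\<close>

type_synonym ('p, 'e) chart = "'p set \<times> ('p \<Rightarrow> 'e)"

definition chart_inv :: "('p, 'e) chart \<Rightarrow> 'e \<Rightarrow> 'p" where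
  "chart_inv c = inv_into (fst c) (snd c)"

definition mcarrier :: "('p, 'e) chart set \<Rightarrow> 'p set" where
  "mcarrier A = (\<Union>c\<in>A. fst c)"

definition mtopology :: "('p, 'e::topological_space) chart set \<Rightarrow> 'p topology" where
  "mtopology A = topology (\<lambda>W. W \<subseteq> mcarrier A \<and> (\<forall>c\<in>A. open (snd c ` (fst c \<inter> W))))"

definition smooth_atlas :: "('p, 'e::euclidean_space) chart set \<Rightarrow> bool" where
  "smooth_atlas A \<longleftrightarrow>
     (\<forall>c\<in>A. inj_on (snd c) (fst c) \<and> open (snd c ` fst c)) \<and>
     (\<forall>c\<in>A. \<forall>d\<in>A. open (snd c ` (fst c \<inter> fst d)) \<and>
        smooth_on (snd c ` (fst c \<inter> fst d)) (snd d \<circ> chart_inv c))"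

definition smooth_manifold :: "('p, 'e::euclidean_space) chart set \<Rightarrow> bool" where
  "smooth_manifold A \<longleftrightarrow> smooth_atlas A \<and> Hausdorff_space (mtopology A) \<and>
     (\<exists>B. countable B \<and> (\<forall>V\<in>B. openin (mtopology A) V) \<and>
        (\<forall>W x. openin (mtopology A) W \<and> x \<in> W \<longrightarrow> (\<exists>V\<in>B. x \<in> V \<and> V \<subseteq> W)))"

lemma istopology_charts:
  fixes A :: "('p, 'e::topological_space) chart set"
  assumes inj: "\<And>c. c \<in> A \<Longrightarrow> inj_on (snd c) (fst c)"
    and opn: "\<And>c. c \<in> A \<Longrightarrow> open (snd c ` fst c)"
  shows "istopology (\<lambda>W. W \<subseteq> mcarrier A \<and> (\<forall>c\<in>A. open (snd c ` (fst c \<inter> W))))"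
  unfolding istopology_def
proof (intro conjI allI impI)
  fix S T
  assume S: "S \<subseteq> mcarrier A \<and> (\<forall>c\<in>A. open (snd c ` (fst c \<inter> S)))"
    and T: "T \<subseteq> mcarrier A \<and> (\<forall>c\<in>A. open (snd c ` (fst c \<inter> T)))"
  show "S \<inter> T \<subseteq> mcarrier A" using S by blast
  show "\<forall>c\<in>A. open (snd c ` (fst c \<inter> (S \<inter> T)))"
  proof
    fix c assume c: "c \<in> A"
    have "snd c ` (fst c \<inter> (S \<inter> T)) = snd c ` (fst c \<inter> S) \<inter> snd c ` (fst c \<inter> T)"
      using inj[OF c] by (auto simp: inj_on_def)
    then show "open (snd c ` (fst c \<inter> (S \<inter> T)))"
      using S T c by (simp add: open_Int)
  qed
next
  fix \<K>
  assume K: "\<forall>K\<in>\<K>. K \<subseteq> mcarrier A \<and> (\<forall>c\<in>A. open (snd c ` (fst c \<inter> K)))"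
  show "\<Union>\<K> \<subseteq> mcarrier A" using K by blast
  show "\<forall>c\<in>A. open (snd c ` (fst c \<inter> \<Union>\<K>))"
  proof
    fix c assume c: "c \<in> A"
    have "snd c ` (fst c \<inter> \<Union>\<K>) = (\<Union>K\<in>\<K>. snd c ` (fst c \<inter> K))" by blast
    then show "open (snd c ` (fst c \<inter> \<Union>\<K>))" using K c by auto
  qed
qed

lemma openin_mtopology:
  fixes A :: "('p, 'e::topological_space) chart set"
  assumes "\<And>c. c \<in> A \<Longrightarrow> inj_on (snd c) (fst c)" "\<And>c. c \<in> A \<Longrightarrow> open (snd c ` fst c)"
  shows "openin (mtopology A) W \<longleftrightarrow> W \<subseteq> mcarrier A \<and> (\<forall>c\<in>A. open (snd c ` (fst c \<inter> W)))"
  unfolding mtopology_def using topology_inverse'[OF istopology_charts[OF assms]] by simp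

definition euclidean_atlas :: "('e::euclidean_space, 'e) chart set" where
  "euclidean_atlas = {(UNIV, id)}"

definition open_submanifold :: "('p, 'e) chart set \<Rightarrow> 'p set \<Rightarrow> ('p, 'e) chart set" where
  "open_submanifold A W = (\<lambda>c. (fst c \<inter> W, snd c)) ` A"

definition product_atlas ::
    "('p, 'e) chart set \<Rightarrow> ('q, 'f) chart set \<Rightarrow> ('p \<times> 'q, 'e \<times> 'f) chart set" where
  "product_atlas A B = (\<lambda>(c, d). (fst c \<times> fst d, map_prod (snd c) (snd d))) ` (A \<times> B)"

text \<open>The openness condition says that \<open>f\<close> is continuous.\<close>

definition smooth_map ::
    "('p, 'e::euclidean_space) chart set \<Rightarrow> ('q, 'f::euclidean_space) chart set \<Rightarrow> ('p \<Rightarrow> 'q) \<Rightarrow> bool" where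
  "smooth_map A B f \<longleftrightarrow> f ` mcarrier A \<subseteq> mcarrier B \<and>
     (\<forall>c\<in>A. \<forall>d\<in>B. open (snd c ` (fst c \<inter> f -` fst d)) \<and>
        smooth_on (snd c ` (fst c \<inter> f -` fst d)) (snd d \<circ> f \<circ> chart_inv c))"

text \<open>
  Smoothness on a subset \<open>S\<close> of a manifold: local extendability to smooth maps on open sets. For
  an embedded submanifold \<open>S\<close> this is smoothness with respect to the submanifold structure.
\<close>

definition smooth_map_on_subset ::
    "('p, 'e::euclidean_space) chart set \<Rightarrow> 'p set \<Rightarrow> ('q, 'f::euclidean_space) chart set \<Rightarrow>
     ('p \<Rightarrow> 'q) \<Rightarrow> bool" where
  "smooth_map_on_subset A S B f \<longleftrightarrow>
     (\<forall>p\<in>S. \<exists>W F. openin (mtopology A) W \<and> p \<in> W \<and> smooth_map (open_submanifold A W) B F \<and>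
        (\<forall>q\<in>W \<inter> S. F q = f q))"

definition diffeomorphism ::
    "('p, 'e::euclidean_space) chart set \<Rightarrow> ('q, 'f::euclidean_space) chart set \<Rightarrow> ('p \<Rightarrow> 'q) \<Rightarrow> bool" where
  "diffeomorphism A B f \<longleftrightarrow> bij_betw f (mcarrier A) (mcarrier B) \<and>
     smooth_map A B f \<and> smooth_map B A (inv_into (mcarrier A) f)"

text \<open>
  The tangent space at \<open>p\<close> is the model vector space \<open>'e\<close>, a vector being its coordinate
  expression in a chosen chart around \<open>p\<close>; \<open>tangent_in_chart A c p v\<close> is the coordinate
  expression of \<open>v\<close> in the chart \<open>c\<close>.
\<close>

definition chart_at :: "('p, 'e) chart set \<Rightarrow> 'p \<Rightarrow> ('p, 'e) chart" where
  "chart_at A p = (SOME c. c \<in> A \<and> p \<in> fst c)"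

definition tangent_in_chart ::
    "('p, 'e::euclidean_space) chart set \<Rightarrow> ('p, 'e) chart \<Rightarrow> 'p \<Rightarrow> 'e \<Rightarrow> 'e" where
  "tangent_in_chart A c p v =
     frechet_derivative (snd c \<circ> chart_inv (chart_at A p)) (at (snd (chart_at A p) p)) v"

definition differential ::
    "('p, 'e::euclidean_space) chart set \<Rightarrow> ('q, 'f::euclidean_space) chart set \<Rightarrow> ('p \<Rightarrow> 'q) \<Rightarrow>
     'p \<Rightarrow> 'e \<Rightarrow> 'f" where
  "differential A B f p v =
     frechet_derivative (snd (chart_at B (f p)) \<circ> f \<circ> chart_inv (chart_at A p))
       (at (snd (chart_at A p) p)) v"

definition submersion ::
    "('p, 'e::euclidean_space) chart set \<Rightarrow> ('q, 'f::euclidean_space) chart set \<Rightarrow> ('p \<Rightarrow> 'q) \<Rightarrow> bool" where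
  "submersion A B f \<longleftrightarrow> smooth_map A B f \<and> (\<forall>p\<in>mcarrier A. surj (differential A B f p))"

definition vf_in_chart ::
    "('p, 'e::euclidean_space) chart set \<Rightarrow> ('p, 'e) chart \<Rightarrow> ('p \<Rightarrow> 'e) \<Rightarrow> 'e \<Rightarrow> 'e" where
  "vf_in_chart A c X y = tangent_in_chart A c (chart_inv c y) (X (chart_inv c y))"

text \<open>In coordinates \<open>[X, Y] = DY X - DX Y\<close>.\<close>

definition vf_bracket ::
    "('p, 'e::euclidean_space) chart set \<Rightarrow> ('p \<Rightarrow> 'e) \<Rightarrow> ('p \<Rightarrow> 'e) \<Rightarrow> 'p \<Rightarrow> 'e" where
  "vf_bracket A X Y p =
     (let c = chart_at A p; y = snd c p; X' = vf_in_chart A c X; Y' = vf_in_chart A c Y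
      in frechet_derivative Y' (at y) (X' y) - frechet_derivative X' (at y) (Y' y))"

section \<open>Lie groupoids\<close>

text \<open>\<open>gmult g h\<close> is relevant only if \<open>src g = tgt h\<close>.\<close>

record ('g, 'm) groupoid =
  src :: "'g \<Rightarrow> 'm"
  tgt :: "'g \<Rightarrow> 'm"
  gmult :: "'g \<Rightarrow> 'g \<Rightarrow> 'g"
  gunit :: "'m \<Rightarrow> 'g"
  ginv :: "'g \<Rightarrow> 'g"

definition composable :: "'g set \<Rightarrow> ('g, 'm) groupoid \<Rightarrow> ('g \<times> 'g) set" where
  "composable G \<G> = {(g, h). g \<in> G \<and> h \<in> G \<and> src \<G> g = tgt \<G> h}"

definition is_groupoid :: "'g set \<Rightarrow> 'm set \<Rightarrow> ('g, 'm) groupoid \<Rightarrow> bool" where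
  "is_groupoid G M \<G> \<longleftrightarrow>
     (\<forall>g\<in>G. src \<G> g \<in> M \<and> tgt \<G> g \<in> M \<and> ginv \<G> g \<in> G) \<and>
     (\<forall>x\<in>M. gunit \<G> x \<in> G \<and> src \<G> (gunit \<G> x) = x \<and> tgt \<G> (gunit \<G> x) = x) \<and>
     (\<forall>(g, h)\<in>composable G \<G>. gmult \<G> g h \<in> G \<and>
        tgt \<G> (gmult \<G> g h) = tgt \<G> g \<and> src \<G> (gmult \<G> g h) = src \<G> h) \<and>
     (\<forall>g h k. (g, h) \<in> composable G \<G> \<and> (h, k) \<in> composable G \<G> \<longrightarrow>
        gmult \<G> (gmult \<G> g h) k = gmult \<G> g (gmult \<G> h k)) \<and>
     (\<forall>g\<in>G. gmult \<G> (gunit \<G> (tgt \<G> g)) g = g \<and> gmult \<G> g (gunit \<G> (src \<G> g)) = g) \<and>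
     (\<forall>g\<in>G. src \<G> (ginv \<G> g) = tgt \<G> g \<and> tgt \<G> (ginv \<G> g) = src \<G> g \<and>
        gmult \<G> g (ginv \<G> g) = gunit \<G> (tgt \<G> g) \<and>
        gmult \<G> (ginv \<G> g) g = gunit \<G> (src \<G> g))"

definition lie_groupoid ::
    "('g, 'e::euclidean_space) chart set \<Rightarrow> ('m, 'f::euclidean_space) chart set \<Rightarrow>
     ('g, 'm) groupoid \<Rightarrow> bool" where
  "lie_groupoid G M \<G> \<longleftrightarrow>
     smooth_manifold G \<and> smooth_manifold M \<and>
     is_groupoid (mcarrier G) (mcarrier M) \<G> \<and>
     submersion G M (src \<G>) \<and> submersion G M (tgt \<G>) \<and>
     smooth_map_on_subset (product_atlas G G) (composable (mcarrier G) \<G>) G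
       (\<lambda>(g, h). gmult \<G> g h) \<and>
     smooth_map M G (gunit \<G>) \<and> smooth_map G G (ginv \<G>)"

definition same_groupoid :: "'g set \<Rightarrow> 'm set \<Rightarrow> ('g, 'm) groupoid \<Rightarrow> ('g, 'm) groupoid \<Rightarrow> bool" where
  "same_groupoid G M \<G> \<H> \<longleftrightarrow>
     (\<forall>g\<in>G. src \<G> g = src \<H> g \<and> tgt \<G> g = tgt \<H> g \<and> ginv \<G> g = ginv \<H> g) \<and>
     (\<forall>x\<in>M. gunit \<G> x = gunit \<H> x) \<and>
     (\<forall>(g, h)\<in>composable G \<G>. gmult \<G> g h = gmult \<H> g h)"

definition pair_groupoid :: "('m \<times> 'm, 'm) groupoid" where
  "pair_groupoid = \<lparr>src = snd, tgt = fst, gmult = (\<lambda>g h. (fst g, snd h)),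
     gunit = (\<lambda>x. (x, x)), ginv = prod.swap\<rparr>"

text \<open>
  \<open>extends_groupoid \<beta> U X \<G> \<P>\<close>: the structure maps of \<open>\<G>\<close> restrict to \<open>U\<close>
  and the set of units \<open>X\<close>, and the bijection \<open>\<beta>\<close> from \<open>U\<close> onto the arrows of \<open>\<P>\<close> identifies
  these restrictions with the structure maps of \<open>\<P>\<close>.
\<close>

definition extends_groupoid ::
    "('g \<Rightarrow> 'h) \<Rightarrow> 'g set \<Rightarrow> 'm set \<Rightarrow> ('g, 'm) groupoid \<Rightarrow> ('h, 'm) groupoid \<Rightarrow> bool" where
  "extends_groupoid \<beta> U X \<G> \<P> \<longleftrightarrow>
     (\<forall>g\<in>U. src \<G> g = src \<P> (\<beta> g) \<and> tgt \<G> g = tgt \<P> (\<beta> g) \<and>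
        ginv \<G> g \<in> U \<and> \<beta> (ginv \<G> g) = ginv \<P> (\<beta> g)) \<and>
     (\<forall>x\<in>X. gunit \<G> x \<in> U \<and> \<beta> (gunit \<G> x) = gunit \<P> x) \<and>
     (\<forall>(g, h)\<in>composable U \<G>. gmult \<G> g h \<in> U \<and> \<beta> (gmult \<G> g h) = gmult \<P> (\<beta> g) (\<beta> h))"

section \<open>Lie algebroids\<close>

text \<open>
  A Lie algebroid over the manifold \<open>base\<close>. The vector bundle is recorded by its fibres and its
  smooth sections (the latter determine the smooth structure of the total space). The anchor
  takes values in the tangent spaces of the base as represented above.
\<close>

record ('m, 'f, 'v) lie_algebroid =
  base :: "('m, 'f) chart set"
  fibre :: "'m \<Rightarrow> 'v set"
  sections :: "('m \<Rightarrow> 'v) set"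
  anchor :: "'m \<Rightarrow> 'v \<Rightarrow> 'f"
  bracket :: "('m \<Rightarrow> 'v) \<Rightarrow> ('m \<Rightarrow> 'v) \<Rightarrow> 'm \<Rightarrow> 'v"

definition push_section ::
    "'m set \<Rightarrow> ('m \<Rightarrow> 'n) \<Rightarrow> ('m \<Rightarrow> 'v \<Rightarrow> 'w) \<Rightarrow> ('m \<Rightarrow> 'v) \<Rightarrow> 'n \<Rightarrow> 'w" where
  "push_section M \<phi> \<Phi> a y = \<Phi> (inv_into M \<phi> y) (a (inv_into M \<phi> y))"

text \<open>\<open>\<Phi>\<close> is an isomorphism of Lie algebroids covering the diffeomorphism \<open>\<phi>\<close> of the bases.\<close>

definition lie_algebroid_iso ::
    "('m, 'f::euclidean_space, 'v::real_vector) lie_algebroid \<Rightarrow>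
     ('n, 'k::euclidean_space, 'w::real_vector) lie_algebroid \<Rightarrow>
     ('m \<Rightarrow> 'n) \<Rightarrow> ('m \<Rightarrow> 'v \<Rightarrow> 'w) \<Rightarrow> bool" where
  "lie_algebroid_iso A B \<phi> \<Phi> \<longleftrightarrow>
     diffeomorphism (base A) (base B) \<phi> \<and>
     (\<forall>x\<in>mcarrier (base A).
        bij_betw (\<Phi> x) (fibre A x) (fibre B (\<phi> x)) \<and>
        (\<forall>e\<in>fibre A x. \<forall>e'\<in>fibre A x. \<forall>r r'.
           \<Phi> x (r *\<^sub>R e + r' *\<^sub>R e') = r *\<^sub>R \<Phi> x e + r' *\<^sub>R \<Phi> x e') \<and>
        (\<forall>e\<in>fibre A x. anchor B (\<phi> x) (\<Phi> x e)
           = differential (base A) (base B) \<phi> x (anchor A x e))) \<and>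
     (\<forall>a. (\<forall>x\<in>mcarrier (base A). a x \<in> fibre A x) \<longrightarrow>
        (a \<in> sections A \<longleftrightarrow> push_section (mcarrier (base A)) \<phi> \<Phi> a \<in> sections B)) \<and>
     (\<forall>a\<in>sections A. \<forall>b\<in>sections A. \<forall>x\<in>mcarrier (base A).
        \<Phi> x (bracket A a b x) =
        bracket B (push_section (mcarrier (base A)) \<phi> \<Phi> a)
          (push_section (mcarrier (base A)) \<phi> \<Phi> b) (\<phi> x))"

subsection \<open>The Lie algebroid of a Lie groupoid\<close>

text \<open>
  For \<open>g\<close> with target \<open>y\<close> and \<open>v\<close> in \<open>ker ds\<close> at the unit of \<open>y\<close>, this is the differential at
  that unit, applied to \<open>v\<close>, of right translation \<open>h \<mapsto> h g\<close>. Right translation is defined only on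
  the source fibre over \<open>y\<close>; as \<open>v\<close> is tangent to that fibre, the value does not depend on
  the local extension \<open>F\<close>.
\<close>

definition right_translate ::
    "('g, 'e::euclidean_space) chart set \<Rightarrow> ('g, 'm) groupoid \<Rightarrow> 'g \<Rightarrow> 'e \<Rightarrow> 'e" where
  "right_translate G \<G> g v =
     (THE w. \<exists>W F. openin (mtopology G) W \<and> gunit \<G> (tgt \<G> g) \<in> W \<and>
        smooth_map (open_submanifold G W) G F \<and>
        (\<forall>h\<in>W. src \<G> h = tgt \<G> g \<longrightarrow> F h = gmult \<G> h g) \<and>
        w = differential G G F (gunit \<G> (tgt \<G> g)) v)"

definition right_invariant_vf ::
    "('g, 'e::euclidean_space) chart set \<Rightarrow> ('g, 'm) groupoid \<Rightarrow> ('m \<Rightarrow> 'e) \<Rightarrow> 'g \<Rightarrow> 'e" where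
  "right_invariant_vf G \<G> a g = right_translate G \<G> g (a (tgt \<G> g))"

definition ker_ds ::
    "('g, 'e::euclidean_space) chart set \<Rightarrow> ('m, 'f::euclidean_space) chart set \<Rightarrow>
     ('g, 'm) groupoid \<Rightarrow> 'm \<Rightarrow> 'e set" where
  "ker_ds G M \<G> x = {v. differential G M (src \<G>) (gunit \<G> x) v = 0}"

definition algebroid_of_groupoid ::
    "('g, 'e::euclidean_space) chart set \<Rightarrow> ('m, 'f::euclidean_space) chart set \<Rightarrow>
     ('g, 'm) groupoid \<Rightarrow> ('m, 'f, 'e) lie_algebroid" where
  "algebroid_of_groupoid G M \<G> =
     \<lparr>base = M,
      fibre = ker_ds G M \<G>,
      sections = {a. (\<forall>x\<in>mcarrier M. a x \<in> ker_ds G M \<G> x) \<and>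
        (\<forall>c\<in>G. smooth_map (open_submanifold M {x \<in> mcarrier M. gunit \<G> x \<in> fst c}) euclidean_atlas
           (\<lambda>x. tangent_in_chart G c (gunit \<G> x) (a x)))},
      anchor = (\<lambda>x v. differential G M (tgt \<G>) (gunit \<G> x) v),
      bracket = (\<lambda>a b x. vf_bracket G (right_invariant_vf G \<G> a) (right_invariant_vf G \<G> b)
        (gunit \<G> x))\<rparr>"

definition integrates_over ::
    "('m \<Rightarrow> 'n) \<Rightarrow> ('g, 'e::euclidean_space) chart set \<Rightarrow> ('n, 'f::euclidean_space) chart set \<Rightarrow>
     ('g, 'n) groupoid \<Rightarrow> ('m, 'k::euclidean_space, 'v::real_vector) lie_algebroid \<Rightarrow> bool" where
  "integrates_over \<phi> G M \<G> A \<longleftrightarrow> (\<exists>\<Phi>. lie_algebroid_iso A (algebroid_of_groupoid G M \<G>) \<phi> \<Phi>)"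

section \<open>The cotangent Lie algebroid of the elliptic Poisson structure\<close>

text \<open>
  An element of a fibre of the elliptic tangent bundle is written in the frame
  \<open>r \<partial>\<^sub>r = x\<^sub>1 \<partial>\<^sub>1 + x\<^sub>2 \<partial>\<^sub>2\<close>, \<open>\<partial>\<^sub>\<theta> = x\<^sub>1 \<partial>\<^sub>2 - x\<^sub>2 \<partial>\<^sub>1\<close>, \<open>\<partial>\<^sub>3\<close>, \<open>\<partial>\<^sub>4\<close>, whose dual frame is
  \<open>d log r\<close>, \<open>d\<theta>\<close>, \<open>dx\<^sub>3\<close>, \<open>dx\<^sub>4\<close>. Covectors are written in the dual frames, so that the pairing
  of a covector with a vector is the inner product of their component vectors.
\<close>

definition elliptic_anchor :: "real^4 \<Rightarrow> real^4 \<Rightarrow> real^4" where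
  "elliptic_anchor x e =
     (e$1) *\<^sub>R vector [x$1, x$2, 0, 0] + (e$2) *\<^sub>R vector [- (x$2), x$1, 0, 0] +
     (e$3) *\<^sub>R axis 3 1 + (e$4) *\<^sub>R axis 4 1"

text \<open>\<open>\<omega> = d log r \<and> dx\<^sub>3 + d\<theta> \<and> dx\<^sub>4\<close> and \<open>\<omega>\<^sup>\<flat>(e) = \<omega>(e, -)\<close>\<close>

definition elliptic_form :: "real^4 \<Rightarrow> real^4 \<Rightarrow> real" where
  "elliptic_form e f = (e$1 * f$3 - e$3 * f$1) + (e$2 * f$4 - e$4 * f$2)"

definition elliptic_flat :: "real^4 \<Rightarrow> real^4" where
  "elliptic_flat e = (\<chi> j. elliptic_form e (axis j 1))"

definition poisson_sharp :: "real^4 \<Rightarrow> real^4 \<Rightarrow> real^4" where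
  "poisson_sharp x = elliptic_anchor x \<circ> inv elliptic_flat \<circ> adjoint (elliptic_anchor x)"

text \<open>Lie derivative of the 1-form \<open>\<beta>\<close> along the vector field \<open>X\<close>, and differential of a function\<close>

definition lie_derivative :: "(real^4 \<Rightarrow> real^4) \<Rightarrow> (real^4 \<Rightarrow> real^4) \<Rightarrow> real^4 \<Rightarrow> real^4" where
  "lie_derivative X \<beta> x = (\<chi> j. (frechet_derivative \<beta> (at x) (X x)) $ j +
     \<beta> x \<bullet> frechet_derivative X (at x) (axis j 1))"

definition ext_d :: "(real^4 \<Rightarrow> real) \<Rightarrow> real^4 \<Rightarrow> real^4" where
  "ext_d f x = (\<chi> j. frechet_derivative f (at x) (axis j 1))"

text \<open>
  \<open>[\<alpha>, \<beta>] = L(\<pi>\<^sup>\<sharp>\<alpha>) \<beta> - L(\<pi>\<^sup>\<sharp>\<beta>) \<alpha> - d\<langle>\<beta>, \<pi>\<^sup>\<sharp>\<alpha>\<rangle>\<close>; for exact forms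
  \<open>[df, dg] = d\<langle>dg, \<pi>\<^sup>\<sharp> df\<rangle>\<close>.
\<close>

definition koszul_bracket :: "(real^4 \<Rightarrow> real^4) \<Rightarrow> (real^4 \<Rightarrow> real^4) \<Rightarrow> real^4 \<Rightarrow> real^4" where
  "koszul_bracket \<alpha> \<beta> x =
     lie_derivative (\<lambda>y. poisson_sharp y (\<alpha> y)) \<beta> x -
     lie_derivative (\<lambda>y. poisson_sharp y (\<beta> y)) \<alpha> x -
     ext_d (\<lambda>y. \<beta> y \<bullet> poisson_sharp y (\<alpha> y)) x"

definition cotangent_algebroid :: "(real^4, real^4, real^4) lie_algebroid" where
  "cotangent_algebroid =
     \<lparr>base = euclidean_atlas,
      fibre = (\<lambda>x. UNIV),
      sections = {\<alpha>. smooth_on UNIV \<alpha>},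
      anchor = poisson_sharp,
      bracket = koszul_bracket\<rparr>"

lemma vector_4_nth [simp]:
  "(vector [a, b, c, d] :: 'a::zero^4) $ 1 = a"
  "(vector [a, b, c, d] :: 'a::zero^4) $ 2 = b"
  "(vector [a, b, c, d] :: 'a::zero^4) $ 3 = c"
  "(vector [a, b, c, d] :: 'a::zero^4) $ 4 = d"
  unfolding vector_def by (simp_all add: eval_nat_numeral)

lemma elliptic_flat_eq: "elliptic_flat e = vector [- (e$3), - (e$4), e$1, e$2]"
  by (simp add: vec_eq_iff forall_4 elliptic_flat_def elliptic_form_def axis_def)

lemma inv_elliptic_flat: "inv elliptic_flat \<alpha> = vector [\<alpha>$3, \<alpha>$4, - (\<alpha>$1), - (\<alpha>$2)]"
  by (rule inv_f_eq) (auto simp: inj_def elliptic_flat_eq vec_eq_iff forall_4)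

lemma linear_elliptic_anchor: "linear (elliptic_anchor x)"
  by (rule linearI) (simp_all add: elliptic_anchor_def algebra_simps)

lemma adjoint_elliptic_anchor:
  "adjoint (elliptic_anchor x) \<alpha> =
     vector [x$1 * \<alpha>$1 + x$2 * \<alpha>$2, x$1 * \<alpha>$2 - x$2 * \<alpha>$1, \<alpha>$3, \<alpha>$4]"
proof -
  have "e \<bullet> adjoint (elliptic_anchor x) \<alpha> =
      e \<bullet> vector [x$1 * \<alpha>$1 + x$2 * \<alpha>$2, x$1 * \<alpha>$2 - x$2 * \<alpha>$1, \<alpha>$3, \<alpha>$4]" for e
    unfolding adjoint_works[OF linear_elliptic_anchor]
    by (simp add: inner_vec_def sum_4 elliptic_anchor_def axis_def algebra_simps)
  then show ?thesis by (metis vector_eq_ldot)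
qed

lemma poisson_sharp_eq:
  "poisson_sharp x \<alpha> =
     vector [x$1 * \<alpha>$3 - x$2 * \<alpha>$4, x$2 * \<alpha>$3 + x$1 * \<alpha>$4,
       - (x$1 * \<alpha>$1) - x$2 * \<alpha>$2, x$2 * \<alpha>$1 - x$1 * \<alpha>$2]"
  by (simp add: vec_eq_iff forall_4 poisson_sharp_def inv_elliptic_flat adjoint_elliptic_anchor
      elliptic_anchor_def axis_def algebra_simps)

text \<open>With \<open>\<pi>(\<alpha>, \<beta>) = \<langle>\<alpha>, \<pi>\<^sup>\<sharp>\<beta>\<rangle>\<close> this is \<open>\<pi> = r \<partial>\<^sub>r \<and> \<partial>\<^sub>3 + \<partial>\<^sub>\<theta> \<and> \<partial>\<^sub>4\<close>.\<close>

lemma poisson_bivector: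
  fixes x \<alpha> \<beta> :: "real^4"
  defines "R \<equiv> vector [x$1, x$2, 0, 0] :: real^4"
    and "T \<equiv> vector [- (x$2), x$1, 0, 0] :: real^4"
  shows "\<alpha> \<bullet> poisson_sharp x \<beta> =
    ((\<alpha> \<bullet> R) * \<beta>$3 - \<alpha>$3 * (\<beta> \<bullet> R)) + ((\<alpha> \<bullet> T) * \<beta>$4 - \<alpha>$4 * (\<beta> \<bullet> T))"
  by (simp add: R_def T_def poisson_sharp_eq inner_vec_def sum_4 algebra_simps)

definition complex_coordinates :: "real^4 \<Rightarrow> complex \<times> complex" where
  "complex_coordinates x = (Complex (x$1) (x$2), Complex (x$3) (x$4))"

text \<open>
  By \<open>poisson_sharp_eq\<close> the anchor maps \<open>-dx\<^sub>1\<close> and \<open>-dx\<^sub>2\<close> to \<open>x\<^sub>1 \<partial>\<^sub>3 - x\<^sub>2 \<partial>\<^sub>4\<close> and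
  \<open>x\<^sub>1 \<partial>\<^sub>4 + x\<^sub>2 \<partial>\<^sub>3\<close>. Hence the isomorphism onto the span of
  \<open>x\<^sub>1 \<partial>\<^sub>3 + x\<^sub>2 \<partial>\<^sub>4\<close>, \<open>x\<^sub>1 \<partial>\<^sub>4 - x\<^sub>2 \<partial>\<^sub>3\<close>, \<open>r \<partial>\<^sub>r\<close>, \<open>\<partial>\<^sub>\<theta>\<close> (in complex notation, of
  \<open>\<zeta> \<partial>\<^sub>\<eta>\<close> and \<open>\<zeta> \<partial>\<^sub>\<zeta>\<close>) covers the reflection \<open>x\<^sub>4 \<mapsto> -x\<^sub>4\<close>, not the identity: over the identity
  one would need \<open>\<zeta>\<close> to be a smooth multiple of its conjugate.
\<close>

definition reflection :: "real^4 \<Rightarrow> real^4" where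
  "reflection x = vector [x$1, x$2, x$3, - (x$4)]"

section \<open>The blow-up\<close>

type_synonym C4 = "(complex \<times> complex) \<times> (complex \<times> complex)"
type_synonym C3 = "complex \<times> complex \<times> complex"

definition center :: "C4 set" where
  "center = {((0, z), (0, z)) |z. True}"

text \<open>A linear map \<open>\<complex>\<^sup>4 \<rightarrow> \<complex>\<^sup>3\<close> identifying the normal spaces of \<open>center\<close> with \<open>\<complex>\<^sup>3\<close>\<close>

fun normal_coordinates :: "C4 \<Rightarrow> C3" where
  "normal_coordinates ((p, q), (p', q')) = (p, p', q' - q)"

lemma center_eq: "center = {x. normal_coordinates x = 0}"
  by (auto simp: center_def zero_prod_def)

fun cline :: "C3 \<Rightarrow> C3 set" where
  "cline (u, v, w) = {(k * u, k * v, k * w) |k. True}"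

definition CP2 :: "C3 set set" where
  "CP2 = {cline n |n. n \<noteq> 0}"

text \<open>
  The blow-up of \<open>\<complex>\<^sup>4\<close> along \<open>center\<close>: pairs of a point \<open>x\<close> and a complex line in the normal
  space containing the normal component of \<open>x\<close>.
\<close>

definition blowup :: "(C4 \<times> C3 set) set" where
  "blowup = {(x, l). l \<in> CP2 \<and> normal_coordinates x \<in> l}"

definition blowdown :: "C4 \<times> C3 set \<Rightarrow> C4" where
  "blowdown = fst"

text \<open>
  The standard affine charts, given by their inverses. In the first one the blow-down map is
  \<open>(z, a, b, c) \<mapsto> (a, z, ab, ac + z)\<close>.
\<close>

fun blowup_param1 :: "complex \<times> complex \<times> complex \<times> complex \<Rightarrow> C4 \<times> C3 set" where
  "blowup_param1 (z, a, b, c) = (((a, z), (a * b, a * c + z)), cline (1, b, c))"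

fun blowup_param2 :: "complex \<times> complex \<times> complex \<times> complex \<Rightarrow> C4 \<times> C3 set" where
  "blowup_param2 (z, a, b, c) = (((a * b, z), (a, a * c + z)), cline (b, 1, c))"

fun blowup_param3 :: "complex \<times> complex \<times> complex \<times> complex \<Rightarrow> C4 \<times> C3 set" where
  "blowup_param3 (z, a, b, c) = (((a * b, z), (a * c, a + z)), cline (b, c, 1))"

definition blowup_atlas :: "(C4 \<times> C3 set, complex \<times> complex \<times> complex \<times> complex) chart set" where
  "blowup_atlas = (\<lambda>\<psi>. (range \<psi>, inv \<psi>)) ` {blowup_param1, blowup_param2, blowup_param3}"

lemma inj_blowup_params: "inj blowup_param1" "inj blowup_param2" "inj blowup_param3"
proof -
  have 1: "b = b' \<and> c = c'" if "cline (1, b, c) = cline (1, b', c')" for b c b' c'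
  proof -
    have "(1, b, c) \<in> cline (1, b, c)" by (auto intro: exI[of _ 1])
    with that show ?thesis by auto
  qed
  have 2: "b = b' \<and> c = c'" if "cline (b, 1, c) = cline (b', 1, c')" for b c b' c'
  proof -
    have "(b, 1, c) \<in> cline (b, 1, c)" by (auto intro: exI[of _ 1])
    with that show ?thesis by auto
  qed
  have 3: "b = b' \<and> c = c'" if "cline (b, c, 1) = cline (b', c', 1)" for b c b' c'
  proof -
    have "(b, c, 1) \<in> cline (b, c, 1)" by (auto intro: exI[of _ 1])
    with that show ?thesis by auto
  qed
  show "inj blowup_param1" "inj blowup_param2" "inj blowup_param3"
    using 1 2 3 by (auto simp: inj_def simp del: cline.simps)
qed

lemma cline_scale:
  assumes k: "k \<noteq> 0"
  shows "cline (k * u, k * v, k * w) = cline (u, v, w)"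
proof (intro set_eqI iffI)
  fix n assume "n \<in> cline (k * u, k * v, k * w)"
  then obtain j where n: "n = (j * (k * u), j * (k * v), j * (k * w))" by auto
  show "n \<in> cline (u, v, w)" unfolding n by (auto intro!: exI[of _ "j * k"])
next
  fix n assume "n \<in> cline (u, v, w)"
  then obtain j where n: "n = (j * u, j * v, j * w)" by auto
  show "n \<in> cline (k * u, k * v, k * w)" unfolding n using k by (auto intro!: exI[of _ "j / k"])
qed

lemma mcarrier_blowup_atlas: "mcarrier blowup_atlas = blowup"
proof
  have "cline n \<in> CP2" if "n \<noteq> 0" for n
    unfolding CP2_def using that by blast
  then have "blowup_param1 n \<in> blowup" "blowup_param2 n \<in> blowup" "blowup_param3 n \<in> blowup" for n
    by (cases n; simp add: blowup_def zero_prod_def del: cline.simps, simp)+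
  then show "mcarrier blowup_atlas \<subseteq> blowup"
    unfolding mcarrier_def blowup_atlas_def by auto
  show "blowup \<subseteq> mcarrier blowup_atlas"
  proof
    fix y assume "y \<in> blowup"
    then obtain p q p' q' u v w k where y: "y = (((p, q), (p', q')), cline (u, v, w))"
      and n: "(u, v, w) \<noteq> 0" and k: "p = k * u" "p' = k * v" "q' - q = k * w"
      unfolding blowup_def CP2_def by auto
    have q': "q' = k * w + q" using k(3) by (simp add: algebra_simps)
    consider "u \<noteq> 0" | "v \<noteq> 0" | "w \<noteq> 0" using n by (auto simp: zero_prod_def)
    then show "y \<in> mcarrier blowup_atlas"
    proof cases
      case 1
      then have "y = blowup_param1 (q, p, v / u, w / u)"
        using k q' cline_scale[of u 1 "v / u" "w / u"] unfolding y by (simp del: cline.simps)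
      then have "y \<in> range blowup_param1" by (rule range_eqI)
      then show ?thesis unfolding mcarrier_def blowup_atlas_def by simp
    next
      case 2
      then have "y = blowup_param2 (q, p', u / v, w / v)"
        using k q' cline_scale[of v "u / v" 1 "w / v"] unfolding y by (simp del: cline.simps)
      then have "y \<in> range blowup_param2" by (rule range_eqI)
      then show ?thesis unfolding mcarrier_def blowup_atlas_def by simp
    next
      case 3
      then have "y = blowup_param3 (q, q' - q, u / w, v / w)"
        using k q' cline_scale[of w "u / w" "v / w" 1] unfolding y by (simp del: cline.simps)
      then have "y \<in> range blowup_param3" by (rule range_eqI)
      then show ?thesis unfolding mcarrier_def blowup_atlas_def by simp
    qed
  qed
qed

text \<open>\<open>\<complex>\<^sup>* \<times> \<complex>\<close>\<close>

definition punctured :: "(complex \<times> complex) set" where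
  "punctured = (UNIV - {0}) \<times> UNIV"

definition removed :: "C4 set" where
  "removed = ({0} \<times> UNIV) \<times> ((UNIV - {0}) \<times> UNIV) \<union> ((UNIV - {0}) \<times> UNIV) \<times> ({0} \<times> UNIV)"

definition G_space :: "(C4 \<times> C3 set) set" where
  "G_space = blowup - mtopology blowup_atlas closure_of {y \<in> blowup. blowdown y \<in> removed}"

definition G_atlas :: "(C4 \<times> C3 set, complex \<times> complex \<times> complex \<times> complex) chart set" where
  "G_atlas = open_submanifold blowup_atlas G_space"

definition pair_part :: "(C4 \<times> C3 set) set" where
  "pair_part = {y \<in> blowup. blowdown y \<in> punctured \<times> punctured}"

end

theory Submission
  imports Defs
begin

text \<open>
  Removing the closure of the two divisors leaves the part \<open>b \<noteq> 0\<close> of the first affine chart of the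
  blow-up, so \<open>\<G>\<close> has global coordinates \<open>(z, a, b, c)\<close>. Transporting the pair groupoid along
  \<open>(z, a, b, c) \<mapsto> ((a, z), (ab, ac + z))\<close> gives the multiplication
  \<open>(z, a, b, c) (z', a', b', c') = (z, a, b b', c + b c')\<close>, in which no division by \<open>a\<close> is left: this is the
  action groupoid of the affine group of \<open>\<complex>\<close> on \<open>\<complex>\<^sup>2\<close>, and it is defined also for \<open>a = 0\<close>. The extension is unique
  because \<open>a \<noteq> 0\<close> is dense, also among the composable pairs.

  At the unit \<open>(q, p, 1, 0)\<close> the kernel of \<open>ds\<close> consists of the vectors \<open>(- p \<gamma>, - p \<beta>, \<beta>, \<gamma>)\<close>, and these
  extend to the right-invariant fields \<open>(- a \<gamma>, - a \<beta>, b \<beta>, \<gamma> + c \<beta>)\<close>. The covector \<open>\<alpha>\<close> is sent to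
  \<open>\<beta> = - (\<alpha>\<^sub>3 + i \<alpha>\<^sub>4)\<close>, \<open>\<gamma> = \<alpha>\<^sub>1 - i \<alpha>\<^sub>2\<close>, as forced by compatibility of the anchors where \<open>p \<noteq> 0\<close>.
  For the brackets one uses that
  \<open>[\<alpha>, \<beta>] = D\<beta>(\<pi>\<^sup>\<sharp>\<alpha>) - D\<alpha>(\<pi>\<^sup>\<sharp>\<beta>) - (\<alpha> \<bullet> \<pi>\<^sup>\<sharp>(e\<^sub>j) \<beta>)\<^sub>j\<close>, as \<open>\<pi>\<close> is linear in the base point.
\<close>

section \<open>Smooth functions\<close>

text \<open>Write an arrow over \<open>pair_part\<close> as a pair of points (p, q), (p', q'). The
  coordinates b = p'/p and c = (q' - q)/p are affine coordinates of the blown-up normal direction,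
  and they obey p''/p = (p'/p) (p''/p') and (q'' - q)/p = (q' - q)/p + (p'/p) (q'' - q')/p'. This
  telescoping is why the multiplication stays polynomial where p = 0.

  The remaining weight lies in the definitions. A tangent vector is stored as its expression in the
  chart that \<open>chart_at\<close> selects, and the charts of \<open>G_atlas\<close> are
  restrictions of all three affine charts, so nothing can be computed before it is carried to the
  global chart. For the bracket this means invariance under a change of chart, hence symmetry of
  second derivatives. Right translation is a definite description over all local extensions, so
  these must be shown to have a common differential on the kernel of ds. Smoothness of a competing
  multiplication is known only through local extensions from the composable pairs, so the density
  argument has to run along curves of composable pairs.\<close>

lemma Ck_on_SucD:
  assumes "Ck_on (Suc k) S f" "x \<in> S"
  shows "(f has_derivative frechet_derivative f (at x)) (at x)"
  using assms by (simp add: frechet_derivative_works)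

lemma Ck_on_lower: "Ck_on (Suc k) S f \<Longrightarrow> Ck_on k S f"
proof (induction k arbitrary: f)
  case 0
  then show ?case
    by (auto intro!: continuous_at_imp_continuous_on differentiable_imp_continuous_within)
qed auto

lemma Ck_on_subset: "Ck_on k S f \<Longrightarrow> T \<subseteq> S \<Longrightarrow> Ck_on k T f"
  by (induction k arbitrary: f) (auto intro: continuous_on_subset)

text \<open>A derivative at a point of an open set sees only the values on that set. This lets a
  chart expression be replaced by a formula that is valid on the chart image alone.\<close>

lemma frechet_derivative_cong_open:
  assumes "open S" "x \<in> S" "\<And>y. y \<in> S \<Longrightarrow> f y = g y" "f differentiable (at x)"
  shows "g differentiable (at x)" "frechet_derivative f (at x) = frechet_derivative g (at x)"
proof -
  have f: "(f has_derivative frechet_derivative f (at x)) (at x)"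
    using assms(4) by (simp add: frechet_derivative_works)
  have g: "(g has_derivative frechet_derivative f (at x)) (at x)"
    by (rule has_derivative_transform_within_open[OF f assms(1,2)]) (use assms(3) in auto)
  then show "g differentiable (at x)" by (auto simp: differentiable_def)
  from g show "frechet_derivative f (at x) = frechet_derivative g (at x)"
    by (rule frechet_derivative_at)
qed

text \<open>For k > 0, \<open>Ck_on\<close> uses derivatives in the ambient space; openness of S
  makes S a neighbourhood of each of its points, so that the values on S control them.\<close>

lemma Ck_on_cong:
  assumes "open S" "Ck_on k S f" "\<And>x. x \<in> S \<Longrightarrow> f x = g x"
  shows "Ck_on k S g"
  using assms(2,3)
proof (induction k arbitrary: f g)
  case 0
  then show ?case by (simp cong: continuous_on_cong)
next
  case (Suc k)
  have d: "g differentiable (at x)" "frechet_derivative f (at x) = frechet_derivative g (at x)"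
    if "x \<in> S" for x
    using frechet_derivative_cong_open[OF assms(1) that, of f g] Suc.prems that by auto
  have "Ck_on k S (\<lambda>x. frechet_derivative g (at x) v)" for v
    by (rule Suc.IH[of "\<lambda>x. frechet_derivative f (at x) v"]) (use Suc.prems d in auto)
  then show ?case using d by simp
qed

text \<open>Lets an explicit derivative stand for \<open>frechet_derivative\<close>, so that a
  closure property can differentiate once by the matching calculus rule and then appeal to its
  induction hypothesis.\<close>

lemma Ck_on_SucI:
  assumes "open S" "\<And>x. x \<in> S \<Longrightarrow> (f has_derivative f' x) (at x)" "\<And>v. Ck_on k S (\<lambda>x. f' x v)"
  shows "Ck_on (Suc k) S f"
proof -
  have eq: "f' x = frechet_derivative f (at x)" if "x \<in> S" for x
    using assms(2)[OF that] by (rule frechet_derivative_at)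
  have "Ck_on k S (\<lambda>x. frechet_derivative f (at x) v)" for v
    by (rule Ck_on_cong[OF assms(1) assms(3)[of v]]) (simp add: eq)
  then show ?thesis using assms(2) by (auto simp: differentiable_def)
qed

lemma Ck_on_const: "open S \<Longrightarrow> Ck_on k S (\<lambda>x. c)"
proof (induction k arbitrary: c)
  case (Suc k)
  show ?case by (rule Ck_on_SucI[where f' = "\<lambda>x v. 0"]) (use Suc in auto)
qed simp

lemma Ck_on_bounded_linear_compose:
  assumes "open S" "bounded_linear L" "Ck_on k S f"
  shows "Ck_on k S (\<lambda>x. L (f x))"
  using assms(3)
proof (induction k arbitrary: f)
  case 0
  then show ?case using bounded_linear.continuous_on[OF assms(2)] by simp
next
  case (Suc k)
  show ?case
    by (rule Ck_on_SucI[where f' = "\<lambda>x v. L (frechet_derivative f (at x) v)"])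
      (use Suc assms Ck_on_SucD[OF Suc.prems] in \<open>auto intro: bounded_linear.has_derivative\<close>)
qed

lemma Ck_on_id: "open S \<Longrightarrow> Ck_on k S (\<lambda>x. x)"
proof (cases k)
  case (Suc k)
  assume "open S"
  then show ?thesis unfolding Suc
    by (intro Ck_on_SucI[where f' = "\<lambda>x v. v"]) (auto intro: Ck_on_const)
qed simp

lemma Ck_on_add:
  assumes "open S" "Ck_on k S f" "Ck_on k S g"
  shows "Ck_on k S (\<lambda>x. f x + g x)"
  using assms(2,3)
proof (induction k arbitrary: f g)
  case 0
  then show ?case by (simp add: continuous_on_add)
next
  case (Suc k)
  show ?case
    by (rule Ck_on_SucI[where
          f' = "\<lambda>x v. frechet_derivative f (at x) v + frechet_derivative g (at x) v"])
      (use Suc assms Ck_on_SucD[OF Suc.prems(1)] Ck_on_SucD[OF Suc.prems(2)] in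
        \<open>auto intro: has_derivative_add\<close>)
qed

lemma Ck_on_sum:
  assumes "open S" "\<And>i. i \<in> I \<Longrightarrow> Ck_on k S (f i)"
  shows "Ck_on k S (\<lambda>x. \<Sum>i\<in>I. f i x)"
  using assms(2)
  by (induction I rule: infinite_finite_induct) (auto intro: Ck_on_const Ck_on_add assms(1))

lemma Ck_on_bounded_bilinear:
  assumes "open S" "bounded_bilinear pr" "Ck_on k S f" "Ck_on k S g"
  shows "Ck_on k S (\<lambda>x. pr (f x) (g x))"
  using assms(3,4)
proof (induction k arbitrary: f g)
  case 0
  then show ?case using bounded_bilinear.continuous_on[OF assms(2)] by simp
next
  case (Suc k)
  show ?case
  proof (rule Ck_on_SucI[OF assms(1), where f' = "\<lambda>x v. pr (f x) (frechet_derivative g (at x) v) +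
          pr (frechet_derivative f (at x) v) (g x)"])
    show "((\<lambda>x. pr (f x) (g x)) has_derivative (\<lambda>v. pr (f x) (frechet_derivative g (at x) v) +
          pr (frechet_derivative f (at x) v) (g x))) (at x)" if "x \<in> S" for x
      using bounded_bilinear.FDERIV[OF assms(2)] Ck_on_SucD[OF Suc.prems(1) that]
        Ck_on_SucD[OF Suc.prems(2) that] by blast
    \<comment> \<open>Each product pairs a first derivative, of class k, with an original factor,
      lowered from class k + 1 to k; the induction hypothesis is general in both factors.\<close>
    show "Ck_on k S (\<lambda>x. pr (f x) (frechet_derivative g (at x) v) +
          pr (frechet_derivative f (at x) v) (g x))" for v
      using Suc Ck_on_lower[OF Suc.prems(1)] Ck_on_lower[OF Suc.prems(2)]
      by (intro Ck_on_add[OF assms(1)] Suc.IH) auto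
  qed
qed

text \<open>The derivative of 1/f is -(1/f) f' (1/f); besides f' it contains only 1/f itself, which
  is of class k by induction.\<close>

lemma Ck_on_inverse:
  fixes f :: "'a::real_normed_vector \<Rightarrow> 'b::real_normed_field"
  assumes "open S" "Ck_on k S f" "\<And>x. x \<in> S \<Longrightarrow> f x \<noteq> 0"
  shows "Ck_on k S (\<lambda>x. inverse (f x))"
  using assms(2)
proof (induction k)
  case 0
  then show ?case using assms(3) by (simp add: continuous_on_inverse)
next
  case (Suc k)
  show ?case
  proof (rule Ck_on_SucI[OF assms(1), where
          f' = "\<lambda>x v. (- 1) * (inverse (f x) * frechet_derivative f (at x) v * inverse (f x))"])
    show "((\<lambda>x. inverse (f x)) has_derivative
        (\<lambda>v. (- 1) * (inverse (f x) * frechet_derivative f (at x) v * inverse (f x)))) (at x)"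
      if "x \<in> S" for x
      using Deriv.has_derivative_inverse[OF assms(3)[OF that] Ck_on_SucD[OF Suc.prems that]] by simp
    show "Ck_on k S (\<lambda>x. (- 1) * (inverse (f x) * frechet_derivative f (at x) v * inverse (f x)))" for v
      using Suc Ck_on_lower[OF Suc.prems]
      by (intro Ck_on_bounded_bilinear[OF assms(1) bounded_bilinear_mult] Ck_on_const assms(1)) auto
  qed
qed

lemma linear_sum_Basis:
  fixes v :: "'a::euclidean_space"
  assumes "linear L"
  shows "L v = (\<Sum>e\<in>Basis. (v \<bullet> e) *\<^sub>R L e)"
proof -
  have "L v = L (\<Sum>e\<in>Basis. (v \<bullet> e) *\<^sub>R e)" by (simp add: euclidean_representation)
  also have "\<dots> = (\<Sum>e\<in>Basis. (v \<bullet> e) *\<^sub>R L e)"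
    using assms by (simp add: linear_sum linear_cmul)
  finally show ?thesis .
qed

text \<open>In the chain rule the derivative of \<open>g\<close> is applied to a vector that moves
  with x, whereas \<open>Ck_on\<close> controls derivatives along fixed vectors. Expanding the
  moving vector in \<open>Basis\<close> gives a finite sum of products of functions of class k; this
  is why the middle space is Euclidean.\<close>

lemma Ck_on_compose:
  fixes f :: "'a::real_normed_vector \<Rightarrow> 'b::euclidean_space"
    and g :: "'b \<Rightarrow> 'c::real_normed_vector"
  assumes "open S" "open T" "f ` S \<subseteq> T" "Ck_on k S f" "Ck_on k T g"
  shows "Ck_on k S (\<lambda>x. g (f x))"
  using assms(4,5)
proof (induction k arbitrary: g)
  case 0
  then show ?case using continuous_on_compose2[of T g S f] assms(3) by simp
next
  case (Suc k)
  let ?D = "\<lambda>x v. \<Sum>e\<in>Basis. (frechet_derivative f (at x) v \<bullet> e) *\<^sub>R frechet_derivative g (at (f x)) e"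
  show ?case
  proof (rule Ck_on_SucI[OF assms(1), where f' = ?D])
    fix x assume x: "x \<in> S"
    have f: "(f has_derivative frechet_derivative f (at x)) (at x)"
      using Ck_on_SucD[OF Suc.prems(1) x] .
    have g: "(g has_derivative frechet_derivative g (at (f x))) (at (f x))"
      using Ck_on_SucD[OF Suc.prems(2)] x assms(3) by blast
    have "((\<lambda>x. g (f x)) has_derivative
        (\<lambda>v. frechet_derivative g (at (f x)) (frechet_derivative f (at x) v))) (at x)"
      using has_derivative_compose[OF f g] .
    also have "(\<lambda>v. frechet_derivative g (at (f x)) (frechet_derivative f (at x) v)) = ?D x"
      using linear_sum_Basis[OF has_derivative_linear[OF g]] by blast
    finally show "((\<lambda>x. g (f x)) has_derivative ?D x) (at x)" .
  next
    fix v
    have "Ck_on k S (\<lambda>x. frechet_derivative g (at (f x)) e)" for e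
      using Suc.IH[of "\<lambda>y. frechet_derivative g (at y) e"] Suc.prems Ck_on_lower by auto
    moreover have "Ck_on k S (\<lambda>x. frechet_derivative f (at x) v \<bullet> e)" for e
      by (rule Ck_on_bounded_linear_compose[OF assms(1) bounded_linear_inner_left])
        (use Suc.prems(1) in simp)
    ultimately show "Ck_on k S (\<lambda>x. ?D x v)"
      by (intro Ck_on_sum Ck_on_bounded_bilinear[OF assms(1) bounded_bilinear_scaleR] assms(1))
  qed
qed

lemma smooth_on_imp_continuous_on: "smooth_on S f \<Longrightarrow> continuous_on S f"
  unfolding smooth_on_def using Ck_on.simps(1) by blast

lemma smooth_on_has_derivative:
  assumes "smooth_on S f" "x \<in> S"
  shows "(f has_derivative frechet_derivative f (at x)) (at x)"
  using assms Ck_on_SucD unfolding smooth_on_def by blast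

lemma smooth_on_frechet_derivative:
  "smooth_on S f \<Longrightarrow> smooth_on S (\<lambda>x. frechet_derivative f (at x) v)"
  unfolding smooth_on_def by (metis Ck_on.simps(2))

lemma smooth_on_subset: "smooth_on S f \<Longrightarrow> T \<subseteq> S \<Longrightarrow> smooth_on T f"
  unfolding smooth_on_def using Ck_on_subset by blast

lemma smooth_on_cong:
  assumes "open S" "smooth_on S f" "\<And>x. x \<in> S \<Longrightarrow> f x = g x"
  shows "smooth_on S g"
  using assms Ck_on_cong unfolding smooth_on_def by blast

lemma smooth_on_compose:
  fixes f :: "'a::real_normed_vector \<Rightarrow> 'b::euclidean_space"
    and g :: "'b \<Rightarrow> 'c::real_normed_vector"
  assumes "open S" "open T" "f ` S \<subseteq> T" "smooth_on S f" "smooth_on T g"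
  shows "smooth_on S (\<lambda>x. g (f x))"
  using assms Ck_on_compose unfolding smooth_on_def by blast

lemma smooth_on_bounded_linear_compose:
  assumes "bounded_linear L" "open S" "smooth_on S f"
  shows "smooth_on S (\<lambda>x. L (f x))"
  using assms Ck_on_bounded_linear_compose unfolding smooth_on_def by blast

lemma smooth_on_bounded_linear: "bounded_linear L \<Longrightarrow> open S \<Longrightarrow> smooth_on S L"
  by (rule smooth_on_bounded_linear_compose[where f = "\<lambda>x. x"]) (simp_all add: smooth_on_def Ck_on_id)

lemma smooth_on_bounded_bilinear:
  assumes "bounded_bilinear pr" "open S" "smooth_on S f" "smooth_on S g"
  shows "smooth_on S (\<lambda>x. pr (f x) (g x))"
  using assms Ck_on_bounded_bilinear unfolding smooth_on_def by blast

lemma smooth_on_id: "open S \<Longrightarrow> smooth_on S (\<lambda>x. x)"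
  unfolding smooth_on_def by (simp add: Ck_on_id)

lemma smooth_on_const: "open S \<Longrightarrow> smooth_on S (\<lambda>x. c)"
  unfolding smooth_on_def by (simp add: Ck_on_const)

lemma smooth_on_add:
  "open S \<Longrightarrow> smooth_on S f \<Longrightarrow> smooth_on S g \<Longrightarrow> smooth_on S (\<lambda>x. f x + g x)"
  unfolding smooth_on_def by (simp add: Ck_on_add)

lemma smooth_on_sum:
  "open S \<Longrightarrow> (\<And>i. i \<in> I \<Longrightarrow> smooth_on S (f i)) \<Longrightarrow> smooth_on S (\<lambda>x. \<Sum>i\<in>I. f i x)"
  unfolding smooth_on_def by (simp add: Ck_on_sum)

lemma smooth_on_inverse:
  fixes f :: "'a::real_normed_vector \<Rightarrow> 'b::real_normed_field"
  shows "open S \<Longrightarrow> smooth_on S f \<Longrightarrow> (\<And>x. x \<in> S \<Longrightarrow> f x \<noteq> 0) \<Longrightarrow> smooth_on S (\<lambda>x. inverse (f x))"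
  unfolding smooth_on_def by (simp add: Ck_on_inverse)

lemmas smooth_on_mult = smooth_on_bounded_bilinear[OF bounded_bilinear_mult]
lemmas smooth_on_fst = smooth_on_bounded_linear_compose[OF bounded_linear_fst]
lemmas smooth_on_snd = smooth_on_bounded_linear_compose[OF bounded_linear_snd]

lemma smooth_on_minus: "open S \<Longrightarrow> smooth_on S f \<Longrightarrow> smooth_on S (\<lambda>x. - f x)"
  by (rule smooth_on_bounded_linear_compose[OF bounded_linear_minus[OF bounded_linear_ident]])

lemma smooth_on_diff:
  "open S \<Longrightarrow> smooth_on S f \<Longrightarrow> smooth_on S g \<Longrightarrow> smooth_on S (\<lambda>x. f x - g x)"
  using smooth_on_add[OF _ _ smooth_on_minus, of S f g] by simp

lemma smooth_on_divide:
  fixes f :: "'a::real_normed_vector \<Rightarrow> 'b::real_normed_field"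
  shows "open S \<Longrightarrow> smooth_on S f \<Longrightarrow> smooth_on S g \<Longrightarrow> (\<And>x. x \<in> S \<Longrightarrow> g x \<noteq> 0) \<Longrightarrow>
    smooth_on S (\<lambda>x. f x / g x)"
  by (simp add: divide_inverse smooth_on_mult smooth_on_inverse)

lemma smooth_on_Pair:
  assumes "open S" "smooth_on S f" "smooth_on S g"
  shows "smooth_on S (\<lambda>x. (f x, g x))"
proof -
  have "smooth_on S (\<lambda>x. (f x, 0) + (0, g x))"
    using assms
    by (intro smooth_on_add smooth_on_bounded_linear_compose[where L = "\<lambda>y. (y, 0)"]
        smooth_on_bounded_linear_compose[where L = "\<lambda>y. (0, y)"])
      (auto intro: bounded_linear_Pair)
  then show ?thesis by simp
qed

lemmas smooth_intros = smooth_on_id smooth_on_const smooth_on_add smooth_on_diff smooth_on_minus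
  smooth_on_mult smooth_on_divide smooth_on_fst smooth_on_snd smooth_on_Pair

text \<open>Again the moving direction is expanded in \<open>Basis\<close>. It serves to read a
  section of the kernel of ds in an arbitrary chart, where it is a transition derivative applied to
  a smooth vector function.\<close>

lemma smooth_on_derivative_apply:
  fixes f :: "'b::euclidean_space \<Rightarrow> 'c::real_normed_vector"
  assumes "open S" "open T" "smooth_on T f" "smooth_on S g" "g ` S \<subseteq> T" "smooth_on S h"
  shows "smooth_on S (\<lambda>x. frechet_derivative f (at (g x)) (h x))"
proof (rule smooth_on_cong[OF assms(1)])
  show "smooth_on S (\<lambda>x. \<Sum>e\<in>Basis. (h x \<bullet> e) *\<^sub>R frechet_derivative f (at (g x)) e)"
    by (rule smooth_on_sum[OF assms(1)], rule smooth_on_bounded_bilinear[OF bounded_bilinear_scaleR assms(1)],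
        rule smooth_on_bounded_linear_compose[OF bounded_linear_inner_left assms(1,6)],
        rule smooth_on_compose[OF assms(1,2,5,4) smooth_on_frechet_derivative[OF assms(3)]])
  show "(\<Sum>e\<in>Basis. (h x \<bullet> e) *\<^sub>R frechet_derivative f (at (g x)) e)
      = frechet_derivative f (at (g x)) (h x)" if "x \<in> S" for x
    using smooth_on_has_derivative[OF assms(3), of "g x"] that assms(5)
    by (intro linear_sum_Basis[symmetric] has_derivative_linear) auto
qed

section \<open>Symmetry of mixed second derivatives\<close>

lemma frechet_derivative_compose_eq:
  assumes "(f has_derivative f') (at x)" "(g has_derivative g') (at (f x))"
  shows "frechet_derivative (\<lambda>x. g (f x)) (at x) v = g' (f' v)"
  using frechet_derivative_at[OF has_derivative_compose[OF assms]] by (metis)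

text \<open>By the mean value theorem, applied once in each direction, the second difference is \<open>h\<^sup>2\<close> times a
  value of the second derivative at a nearby point.\<close>

lemma second_difference_estimate:
  fixes f :: "'a::real_normed_vector \<Rightarrow> real" and u v :: 'a
  assumes S: "open S" "x \<in> S" and f: "smooth_on S f" and e: "e > 0"
  defines "dd \<equiv> \<lambda>y. frechet_derivative (\<lambda>y. frechet_derivative f (at y) u) (at y) v"
  shows "\<exists>d>0. \<forall>h. 0 < h \<and> h < d \<longrightarrow>
    \<bar>(f (x + h *\<^sub>R u + h *\<^sub>R v) - f (x + h *\<^sub>R u) - f (x + h *\<^sub>R v) + f x) - h * h * dd x\<bar> \<le> e * (h * h)"
proof -
  have fu: "smooth_on S (\<lambda>y. frechet_derivative f (at y) u)"
    using f by (rule smooth_on_frechet_derivative)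
  have "continuous_on S dd"
    unfolding dd_def by (intro smooth_on_imp_continuous_on smooth_on_frechet_derivative fu)
  then have "isCont dd x" using S continuous_on_eq_continuous_at by blast
  then obtain r1 where r1: "r1 > 0" "\<And>y. dist y x < r1 \<Longrightarrow> dist (dd y) (dd x) < e"
    using e by (auto simp: continuous_at_eps_delta)
  obtain r2 where r2: "r2 > 0" "ball x r2 \<subseteq> S"
    using S open_contains_ball by blast
  define r where "r = min r1 r2"
  \<comment> \<open>Chosen so that the parallelogram of all x + s u + t v with 0 <= s, t < d lies in
    the ball of radius r; the summand 1 covers u = v = 0.\<close>
  define d where "d = r / (norm u + norm v + 1)"
  have d: "d > 0" using r1 r2 by (auto simp: d_def r_def intro!: divide_pos_pos add_nonneg_pos)
  have near: "dist (x + s *\<^sub>R u + t *\<^sub>R v) x < r" if st: "0 \<le> s" "s < d" "0 \<le> t" "t < d" for s t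
  proof -
    have "dist (x + s *\<^sub>R u + t *\<^sub>R v) x = norm (s *\<^sub>R u + t *\<^sub>R v)"
      by (simp add: dist_norm)
    also have "\<dots> \<le> s * norm u + t * norm v"
      using norm_triangle_ineq[of "s *\<^sub>R u" "t *\<^sub>R v"] st by simp
    also have "\<dots> \<le> d * norm u + d * norm v"
      using st by (intro add_mono mult_right_mono) auto
    also have "\<dots> < d * (norm u + norm v + 1)" using d by (simp add: algebra_simps)
    also have "\<dots> = r"
      unfolding d_def by (simp add: add_nonneg_eq_0_iff add_nonneg_pos less_imp_neq[symmetric])
    finally show ?thesis .
  qed
  then have inS: "x + s *\<^sub>R u + t *\<^sub>R v \<in> S" if "0 \<le> s" "s < d" "0 \<le> t" "t < d" for s t
    using r2 that by (auto simp: r_def dist_commute subset_iff)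
  have "\<bar>(f (x + h *\<^sub>R u + h *\<^sub>R v) - f (x + h *\<^sub>R u) - f (x + h *\<^sub>R v) + f x) - h * h * dd x\<bar>
      \<le> e * (h * h)" if h: "0 < h" "h < d" for h
  proof -
    \<comment> \<open>The second difference is the increment of \<open>p\<close> from 0 to h. The
      dummy \<open>0 *\<^sub>R v\<close> gives both terms the shape for which \<open>line\<close> is
      stated.\<close>
    define p where "p = (\<lambda>s. f (x + s *\<^sub>R u + h *\<^sub>R v) - f (x + s *\<^sub>R u + 0 *\<^sub>R v))"
    have line: "((\<lambda>s. F (x + s *\<^sub>R u + t *\<^sub>R v)) has_real_derivative
        frechet_derivative F (at (x + s *\<^sub>R u + t *\<^sub>R v)) u) (at s)"
      if "smooth_on S F" "0 \<le> s" "s < d" "0 \<le> t" "t < d" for F :: "'a \<Rightarrow> real" and s t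
    proof -
      let ?D = "frechet_derivative F (at (x + s *\<^sub>R u + t *\<^sub>R v))"
      have D: "(F has_derivative ?D) (at (x + s *\<^sub>R u + t *\<^sub>R v))"
        using smooth_on_has_derivative[OF that(1) inS] that by auto
      have "((\<lambda>s. F (x + s *\<^sub>R u + t *\<^sub>R v)) has_derivative (\<lambda>k. ?D (k *\<^sub>R u))) (at s)"
        by (rule has_derivative_compose[where f = "\<lambda>s. x + s *\<^sub>R u + t *\<^sub>R v", OF _ D]) (auto intro!: derivative_eq_intros)
      moreover have "(\<lambda>k. ?D (k *\<^sub>R u)) = (*) (?D u)"
        using linear_cmul[OF has_derivative_linear[OF D]] by (auto simp: mult.commute)
      ultimately show ?thesis by (simp add: has_field_derivative_def)
    qed
    have line': "((\<lambda>t. F (x + s *\<^sub>R u + t *\<^sub>R v)) has_real_derivative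
        frechet_derivative F (at (x + s *\<^sub>R u + t *\<^sub>R v)) v) (at t)"
      if "smooth_on S F" "0 \<le> s" "s < d" "0 \<le> t" "t < d" for F :: "'a \<Rightarrow> real" and s t
    proof -
      let ?D = "frechet_derivative F (at (x + s *\<^sub>R u + t *\<^sub>R v))"
      have D: "(F has_derivative ?D) (at (x + s *\<^sub>R u + t *\<^sub>R v))"
        using smooth_on_has_derivative[OF that(1) inS] that by auto
      have "((\<lambda>t. F (x + s *\<^sub>R u + t *\<^sub>R v)) has_derivative (\<lambda>k. ?D (k *\<^sub>R v))) (at t)"
        by (rule has_derivative_compose[where f = "\<lambda>t. x + s *\<^sub>R u + t *\<^sub>R v", OF _ D]) (auto intro!: derivative_eq_intros)
      moreover have "(\<lambda>k. ?D (k *\<^sub>R v)) = (*) (?D v)"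
        using linear_cmul[OF has_derivative_linear[OF D]] by (auto simp: mult.commute)
      ultimately show ?thesis by (simp add: has_field_derivative_def)
    qed
    define p' where "p' = (\<lambda>s. frechet_derivative f (at (x + s *\<^sub>R u + h *\<^sub>R v)) u -
      frechet_derivative f (at (x + s *\<^sub>R u + 0 *\<^sub>R v)) u)"
    have "\<exists>s. 0 < s \<and> s < h \<and> p h - p 0 = (h - 0) * p' s"
      unfolding p_def p'_def
      by (rule MVT2[OF h(1)]) (use h f in \<open>intro DERIV_diff line; simp\<close>)
    then obtain s where s: "0 < s" "s < h" "p h - p 0 = h * p' s" by auto
    have "\<exists>t. 0 < t \<and> t < h \<and> frechet_derivative f (at (x + s *\<^sub>R u + h *\<^sub>R v)) u -
      frechet_derivative f (at (x + s *\<^sub>R u + 0 *\<^sub>R v)) u = (h - 0) * dd (x + s *\<^sub>R u + t *\<^sub>R v)"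
      unfolding dd_def
      by (rule MVT2[OF h(1)]) (use h s in \<open>intro line' fu; simp\<close>)
    then obtain t where t: "0 < t" "t < h" "p' s = h * dd (x + s *\<^sub>R u + t *\<^sub>R v)"
      unfolding p'_def by auto
    have "p h - p 0 = f (x + h *\<^sub>R u + h *\<^sub>R v) - f (x + h *\<^sub>R u) - f (x + h *\<^sub>R v) + f x"
      by (simp add: p_def)
    then have "f (x + h *\<^sub>R u + h *\<^sub>R v) - f (x + h *\<^sub>R u) - f (x + h *\<^sub>R v) + f x - h * h * dd x
        = h * h * (dd (x + s *\<^sub>R u + t *\<^sub>R v) - dd x)"
      using s t by (simp add: algebra_simps)
    moreover have "\<bar>dd (x + s *\<^sub>R u + t *\<^sub>R v) - dd x\<bar> < e"
      using r1(2)[of "x + s *\<^sub>R u + t *\<^sub>R v"] near[of s t] s t h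
      by (simp add: r_def dist_real_def)
    ultimately show ?thesis using h by (simp add: abs_mult mult.commute mult_left_mono)
  qed
  with d show ?thesis by blast
qed

text \<open>The second difference is symmetric in u and v, and for small h it is within e/2 times
  h^2 of h^2 times either mixed derivative. Dividing by h^2 bounds the gap between the two by
  e.\<close>

lemma symmetric_second_derivative_real:
  fixes f :: "'a::real_normed_vector \<Rightarrow> real"
  assumes S: "open S" "x \<in> S" and f: "smooth_on S f"
  shows "frechet_derivative (\<lambda>y. frechet_derivative f (at y) u) (at x) v =
    frechet_derivative (\<lambda>y. frechet_derivative f (at y) v) (at x) u" (is "?a = ?b")
proof -
  have "\<bar>?a - ?b\<bar> \<le> 0 + e" if "e > 0" for e
  proof -
    have e2: "e / 2 > 0" using that by simp
    obtain d1 where d1: "d1 > 0" "\<And>h. 0 < h \<and> h < d1 \<Longrightarrow>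
        \<bar>(f (x + h *\<^sub>R u + h *\<^sub>R v) - f (x + h *\<^sub>R u) - f (x + h *\<^sub>R v) + f x) - h * h * ?a\<bar>
          \<le> e / 2 * (h * h)"
      using second_difference_estimate[OF S f e2, of u v] by blast
    obtain d2 where d2: "d2 > 0" "\<And>h. 0 < h \<and> h < d2 \<Longrightarrow>
        \<bar>(f (x + h *\<^sub>R v + h *\<^sub>R u) - f (x + h *\<^sub>R v) - f (x + h *\<^sub>R u) + f x) - h * h * ?b\<bar>
          \<le> e / 2 * (h * h)"
      using second_difference_estimate[OF S f e2, of v u] by blast
    define h where "h = min d1 d2 / 2"
    have h: "0 < h" "h < d1" "h < d2" using d1 d2 by (auto simp: h_def)
    have c: "x + h *\<^sub>R v + h *\<^sub>R u = x + h *\<^sub>R u + h *\<^sub>R v" by (simp add: algebra_simps)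
    have tri: "\<bar>A - B\<bar> \<le> E"
      if "\<bar>p - q - r + s - A\<bar> \<le> E / 2" "\<bar>p - r - q + s - B\<bar> \<le> E / 2" for A B E p q r s :: real
      using that by linarith
    have "\<bar>h * h * ?a - h * h * ?b\<bar> \<le> e * (h * h)"
      by (rule tri[where p = "f (x + h *\<^sub>R u + h *\<^sub>R v)"])
        (use d1(2)[of h] d2(2)[of h] h in \<open>simp_all add: c\<close>)
    then have "h * h * \<bar>?a - ?b\<bar> \<le> h * h * e"
      using h by (simp add: abs_mult mult.commute flip: right_diff_distrib)
    then show ?thesis using h by simp
  qed
  then show ?thesis using field_le_epsilon[of "\<bar>?a - ?b\<bar>" 0] by simp
qed

text \<open>Reduction to the real case: pairing with a fixed w commutes with differentiation, and a
  vector is determined by its inner products.\<close>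

lemma symmetric_second_derivative:
  fixes f :: "'a::real_normed_vector \<Rightarrow> 'b::real_inner"
  assumes S: "open S" "x \<in> S" and f: "smooth_on S f"
  shows "frechet_derivative (\<lambda>y. frechet_derivative f (at y) u) (at x) v =
    frechet_derivative (\<lambda>y. frechet_derivative f (at y) v) (at x) u"
proof -
  have inner: "frechet_derivative (\<lambda>y. frechet_derivative (\<lambda>y. f y \<bullet> w) (at y) u) (at x) v
      = frechet_derivative (\<lambda>y. frechet_derivative f (at y) u) (at x) v \<bullet> w" for u v w
  proof -
    have 1: "frechet_derivative (\<lambda>y. f y \<bullet> w) (at y) u = frechet_derivative f (at y) u \<bullet> w"
      if "y \<in> S" for y
      by (rule frechet_derivative_compose_eq[OF smooth_on_has_derivative[OF f that]
            bounded_linear_imp_has_derivative[OF bounded_linear_inner_left]])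
    have "(\<lambda>y. frechet_derivative f (at y) u \<bullet> w) differentiable (at x)"
      using smooth_on_has_derivative[OF smooth_on_bounded_linear_compose[OF bounded_linear_inner_left S(1)
            smooth_on_frechet_derivative[OF f]] S(2)]
      by (auto simp: differentiable_def)
    then have "frechet_derivative (\<lambda>y. frechet_derivative f (at y) u \<bullet> w) (at x)
        = frechet_derivative (\<lambda>y. frechet_derivative (\<lambda>y. f y \<bullet> w) (at y) u) (at x)"
      by (intro frechet_derivative_cong_open(2)[OF S]) (simp_all add: 1)
    moreover have "frechet_derivative (\<lambda>y. frechet_derivative f (at y) u \<bullet> w) (at x) v
        = frechet_derivative (\<lambda>y. frechet_derivative f (at y) u) (at x) v \<bullet> w"
      by (rule frechet_derivative_compose_eq[OF smooth_on_has_derivative[OF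
              smooth_on_frechet_derivative[OF f] S(2)]
            bounded_linear_imp_has_derivative[OF bounded_linear_inner_left]])
    ultimately show ?thesis by simp
  qed
  have "smooth_on S (\<lambda>y. f y \<bullet> w)" for w
    by (rule smooth_on_bounded_linear_compose[OF bounded_linear_inner_left S(1) f])
  from symmetric_second_derivative_real[where u = u and v = v, OF S this] show ?thesis
    unfolding inner by (rule vector_eq_rdot[THEN iffD1, OF allI])
qed

section \<open>Manifolds with a global chart\<close>

lemma chart_inv_left: "inj_on (snd c) (fst c) \<Longrightarrow> p \<in> fst c \<Longrightarrow> chart_inv c (snd c p) = p"
  by (simp add: chart_inv_def inv_into_f_f)

lemma chart_inv_right:
  assumes "y \<in> snd c ` fst c"
  shows "snd c (chart_inv c y) = y" "chart_inv c y \<in> fst c"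
  using assms by (simp_all add: chart_inv_def f_inv_into_f inv_into_into)

lemma chart_inv_restrict:
  assumes "inj_on (snd c) (fst c)" "y \<in> snd c ` (fst c \<inter> W)"
  shows "chart_inv (fst c \<inter> W, snd c) y = chart_inv c y"
  using assms by (auto simp: chart_inv_def inv_into_f_f intro!: inv_into_f_eq inj_on_subset[OF assms(1)])

lemma smooth_atlasD:
  assumes "smooth_atlas A" "c \<in> A"
  shows "inj_on (snd c) (fst c)" "open (snd c ` fst c)"
    and "d \<in> A \<Longrightarrow> open (snd c ` (fst c \<inter> fst d))"
    and "d \<in> A \<Longrightarrow> smooth_on (snd c ` (fst c \<inter> fst d)) (snd d \<circ> chart_inv c)"
  using assms unfolding smooth_atlas_def by blast+

lemma smooth_atlas_openin:
  assumes "smooth_atlas A"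
  shows "openin (mtopology A) W \<longleftrightarrow> W \<subseteq> mcarrier A \<and> (\<forall>c\<in>A. open (snd c ` (fst c \<inter> W)))"
  using smooth_atlasD[OF assms] by (intro openin_mtopology) auto

text \<open>The trace of W in another chart d is the preimage, under the transition from d to c, of
  the image of W under c; transitions are continuous on open domains, so openness in one chart
  suffices.\<close>

lemma smooth_atlas_openin_chart:
  assumes A: "smooth_atlas A" and c: "c \<in> A" and W: "W \<subseteq> fst c" "open (snd c ` W)"
  shows "openin (mtopology A) W"
proof -
  have "open (snd d ` (fst d \<inter> W))" if d: "d \<in> A" for d
  proof -
    let ?U = "snd d ` (fst d \<inter> fst c)"
    note di = chart_inv_left[OF smooth_atlasD(1)[OF A d]]
    have "snd d ` (fst d \<inter> W) = (snd c \<circ> chart_inv d) -` (snd c ` W) \<inter> ?U" (is "?L = ?R")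
    proof
      show "?L \<subseteq> ?R" using W(1) di by auto
      show "?R \<subseteq> ?L"
      proof
        fix y assume y: "y \<in> ?R"
        then obtain q where q: "q \<in> fst d" "q \<in> fst c" "y = snd d q" by auto
        then have "snd c q \<in> snd c ` W" using y di[of q] by simp
        then have "q \<in> W" using W(1) q(2) smooth_atlasD(1)[OF A c] by (auto dest: inj_onD)
        with q show "y \<in> ?L" by auto
      qed
    qed
    then show ?thesis
      using continuous_on_open_vimage[OF smooth_atlasD(3)[OF A d c]] W
        smooth_on_imp_continuous_on[OF smooth_atlasD(4)[OF A d c]] by metis
  qed
  then show ?thesis
    using W c unfolding smooth_atlas_openin[OF A] by (auto simp: mcarrier_def)
qed

lemma mcarrier_open_submanifold: "mcarrier (open_submanifold A W) = mcarrier A \<inter> W"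
  by (auto simp: mcarrier_def open_submanifold_def)

lemma smooth_atlas_open_submanifold:
  assumes A: "smooth_atlas A" and W: "openin (mtopology A) W"
  shows "smooth_atlas (open_submanifold A W)"
proof -
  note cD = smooth_atlasD[OF A]
  have oW: "open (snd c ` (fst c \<inter> W))" if "c \<in> A" for c
    using W that unfolding smooth_atlas_openin[OF A] by blast
  have "open (snd c ` (fst c \<inter> W \<inter> (fst d \<inter> W))) \<and>
      smooth_on (snd c ` (fst c \<inter> W \<inter> (fst d \<inter> W))) (snd d \<circ> chart_inv (fst c \<inter> W, snd c))"
    if c: "c \<in> A" and d: "d \<in> A" for c d
  proof
    have "snd c ` (fst c \<inter> W \<inter> (fst d \<inter> W)) = snd c ` (fst c \<inter> fst d) \<inter> snd c ` (fst c \<inter> W)"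
      using cD(1)[OF c] by (auto simp: inj_on_def)
    then show *: "open (snd c ` (fst c \<inter> W \<inter> (fst d \<inter> W)))"
      using cD(3)[OF c d] oW[OF c] by (simp add: open_Int)
    have "smooth_on (snd c ` (fst c \<inter> W \<inter> (fst d \<inter> W))) (snd d \<circ> chart_inv c)"
      by (rule smooth_on_subset[OF cD(4)[OF c d]]) auto
    then show "smooth_on (snd c ` (fst c \<inter> W \<inter> (fst d \<inter> W))) (snd d \<circ> chart_inv (fst c \<inter> W, snd c))"
      by (rule smooth_on_cong[OF *]) (use chart_inv_restrict[OF cD(1)[OF c]] in auto)
  qed
  moreover have "inj_on (snd c) (fst c \<inter> W)" if "c \<in> A" for c
    using cD(1)[OF that] by (rule inj_on_subset) auto
  ultimately show ?thesis
    using oW unfolding smooth_atlas_def open_submanifold_def by simp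
qed

lemma product_chart_inv:
  assumes "inj_on (snd c) (fst c)" "inj_on (snd d) (fst d)"
    "y \<in> map_prod (snd c) (snd d) ` (fst c \<times> fst d)"
  shows "chart_inv (fst c \<times> fst d, map_prod (snd c) (snd d)) y
    = (chart_inv c (fst y), chart_inv d (snd y))"
  using assms by (auto simp: chart_inv_def inv_into_f_f intro!: inv_into_f_eq map_prod_inj_on)

lemma map_prod_image_inter:
  assumes "inj_on f S" "inj_on g T"
  shows "map_prod f g ` ((S \<times> T) \<inter> (S' \<times> T')) = f ` (S \<inter> S') \<times> g ` (T \<inter> T')"
  by (auto simp: map_prod_surj_on Times_Int_Times)

lemma smooth_atlas_product:
  fixes A :: "('p, 'e::euclidean_space) chart set" and B :: "('q, 'f::euclidean_space) chart set"
  assumes A: "smooth_atlas A" and B: "smooth_atlas B"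
  shows "smooth_atlas (product_atlas A B)"
proof -
  have 1: "inj_on (map_prod (snd c) (snd d)) (fst c \<times> fst d) \<and>
      open (map_prod (snd c) (snd d) ` (fst c \<times> fst d))" if "c \<in> A" "d \<in> B" for c d
    using smooth_atlasD(1,2)[OF A that(1)] smooth_atlasD(1,2)[OF B that(2)]
    by (simp add: map_prod_inj_on map_prod_surj_on open_Times)
  have 2: "open (map_prod (snd c) (snd d) ` ((fst c \<times> fst d) \<inter> (fst c' \<times> fst d'))) \<and>
      smooth_on (map_prod (snd c) (snd d) ` ((fst c \<times> fst d) \<inter> (fst c' \<times> fst d')))
        (map_prod (snd c') (snd d') \<circ> chart_inv (fst c \<times> fst d, map_prod (snd c) (snd d)))"
    if c: "c \<in> A" "c' \<in> A" and d: "d \<in> B" "d' \<in> B" for c c' d d'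
  proof
    note cD = smooth_atlasD[OF A c(1)] and dD = smooth_atlasD[OF B d(1)]
    have eq: "map_prod (snd c) (snd d) ` ((fst c \<times> fst d) \<inter> (fst c' \<times> fst d'))
        = snd c ` (fst c \<inter> fst c') \<times> snd d ` (fst d \<inter> fst d')" (is "?V = ?V1 \<times> ?V2")
      by (rule map_prod_image_inter[OF cD(1) dD(1)])
    show o: "open ?V"
      unfolding eq using cD(3)[OF c(2)] dD(3)[OF d(2)] by (rule open_Times)
    have "smooth_on ?V (\<lambda>y. ((snd c' \<circ> chart_inv c) (fst y), (snd d' \<circ> chart_inv d) (snd y)))"
      by (intro smooth_on_Pair[OF o]
          smooth_on_compose[OF o cD(3)[OF c(2)] _ smooth_on_fst[OF o smooth_on_id[OF o]] cD(4)[OF c(2)]]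
          smooth_on_compose[OF o dD(3)[OF d(2)] _ smooth_on_snd[OF o smooth_on_id[OF o]] dD(4)[OF d(2)]])
        (auto simp: eq)
    then show "smooth_on ?V
        (map_prod (snd c') (snd d') \<circ> chart_inv (fst c \<times> fst d, map_prod (snd c) (snd d)))"
      by (rule smooth_on_cong[OF o]) (subst comp_apply, subst product_chart_inv[OF cD(1) dD(1)], auto)
  qed
  show ?thesis
    unfolding smooth_atlas_def product_atlas_def using 1 2 by auto
qed

lemma mcarrier_product: "mcarrier (product_atlas A B) = mcarrier A \<times> mcarrier B"
  unfolding mcarrier_def product_atlas_def by (auto; force)

lemma smooth_atlas_euclidean: "smooth_atlas euclidean_atlas"
  by (auto simp: smooth_atlas_def euclidean_atlas_def chart_inv_def smooth_on_id comp_def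
      inv_into_f_f[of "\<lambda>x. x", simplified])

text \<open>One chart has the whole manifold as its domain, yet the atlas may hold others.
  \<open>smooth_map\<close> and \<open>mtopology\<close> quantify over all charts, and
  \<open>chart_at\<close> may pick any of them; the locale serves to reduce such notions to the
  chart c.\<close>

locale global_chart =
  fixes A :: "('p, 'e::euclidean_space) chart set" and c :: "('p, 'e) chart"
  assumes atlas: "smooth_atlas A" and chart: "c \<in> A" and carrier: "mcarrier A = fst c"
begin

lemmas chart_inj = smooth_atlasD(1)[OF atlas chart]
lemmas chart_open = smooth_atlasD(2)[OF atlas chart]

lemma domain_subset: "d \<in> A \<Longrightarrow> fst d \<subseteq> fst c"
  using carrier by (auto simp: mcarrier_def)

lemma to_chart:
  assumes "d \<in> A"
  shows "open (snd c ` fst d)" "smooth_on (snd c ` fst d) (snd d \<circ> chart_inv c)"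
  using smooth_atlasD(3,4)[OF atlas chart assms] domain_subset[OF assms] by (simp_all add: Int_absorb1)

lemma from_chart:
  assumes "d \<in> A"
  shows "smooth_on (snd d ` fst d) (snd c \<circ> chart_inv d)"
  using smooth_atlasD(4)[OF atlas assms chart] domain_subset[OF assms] by (simp add: Int_absorb2)

lemma chart_inv_global: "p \<in> fst c \<Longrightarrow> chart_inv c (snd c p) = p"
  by (rule chart_inv_left[OF chart_inj])

lemma openin_iff: "openin (mtopology A) W \<longleftrightarrow> W \<subseteq> fst c \<and> open (snd c ` W)"
proof
  assume "openin (mtopology A) W"
  then have "W \<subseteq> fst c" "open (snd c ` (fst c \<inter> W))"
    unfolding smooth_atlas_openin[OF atlas] carrier using chart by auto
  then show "W \<subseteq> fst c \<and> open (snd c ` W)" by (simp add: Int_absorb1)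
qed (use smooth_atlas_openin_chart[OF atlas chart] in blast)

lemma topspace_eq: "topspace (mtopology A) = fst c"
  using openin_iff chart_open by (metis openin_subset openin_topspace subset_antisym order_refl)

lemma openin_chart_preimage:
  assumes "open V"
  shows "openin (mtopology A) {p \<in> fst c. snd c p \<in> V}"
proof -
  have "snd c ` {p \<in> fst c. snd c p \<in> V} = snd c ` fst c \<inter> V" by auto
  then show ?thesis unfolding openin_iff using chart_open assms by (auto simp: open_Int)
qed

lemma Hausdorff: "Hausdorff_space (mtopology A)"
  unfolding Hausdorff_space_def topspace_eq
proof (intro allI impI)
  fix p q assume pq: "p \<in> fst c \<and> q \<in> fst c \<and> p \<noteq> q"
  then have "snd c p \<noteq> snd c q" using chart_inj by (auto dest: inj_onD)
  then obtain V V' where "open V" "open V'" "snd c p \<in> V" "snd c q \<in> V'" "V \<inter> V' = {}"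
    using hausdorff by metis
  then show "\<exists>V V'. openin (mtopology A) V \<and> openin (mtopology A) V' \<and> p \<in> V \<and> q \<in> V' \<and> disjnt V V'"
    using openin_chart_preimage[of V] openin_chart_preimage[of V'] pq
    by (intro exI[of _ "{p \<in> fst c. snd c p \<in> V}"] exI[of _ "{p \<in> fst c. snd c p \<in> V'}"])
      (auto simp: disjnt_def)
qed

text \<open>The Hausdorff property and a countable base are both pulled back from the model space
  along the one chart.\<close>

lemma smooth_manifold: "smooth_manifold A"
proof -
  obtain B :: "'e set set" where B: "countable B" "topological_basis B"
    using ex_countable_basis by blast
  define B' where "B' = (\<lambda>V. {p \<in> fst c. snd c p \<in> V}) ` B"
  have "countable B'" using B by (simp add: B'_def)
  moreover have "\<forall>V\<in>B'. openin (mtopology A) V"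
    using openin_chart_preimage topological_basis_open[OF B(2)] by (auto simp: B'_def)
  moreover have "\<exists>V\<in>B'. p \<in> V \<and> V \<subseteq> W" if W: "openin (mtopology A) W" and p: "p \<in> W" for W p
  proof -
    have "snd c p \<in> snd c ` W" "open (snd c ` W)" using W p openin_iff by auto
    then obtain V where V: "V \<in> B" "snd c p \<in> V" "V \<subseteq> snd c ` W"
      using topological_basisE[OF B(2)] by metis
    have "{p \<in> fst c. snd c p \<in> V} \<subseteq> W"
      using V(3) W chart_inj unfolding openin_iff inj_on_def by blast
    moreover have "p \<in> fst c" using W p openin_iff by auto
    ultimately show ?thesis using V unfolding B'_def by blast
  qed
  ultimately show ?thesis
    unfolding smooth_manifold_def using atlas Hausdorff by blast
qed

lemma global_chart_open_submanifold:
  assumes "openin (mtopology A) W"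
  shows "global_chart (open_submanifold A W) (fst c \<inter> W, snd c)"
proof
  show "smooth_atlas (open_submanifold A W)"
    using smooth_atlas_open_submanifold[OF atlas assms] .
  show "(fst c \<inter> W, snd c) \<in> open_submanifold A W"
    using chart by (auto simp: open_submanifold_def)
  show "mcarrier (open_submanifold A W) = fst (fst c \<inter> W, snd c)"
    by (simp add: mcarrier_open_submanifold carrier)
qed

section \<open>Tangent vectors and the bracket of vector fields in a global chart\<close>

lemma chart_at:
  assumes "p \<in> fst c"
  shows "chart_at A p \<in> A" "p \<in> fst (chart_at A p)"
proof -
  have "\<exists>d. d \<in> A \<and> p \<in> fst d" using chart assms by blast
  then have "chart_at A p \<in> A \<and> p \<in> fst (chart_at A p)"
    unfolding chart_at_def by (rule someI_ex)
  then show "chart_at A p \<in> A" "p \<in> fst (chart_at A p)" by blast+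
qed

lemma transition_derivative:
  assumes d: "d \<in> A" and e: "e \<in> A" and p: "p \<in> fst d" "p \<in> fst e"
  shows "((snd e \<circ> chart_inv d) has_derivative frechet_derivative (snd e \<circ> chart_inv d) (at (snd d p)))
      (at (snd d p))"
  using smooth_atlasD(4)[OF atlas d e] p by (intro smooth_on_has_derivative) auto

text \<open>A vector is stored in the chart b chosen by \<open>chart_at\<close>, so its expressions
  in d and e are derivatives of transitions out of b; near p the transition from b to e factors
  through d, and the chain rule applies.\<close>

lemma tangent_in_chart_trans:
  assumes d: "d \<in> A" and e: "e \<in> A" and p: "p \<in> fst d" "p \<in> fst e"
  shows "tangent_in_chart A e p v
    = frechet_derivative (snd e \<circ> chart_inv d) (at (snd d p)) (tangent_in_chart A d p v)"
proof -
  define b where "b = chart_at A p"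
  have b: "b \<in> A" "p \<in> fst b"
    using chart_at p domain_subset[OF d] by (auto simp: b_def)
  note bi = chart_inv_left[OF smooth_atlasD(1)[OF atlas b(1)]]
    and di = chart_inv_left[OF smooth_atlasD(1)[OF atlas d]]
  let ?S = "snd b ` (fst b \<inter> fst d) \<inter> snd b ` (fst b \<inter> fst e)"
  have S: "open ?S" "snd b p \<in> ?S"
    using smooth_atlasD(3)[OF atlas b(1) d] smooth_atlasD(3)[OF atlas b(1) e] b(2) p
    by (auto intro: open_Int)
  have 1: "(snd d \<circ> chart_inv b) (snd b p) = snd d p"
    by (simp add: bi b)
  have "(snd e \<circ> chart_inv b) y = (snd e \<circ> chart_inv d) ((snd d \<circ> chart_inv b) y)" if y: "y \<in> ?S" for y
  proof -
    from y obtain q where "q \<in> fst b" "q \<in> fst d" "y = snd b q" by auto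
    then show ?thesis using bi[of q] di[of q] by simp
  qed
  then have *: "frechet_derivative (snd e \<circ> chart_inv b) (at (snd b p))
      = frechet_derivative (\<lambda>y. (snd e \<circ> chart_inv d) ((snd d \<circ> chart_inv b) y)) (at (snd b p))"
    using transition_derivative[OF b(1) e b(2) p(2)]
    by (intro frechet_derivative_cong_open(2)[OF S]) (auto simp: differentiable_def)
  have "frechet_derivative (snd e \<circ> chart_inv b) (at (snd b p)) v = frechet_derivative (snd e \<circ> chart_inv d) (at (snd d p))
      (frechet_derivative (snd d \<circ> chart_inv b) (at (snd b p)) v)"
    unfolding * by (rule frechet_derivative_compose_eq[OF transition_derivative[OF b(1) d b(2) p(1)]])
      (unfold 1, rule transition_derivative[OF d e p])
  then show ?thesis by (simp add: tangent_in_chart_def b_def)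
qed

text \<open>The transition of a chart to itself is known to be the identity on the chart image; as
  this image is open, the derivative is the identity.\<close>

lemma tangent_in_chart_at:
  assumes p: "p \<in> fst c"
  shows "tangent_in_chart A (chart_at A p) p v = v"
proof -
  let ?b = "chart_at A p"
  note b = chart_at[OF p]
  have S: "open (snd ?b ` fst ?b)" "snd ?b p \<in> snd ?b ` fst ?b"
    using smooth_atlasD(2)[OF atlas b(1)] b(2) by auto
  have "frechet_derivative (\<lambda>x. x) (at (snd ?b p)) = frechet_derivative (snd ?b \<circ> chart_inv ?b) (at (snd ?b p))"
    by (rule frechet_derivative_cong_open(2)[OF S]) (auto simp: chart_inv_right)
  from fun_cong[OF this, of v] show ?thesis by (simp add: tangent_in_chart_def)
qed

definition tangent_from_chart :: "'p \<Rightarrow> 'e \<Rightarrow> 'e" where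
  "tangent_from_chart p = frechet_derivative (snd (chart_at A p) \<circ> chart_inv c) (at (snd c p))"

lemma linear_tangent_from_chart: "p \<in> fst c \<Longrightarrow> linear (tangent_from_chart p)"
  unfolding tangent_from_chart_def
  by (rule has_derivative_linear[OF transition_derivative[OF chart]]) (auto intro: chart_at)

lemma linear_tangent_in_chart: "p \<in> fst c \<Longrightarrow> linear (tangent_in_chart A c p)"
  unfolding tangent_in_chart_def
  by (rule has_derivative_linear[OF transition_derivative[OF _ chart]]) (auto intro: chart_at)

lemma tangent_from_in: "p \<in> fst c \<Longrightarrow> tangent_from_chart p (tangent_in_chart A c p v) = v"
  using tangent_in_chart_trans[OF chart chart_at(1)[of p] _ chart_at(2)[of p]] tangent_in_chart_at[of p v]
  by (simp add: tangent_from_chart_def)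

text \<open>\<open>tangent_from_chart\<close> is already a left inverse of a linear endomorphism of
  a finite-dimensional space, and such a one-sided inverse is two-sided.\<close>

lemma tangent_in_from:
  assumes "p \<in> fst c"
  shows "tangent_in_chart A c p (tangent_from_chart p w) = w"
proof -
  have "inj (tangent_in_chart A c p)"
    using tangent_from_in[OF assms] by (metis injI)
  then have "surj (tangent_in_chart A c p)"
    using linear_injective_imp_surjective[OF linear_tangent_in_chart[OF assms]] by simp
  then obtain v where "w = tangent_in_chart A c p v" by blast
  then show ?thesis using tangent_from_in[OF assms] by simp
qed

text \<open>\<open>vf_bracket\<close> is evaluated in whichever chart \<open>chart_at\<close> picks.
  Passing to c introduces second derivatives of the transition map, which enter symmetrically in X
  and Y and cancel in the commutator.\<close>

lemma vf_bracket_global: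
  fixes X Y :: "'p \<Rightarrow> 'e"
  defines "X1 \<equiv> vf_in_chart A c X" and "Y1 \<equiv> vf_in_chart A c Y"
  assumes p: "p \<in> fst c"
    and dX: "(X1 has_derivative X') (at (snd c p))" and dY: "(Y1 has_derivative Y') (at (snd c p))"
  shows "tangent_in_chart A c p (vf_bracket A X Y p) = Y' (X1 (snd c p)) - X' (Y1 (snd c p))"
proof -
  define b where "b = chart_at A p"
  have b: "b \<in> A" "p \<in> fst b" using chart_at[OF p] by (simp_all add: b_def)
  define s where "s = snd b \<circ> chart_inv c"
  define t where "t = snd c \<circ> chart_inv b"
  define S where "S = snd c ` fst b"
  define x where "x = snd c p"
  define y where "y = snd b p"
  note bi = chart_inv_left[OF smooth_atlasD(1)[OF atlas b(1)]]
  have S: "open S" "x \<in> S" and s: "smooth_on S s"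
    using to_chart[OF b(1)] b(2) by (simp_all add: S_def s_def x_def)
  have U: "open (snd b ` fst b)" "y \<in> snd b ` fst b" and t: "smooth_on (snd b ` fst b) t"
    using smooth_atlasD(2)[OF atlas b(1)] b(2) from_chart[OF b(1)] by (auto simp: y_def t_def)
  have ty: "t y = x" by (simp add: t_def y_def x_def bi b)
  have Ds: "(s has_derivative frechet_derivative s (at z)) (at z)" if "z \<in> S" for z
    by (rule smooth_on_has_derivative[OF s that])
  have D2s: "((\<lambda>z. frechet_derivative s (at z) v) has_derivative
      frechet_derivative (\<lambda>z. frechet_derivative s (at z) v) (at x)) (at x)" for v
    by (rule smooth_on_has_derivative[OF smooth_on_frechet_derivative[OF s] S(2)])
  \<comment> \<open>Second derivative of the transition, first along v and then along u.\<close>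
  define D2 where "D2 = (\<lambda>u v. frechet_derivative (\<lambda>z. frechet_derivative s (at z) v) (at x) u)"
  have sym: "D2 u v = D2 v u" for u v
    unfolding D2_def by (rule symmetric_second_derivative[OF S s])
  have Dt: "(t has_derivative frechet_derivative t (at y)) (at y)"
    by (rule smooth_on_has_derivative[OF t U(2)])
  have tangent: "tangent_in_chart A b q v = frechet_derivative s (at (snd c q)) (tangent_in_chart A c q v)"
    if "q \<in> fst b" for q v
    unfolding s_def using tangent_in_chart_trans[OF chart b(1)] domain_subset[OF b(1)] that by blast
  have in_b: "vf_in_chart A b Z z = frechet_derivative s (at (t z)) (vf_in_chart A c Z (t z))"
    if z: "z \<in> snd b ` fst b" for Z z
  proof -
    have "chart_inv b z \<in> fst b" using chart_inv_right[OF z] by simp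
    moreover from this have "chart_inv c (t z) = chart_inv b z"
      using domain_subset[OF b(1)] by (auto simp: t_def intro!: chart_inv_global)
    ultimately show ?thesis
      unfolding vf_in_chart_def using tangent[of "chart_inv b z"] by (simp add: t_def)
  qed
  text \<open>The product rule for \<open>vf_in_chart A b Z = (Ds \<cdot> vf_in_chart A c Z) \<circ> t\<close>; expanding in a
    basis reduces it to the product rule for \<open>*\<^sub>R\<close>.\<close>
  have DZ: "frechet_derivative (vf_in_chart A b Z) (at y) k =
      D2 (frechet_derivative t (at y) k) (vf_in_chart A c Z x) +
      frechet_derivative s (at x) (Z' (frechet_derivative t (at y) k))"
    if Z: "(vf_in_chart A c Z has_derivative Z') (at x)" for Z Z' k
  proof -
    define Z1 where "Z1 = vf_in_chart A c Z"
    have exp: "frechet_derivative s (at z) v = (\<Sum>e\<in>Basis. (v \<bullet> e) *\<^sub>R frechet_derivative s (at z) e)"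
      if "z \<in> S" for z v
      by (rule linear_sum_Basis[OF has_derivative_linear[OF Ds[OF that]]])
    have P: "((\<lambda>z. \<Sum>e\<in>Basis. (Z1 z \<bullet> e) *\<^sub>R frechet_derivative s (at z) e) has_derivative
        (\<lambda>h. \<Sum>e\<in>Basis. (Z1 x \<bullet> e) *\<^sub>R D2 h e + (Z' h \<bullet> e) *\<^sub>R frechet_derivative s (at x) e)) (at x)"
      unfolding Z1_def D2_def
      by (intro has_derivative_sum has_derivative_scaleR has_derivative_inner_left Z D2s)
    have "D2 h (\<Sum>e\<in>Basis. (Z1 x \<bullet> e) *\<^sub>R e) = (\<Sum>e\<in>Basis. (Z1 x \<bullet> e) *\<^sub>R D2 h e)" for h
    proof -
      \<comment> \<open>Linearity is immediate in the direction of the outer derivative; symmetry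
        moves it to the other argument.\<close>
      have lin: "linear (\<lambda>v. D2 h v)"
        by (subst sym, unfold D2_def, rule has_derivative_linear[OF D2s])
      show ?thesis using lin by (simp add: linear_sum linear_cmul)
    qed
    then have "(\<Sum>e\<in>Basis. (Z1 x \<bullet> e) *\<^sub>R D2 h e + (Z' h \<bullet> e) *\<^sub>R frechet_derivative s (at x) e)
        = D2 h (Z1 x) + frechet_derivative s (at x) (Z' h)" for h
      by (simp add: sum.distrib euclidean_representation exp[OF S(2), of "Z' h"])
    with P have P: "((\<lambda>z. \<Sum>e\<in>Basis. (Z1 z \<bullet> e) *\<^sub>R frechet_derivative s (at z) e) has_derivative
        (\<lambda>h. D2 h (Z1 x) + frechet_derivative s (at x) (Z' h))) (at (t y))"
      unfolding ty by simp
    have comp: "((\<lambda>z. \<Sum>e\<in>Basis. (Z1 (t z) \<bullet> e) *\<^sub>R frechet_derivative s (at (t z)) e) has_derivative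
        (\<lambda>k. D2 (frechet_derivative t (at y) k) (Z1 x) +
          frechet_derivative s (at x) (Z' (frechet_derivative t (at y) k)))) (at y)"
      using has_derivative_compose[OF Dt P] .
    have "t z \<in> S" if "z \<in> snd b ` fst b" for z
      using chart_inv_right[OF that] by (auto simp: t_def S_def)
    then have eq: "(\<Sum>e\<in>Basis. (Z1 (t z) \<bullet> e) *\<^sub>R frechet_derivative s (at (t z)) e) = vf_in_chart A b Z z"
      if "z \<in> snd b ` fst b" for z
      using in_b[OF that, of Z] exp[of "t z" "Z1 (t z)"] that by (simp add: Z1_def)
    have "(vf_in_chart A b Z has_derivative
        (\<lambda>k. D2 (frechet_derivative t (at y) k) (Z1 x) +
          frechet_derivative s (at x) (Z' (frechet_derivative t (at y) k)))) (at y)"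
      by (rule has_derivative_transform_within_open[OF comp U eq])
    from frechet_derivative_at[OF this, symmetric] show ?thesis by (simp add: Z1_def)
  qed
  have inv: "frechet_derivative t (at y) (frechet_derivative s (at x) v) = v" for v
  proof -
    have "tangent_in_chart A c p (tangent_from_chart p v) = v" by (rule tangent_in_from[OF p])
    then show ?thesis
      by (simp add: tangent_in_chart_def tangent_from_chart_def s_def t_def x_def y_def b_def)
  qed
  have Zb: "vf_in_chart A b Z y = frechet_derivative s (at x) (vf_in_chart A c Z x)" for Z
    using in_b[OF U(2)] ty by simp
  have lin: "linear (frechet_derivative s (at x))" by (rule has_derivative_linear[OF Ds[OF S(2)]])
  have "vf_bracket A X Y p = frechet_derivative (vf_in_chart A b Y) (at y) (vf_in_chart A b X y)
      - frechet_derivative (vf_in_chart A b X) (at y) (vf_in_chart A b Y y)"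
    by (simp add: vf_bracket_def Let_def b_def y_def)
  \<comment> \<open>The two second-derivative terms are \<open>D2 (X1 x) (Y1 x)\<close> and
    \<open>D2 (Y1 x) (X1 x)\<close>, equal by \<open>sym\<close>; \<open>inv\<close> removes the
    derivative of \<open>t\<close> in front of the fields.\<close>
  also have "\<dots> = frechet_derivative s (at x) (Y' (X1 x)) - frechet_derivative s (at x) (X' (Y1 x))"
    using DZ[OF dX[unfolded X1_def, folded x_def]] DZ[OF dY[unfolded Y1_def, folded x_def]]
      sym[of "X1 x" "Y1 x"]
    by (simp add: Zb inv X1_def Y1_def)
  also have "\<dots> = frechet_derivative s (at x) (Y' (X1 x) - X' (Y1 x))"
    by (simp add: linear_diff[OF lin])
  finally have "vf_bracket A X Y p = tangent_from_chart p (Y' (X1 x) - X' (Y1 x))"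
    by (simp add: tangent_from_chart_def s_def x_def b_def)
  then show ?thesis using tangent_in_from[OF p] by (simp add: x_def)
qed

end

lemma global_chart_euclidean: "global_chart euclidean_atlas (UNIV, id)"
  by unfold_locales (simp add: smooth_atlas_euclidean, simp_all add: euclidean_atlas_def mcarrier_def)

lemma global_chart_product:
  assumes "global_chart A c" "global_chart B d"
  shows "global_chart (product_atlas A B) (fst c \<times> fst d, map_prod (snd c) (snd d))"
proof -
  interpret A: global_chart A c by fact
  interpret B: global_chart B d by fact
  show ?thesis
  proof
    show "smooth_atlas (product_atlas A B)" by (rule smooth_atlas_product[OF A.atlas B.atlas])
    show "(fst c \<times> fst d, map_prod (snd c) (snd d)) \<in> product_atlas A B"
      using A.chart B.chart by (force simp: product_atlas_def)
    show "mcarrier (product_atlas A B) = fst (fst c \<times> fst d, map_prod (snd c) (snd d))"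
      by (simp add: mcarrier_product A.carrier B.carrier)
  qed
qed

section \<open>Smooth maps and differentials between manifolds with global charts\<close>

locale global_charts = A: global_chart A c + B: global_chart B d
  for A :: "('p, 'e::euclidean_space) chart set" and c
    and B :: "('q, 'f::euclidean_space) chart set" and d
begin

text \<open>In any other pair of charts f is its global expression \<open>F\<close>, preceded and
  followed by transitions. Continuity of \<open>F\<close> after the first transition also gives the
  openness demanded by \<open>smooth_map\<close>.\<close>

lemma smooth_map_iff:
  "smooth_map A B f \<longleftrightarrow> f ` fst c \<subseteq> fst d \<and> smooth_on (snd c ` fst c) (snd d \<circ> f \<circ> chart_inv c)"
proof
  assume f: "smooth_map A B f"
  then have 1: "f ` fst c \<subseteq> fst d" by (simp add: smooth_map_def A.carrier B.carrier)
  then have "fst c \<inter> f -` fst d = fst c" by auto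
  then show "f ` fst c \<subseteq> fst d \<and> smooth_on (snd c ` fst c) (snd d \<circ> f \<circ> chart_inv c)"
    using f A.chart B.chart 1 unfolding smooth_map_def by metis
next
  assume f: "f ` fst c \<subseteq> fst d \<and> smooth_on (snd c ` fst c) (snd d \<circ> f \<circ> chart_inv c)"
  define F where "F = snd d \<circ> f \<circ> chart_inv c"
  have "open (snd c' ` (fst c' \<inter> f -` fst d')) \<and>
      smooth_on (snd c' ` (fst c' \<inter> f -` fst d')) (snd d' \<circ> f \<circ> chart_inv c')"
    if c': "c' \<in> A" and d': "d' \<in> B" for c' d'
  proof
    let ?t = "snd c \<circ> chart_inv c'" and ?U = "snd c' ` fst c'"
    note ci' = chart_inv_left[OF smooth_atlasD(1)[OF A.atlas c']]
    have cc: "chart_inv c (?t y) = chart_inv c' y" if "y \<in> ?U" for y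
      using chart_inv_right[OF that] A.domain_subset[OF c'] by (auto intro!: A.chart_inv_global)
    have U: "open ?U" by (rule smooth_atlasD(2)[OF A.atlas c'])
    have t: "smooth_on ?U ?t" by (rule A.from_chart[OF c'])
    have Ft: "smooth_on ?U (\<lambda>y. F (?t y))"
      using f A.domain_subset[OF c'] chart_inv_right unfolding F_def
      by (intro smooth_on_compose[OF U A.chart_open _ t]) (auto simp: ci' comp_def)
    have Ft_eq: "F (?t y) = snd d (f (chart_inv c' y))" if "y \<in> ?U" for y
      using cc[OF that] by (simp add: F_def)
    \<comment> \<open>Because the chart d is injective, whether f lands in the domain of d' can be
      read off from the value of \<open>F\<close>.\<close>
    have eq: "snd c' ` (fst c' \<inter> f -` fst d') = (\<lambda>y. F (?t y)) -` (snd d ` fst d') \<inter> ?U" (is "?L = ?R")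
    proof
      show "?L \<subseteq> ?R"
      proof
        fix y assume "y \<in> ?L"
        then obtain q where "q \<in> fst c'" "f q \<in> fst d'" "y = snd c' q" by auto
        then show "y \<in> ?R" using Ft_eq[of y] ci'[of q] by auto
      qed
      show "?R \<subseteq> ?L"
      proof
        fix y assume y: "y \<in> ?R"
        then have 1: "chart_inv c' y \<in> fst c'" "snd c' (chart_inv c' y) = y"
          using chart_inv_right[of y c'] by simp_all
        then have "f (chart_inv c' y) \<in> fst d" using A.domain_subset[OF c'] f by auto
        moreover have "snd d (f (chart_inv c' y)) \<in> snd d ` fst d'" using y Ft_eq by auto
        ultimately have "f (chart_inv c' y) \<in> fst d'"
          using B.chart_inj B.domain_subset[OF d'] by (auto dest: inj_onD)
        with 1 show "y \<in> ?L" by (intro image_eqI[of _ _ "chart_inv c' y"]) auto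
      qed
    qed
    show o: "open ?L"
      unfolding eq using continuous_on_open_vimage[OF U] smooth_on_imp_continuous_on[OF Ft]
        B.to_chart(1)[OF d'] by blast
    have "smooth_on ?L (\<lambda>y. (snd d' \<circ> chart_inv d) (F (?t y)))"
      by (rule smooth_on_compose[OF o B.to_chart(1)[OF d'] _ smooth_on_subset[OF Ft] B.to_chart(2)[OF d']])
        (auto simp: eq)
    then show "smooth_on ?L (snd d' \<circ> f \<circ> chart_inv c')"
    proof (rule smooth_on_cong[OF o])
      fix y assume y: "y \<in> ?L"
      then obtain q where q: "q \<in> fst c'" "y = snd c' q" by auto
      then have "f (chart_inv c' y) \<in> fst d"
        using f A.domain_subset[OF c'] ci'[of q] by auto
      then have "chart_inv d (F (?t y)) = f (chart_inv c' y)"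
        using q Ft_eq[of y] by (simp add: B.chart_inv_global)
      then show "(snd d' \<circ> chart_inv d) (F (?t y)) = (snd d' \<circ> f \<circ> chart_inv c') y" by simp
    qed
  qed
  then show "smooth_map A B f"
    using f by (auto simp: smooth_map_def A.carrier B.carrier)
qed

lemma differential_local:
  assumes W: "openin (mtopology A) W" "f ` W \<subseteq> fst d" "p \<in> W"
    and D: "((\<lambda>y. snd d (f (chart_inv c y))) has_derivative D) (at (snd c p))"
  shows "differential A B f p v = B.tangent_from_chart (f p) (D (tangent_in_chart A c p v))"
proof -
  define a where "a = chart_at A p"
  define b where "b = chart_at B (f p)"
  have p: "p \<in> fst c" "f p \<in> fst d" "W \<subseteq> fst c" using W A.openin_iff by auto
  have a: "a \<in> A" "p \<in> fst a" using A.chart_at[OF p(1)] by (simp_all add: a_def)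
  have b: "b \<in> B" "f p \<in> fst b" using B.chart_at[OF p(2)] by (simp_all add: b_def)
  note ai = chart_inv_left[OF smooth_atlasD(1)[OF A.atlas a(1)]]
  have o: "open (snd a ` (fst a \<inter> W))" "snd a p \<in> snd a ` (fst a \<inter> W)"
    using W a unfolding smooth_atlas_openin[OF A.atlas] by auto
  define s where "s = snd b \<circ> chart_inv d"
  define t where "t = snd c \<circ> chart_inv a"
  have Ds: "(s has_derivative frechet_derivative s (at (snd d (f p)))) (at (snd d (f p)))"
    unfolding s_def by (rule B.transition_derivative[OF B.chart b(1) p(2) b(2)])
  have Dt: "(t has_derivative frechet_derivative t (at (snd a p))) (at (snd a p))"
    unfolding t_def by (rule A.transition_derivative[OF a(1) A.chart a(2) p(1)])
  have tp: "t (snd a p) = snd c p" using a by (simp add: t_def ai)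
  have "((\<lambda>y. snd d (f (chart_inv c (t y)))) has_derivative
      (\<lambda>v. D (frechet_derivative t (at (snd a p)) v))) (at (snd a p))"
    by (rule has_derivative_compose[OF Dt]) (unfold tp, rule D)
  from has_derivative_compose[OF this, of s] Ds
  have L: "((\<lambda>y. s (snd d (f (chart_inv c (t y))))) has_derivative
      (\<lambda>v. frechet_derivative s (at (snd d (f p))) (D (frechet_derivative t (at (snd a p)) v)))) (at (snd a p))"
    by (simp add: tp A.chart_inv_global p)
  have "((snd b \<circ> f \<circ> chart_inv a) has_derivative
      (\<lambda>v. frechet_derivative s (at (snd d (f p))) (D (frechet_derivative t (at (snd a p)) v)))) (at (snd a p))"
  proof (rule has_derivative_transform_within_open[OF L o])
    fix y assume "y \<in> snd a ` (fst a \<inter> W)"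
    then obtain q where q: "q \<in> fst a" "q \<in> W" "y = snd a q" by auto
    then have "q \<in> fst c" "f q \<in> fst d" using p(3) W(2) by auto
    then show "s (snd d (f (chart_inv c (t y)))) = (snd b \<circ> f \<circ> chart_inv a) y"
      using q by (simp add: s_def t_def ai A.chart_inv_global B.chart_inv_global)
  qed
  from frechet_derivative_at[OF this] show ?thesis
    unfolding differential_def tangent_in_chart_def B.tangent_from_chart_def
      a_def[symmetric] b_def[symmetric] s_def t_def by metis
qed

end

context global_charts
begin

lemma smooth_map_open_submanifold_iff:
  assumes W: "openin (mtopology A) W"
  shows "smooth_map (open_submanifold A W) B f \<longleftrightarrow>
    f ` W \<subseteq> fst d \<and> smooth_on (snd c ` W) (snd d \<circ> f \<circ> chart_inv c)"
proof -
  have sub: "W \<subseteq> fst c" "open (snd c ` W)" using W by (simp_all add: A.openin_iff)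
  then have int: "fst c \<inter> W = W" by auto
  interpret W: global_chart "open_submanifold A W" "(fst c \<inter> W, snd c)"
    by (rule A.global_chart_open_submanifold[OF W])
  interpret WB: global_charts "open_submanifold A W" "(fst c \<inter> W, snd c)" B d ..
  have eq: "(snd d \<circ> f \<circ> chart_inv c) y = (snd d \<circ> f \<circ> chart_inv (fst c \<inter> W, snd c)) y"
    if "y \<in> snd c ` W" for y
    using chart_inv_restrict[OF A.chart_inj, of y W] that by (simp add: int)
  have "smooth_on (snd c ` W) (snd d \<circ> f \<circ> chart_inv c) \<longleftrightarrow>
      smooth_on (snd c ` W) (snd d \<circ> f \<circ> chart_inv (fst c \<inter> W, snd c))"
  proof
    assume "smooth_on (snd c ` W) (snd d \<circ> f \<circ> chart_inv c)"
    then show "smooth_on (snd c ` W) (snd d \<circ> f \<circ> chart_inv (fst c \<inter> W, snd c))"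
      by (rule smooth_on_cong[OF sub(2)]) (rule eq)
  next
    assume "smooth_on (snd c ` W) (snd d \<circ> f \<circ> chart_inv (fst c \<inter> W, snd c))"
    then show "smooth_on (snd c ` W) (snd d \<circ> f \<circ> chart_inv c)"
      by (rule smooth_on_cong[OF sub(2)]) (rule eq[symmetric])
  qed
  then show ?thesis by (simp add: WB.smooth_map_iff int)
qed

end

lemma chart_inv_id [simp]: "chart_inv (UNIV, id) = id"
  by (auto simp: chart_inv_def)

lemma chart_at_euclidean [simp]: "chart_at euclidean_atlas p = (UNIV, id)"
  unfolding chart_at_def euclidean_atlas_def by (rule some_equality) auto

lemma tangent_in_chart_euclidean [simp]: "tangent_in_chart euclidean_atlas (UNIV, id) p v = v"
  using global_chart.tangent_in_chart_at[OF global_chart_euclidean, of p v] by simp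

lemma mcarrier_euclidean [simp]: "mcarrier euclidean_atlas = UNIV"
  by (simp add: mcarrier_def euclidean_atlas_def)

context global_chart
begin

text \<open>The Euclidean atlas has the identity as its only chart, so on the target side no
  conversion of vectors remains.\<close>

lemma differential_to_euclidean:
  fixes f :: "'p \<Rightarrow> 'f::euclidean_space"
  assumes p: "p \<in> fst c"
    and D: "((\<lambda>y. f (chart_inv c y)) has_derivative D) (at (snd c p))"
  shows "differential A euclidean_atlas f p v = D (tangent_in_chart A c p v)"
proof -
  interpret E: global_charts A c "euclidean_atlas :: ('f, 'f) chart set" "(UNIV, id)"
    by (intro global_charts.intro global_chart_axioms global_chart_euclidean)
  have "openin (mtopology A) (fst c)" using openin_topspace[of "mtopology A"] by (simp add: topspace_eq)
  from E.differential_local[OF this _ p, of f D v] D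
  have "differential A euclidean_atlas f p v = E.B.tangent_from_chart (f p) (D (tangent_in_chart A c p v))"
    by simp
  then show ?thesis
    using E.B.tangent_from_in[of "f p" "D (tangent_in_chart A c p v)"] by simp
qed

lemma submersion_to_euclidean:
  fixes f :: "'p \<Rightarrow> 'f::euclidean_space"
  assumes f: "smooth_map A euclidean_atlas f"
    and D: "\<And>p. p \<in> fst c \<Longrightarrow> ((\<lambda>y. f (chart_inv c y)) has_derivative D p) (at (snd c p))"
    and surj: "\<And>p. p \<in> fst c \<Longrightarrow> surj (D p)"
  shows "submersion A euclidean_atlas f"
  unfolding submersion_def
proof (intro conjI ballI f)
  fix p assume "p \<in> mcarrier A"
  then have p: "p \<in> fst c" by (simp add: carrier)
  show "surj (differential A euclidean_atlas f p)"
  proof (rule surjI)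
    fix w
    show "differential A euclidean_atlas f p (tangent_from_chart p (inv (D p) w)) = w"
      unfolding differential_to_euclidean[OF p D[OF p]] tangent_in_from[OF p]
      by (rule surj_f_inv_f[OF surj[OF p]])
  qed
qed

end

section \<open>The blow-up and its charts\<close>

declare cline.simps [simp del] blowup_param1.simps [simp del] blowup_param2.simps [simp del]
  blowup_param3.simps [simp del]

lemma chart_inv_param:
  assumes "inj \<psi>"
  shows "chart_inv (range \<psi>, inv \<psi>) y = \<psi> y"
  unfolding chart_inv_def using assms
  by (intro inv_into_f_eq) (auto simp: inv_f_f inj_on_def)

text \<open>Criterion for charts that are inverses of injective, everywhere defined
  parametrisations. Each pair needs a smooth change of coordinates \<open>\<tau>\<close> on an open
  V containing the overlap; that V is no larger than the overlap follows from the equation on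
  V.\<close>

lemma smooth_atlas_params:
  assumes inj: "\<And>\<psi>. \<psi> \<in> P \<Longrightarrow> inj \<psi>"
    and trans: "\<And>\<psi> \<phi>. \<psi> \<in> P \<Longrightarrow> \<phi> \<in> P \<Longrightarrow>
      \<exists>V \<tau>. open V \<and> smooth_on V \<tau> \<and> (\<forall>y\<in>V. \<psi> y = \<phi> (\<tau> y)) \<and> (\<forall>y. \<psi> y \<in> range \<phi> \<longrightarrow> y \<in> V)"
  shows "smooth_atlas ((\<lambda>\<psi>. (range \<psi>, inv \<psi>)) ` P)"
proof -
  have 1: "inj_on (inv \<psi>) (range \<psi>) \<and> open (inv \<psi> ` range \<psi>)" if "\<psi> \<in> P" for \<psi>
    using inj[OF that] by (auto simp: inj_on_def image_comp inv_o_cancel)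
  have 2: "open (inv \<psi> ` (range \<psi> \<inter> range \<phi>)) \<and>
      smooth_on (inv \<psi> ` (range \<psi> \<inter> range \<phi>)) (inv \<phi> \<circ> chart_inv (range \<psi>, inv \<psi>))"
    if P: "\<psi> \<in> P" "\<phi> \<in> P" for \<psi> \<phi>
  proof -
    obtain V \<tau> where V: "open V" "smooth_on V \<tau>" "\<And>y. y \<in> V \<Longrightarrow> \<psi> y = \<phi> (\<tau> y)"
      "\<And>y. \<psi> y \<in> range \<phi> \<Longrightarrow> y \<in> V"
      using trans[OF P] by blast
    have "inv \<psi> ` (range \<psi> \<inter> range \<phi>) = V"
    proof
      show "inv \<psi> ` (range \<psi> \<inter> range \<phi>) \<subseteq> V"
      proof
        fix y assume "y \<in> inv \<psi> ` (range \<psi> \<inter> range \<phi>)"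
        then obtain x where "y = inv \<psi> (\<psi> x)" "\<psi> x \<in> range \<phi>" by blast
        then show "y \<in> V" using V(4)[of x] inv_f_f[OF inj[OF P(1)]] by simp
      qed
      show "V \<subseteq> inv \<psi> ` (range \<psi> \<inter> range \<phi>)"
      proof
        fix y assume "y \<in> V"
        then have "\<psi> y \<in> range \<psi> \<inter> range \<phi>"
          using V(3)[of y] by (metis IntI rangeI)
        moreover have "y = inv \<psi> (\<psi> y)" by (simp add: inv_f_f[OF inj[OF P(1)]])
        ultimately show "y \<in> inv \<psi> ` (range \<psi> \<inter> range \<phi>)" by (intro image_eqI)
      qed
    qed
    moreover have "smooth_on V (inv \<phi> \<circ> chart_inv (range \<psi>, inv \<psi>))"
      by (rule smooth_on_cong[OF V(1,2)])
        (simp add: chart_inv_param[OF inj[OF P(1)]] V(3) inv_f_f[OF inj[OF P(2)]])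
    ultimately show ?thesis using V(1) by simp
  qed
  show ?thesis unfolding smooth_atlas_def using 1 2 by auto
qed

lemma in_cline: "n \<in> cline n"
  by (cases n) (auto simp: cline.simps intro: exI[of _ 1])

lemma cline_scale':
  "k \<noteq> 0 \<Longrightarrow> u' = k * u \<Longrightarrow> v' = k * v \<Longrightarrow> w' = k * w \<Longrightarrow> cline (u, v, w) = cline (u', v', w')"
  using cline_scale by simp

text \<open>Homogeneous coordinates are rescaled by the inverse of the coordinate that is to become
  1.\<close>

lemma cline_normalize:
  "b \<noteq> 0 \<Longrightarrow> cline (1, b, c) = cline (1 / b, 1, c / b)"
  "c \<noteq> 0 \<Longrightarrow> cline (1, b, c) = cline (1 / c, b / c, 1)"
  "b \<noteq> 0 \<Longrightarrow> cline (b, 1, c) = cline (1, 1 / b, c / b)"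
  "c \<noteq> 0 \<Longrightarrow> cline (b, 1, c) = cline (b / c, 1 / c, 1)"
  "b \<noteq> 0 \<Longrightarrow> cline (b, c, 1) = cline (1, c / b, 1 / b)"
  "c \<noteq> 0 \<Longrightarrow> cline (b, c, 1) = cline (b / c, 1, 1 / c)"
  by (rule cline_scale'[where k = "1 / b"] cline_scale'[where k = "1 / c"]; simp; fail)+

lemma blowup_param_transitions:
  "b \<noteq> 0 \<Longrightarrow> blowup_param1 (z, a, b, c) = blowup_param2 (z, a * b, 1 / b, c / b)"
  "c \<noteq> 0 \<Longrightarrow> blowup_param1 (z, a, b, c) = blowup_param3 (z, a * c, 1 / c, b / c)"
  "b \<noteq> 0 \<Longrightarrow> blowup_param2 (z, a, b, c) = blowup_param1 (z, a * b, 1 / b, c / b)"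
  "c \<noteq> 0 \<Longrightarrow> blowup_param2 (z, a, b, c) = blowup_param3 (z, a * c, b / c, 1 / c)"
  "b \<noteq> 0 \<Longrightarrow> blowup_param3 (z, a, b, c) = blowup_param1 (z, a * b, c / b, 1 / b)"
  "c \<noteq> 0 \<Longrightarrow> blowup_param3 (z, a, b, c) = blowup_param2 (z, a * c, b / c, 1 / c)"
  by (simp_all add: blowup_param1.simps blowup_param2.simps blowup_param3.simps, (erule cline_normalize)+)

lemma cline_eqD: "cline (u, v, w) = cline n \<Longrightarrow> \<exists>k. n = (k * u, k * v, k * w)"
  using in_cline[of n] by (auto simp: cline.simps)

text \<open>Equal points have equal lines, so the normalised generator of one line is a multiple of
  that of the other; its entry 1 excludes a zero in the same position.\<close>

lemma blowup_param_overlaps: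
  "blowup_param1 y \<in> range blowup_param2 \<Longrightarrow> fst (snd (snd y)) \<noteq> 0"
  "blowup_param1 y \<in> range blowup_param3 \<Longrightarrow> snd (snd (snd y)) \<noteq> 0"
  "blowup_param2 y \<in> range blowup_param1 \<Longrightarrow> fst (snd (snd y)) \<noteq> 0"
  "blowup_param2 y \<in> range blowup_param3 \<Longrightarrow> snd (snd (snd y)) \<noteq> 0"
  "blowup_param3 y \<in> range blowup_param1 \<Longrightarrow> fst (snd (snd y)) \<noteq> 0"
  "blowup_param3 y \<in> range blowup_param2 \<Longrightarrow> snd (snd (snd y)) \<noteq> 0"
  by (cases y; auto simp: blowup_param1.simps blowup_param2.simps blowup_param3.simps dest!: cline_eqD)+

lemma open_coord3_neq_0: "open {y :: complex \<times> complex \<times> complex \<times> complex. fst (snd (snd y)) \<noteq> 0}"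
  by (intro open_Collect_neq continuous_intros)

lemma open_coord4_neq_0: "open {y :: complex \<times> complex \<times> complex \<times> complex. snd (snd (snd y)) \<noteq> 0}"
  by (intro open_Collect_neq continuous_intros)

lemma smooth_atlas_blowup: "smooth_atlas blowup_atlas"
  unfolding blowup_atlas_def
proof (rule smooth_atlas_params)
  show "inj \<psi>" if "\<psi> \<in> {blowup_param1, blowup_param2, blowup_param3}" for \<psi>
    using that inj_blowup_params by auto
  let ?V3 = "{y :: complex \<times> complex \<times> complex \<times> complex. fst (snd (snd y)) \<noteq> 0}"
  let ?V4 = "{y :: complex \<times> complex \<times> complex \<times> complex. snd (snd (snd y)) \<noteq> 0}"
  let ?a = "\<lambda>y :: complex \<times> complex \<times> complex \<times> complex. fst (snd y)"
  let ?b = "\<lambda>y :: complex \<times> complex \<times> complex \<times> complex. fst (snd (snd y))"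
  let ?c = "\<lambda>y :: complex \<times> complex \<times> complex \<times> complex. snd (snd (snd y))"
  have id: "\<exists>V \<tau>. open V \<and> smooth_on V \<tau> \<and> (\<forall>y\<in>V. \<psi> y = \<psi> (\<tau> y)) \<and> (\<forall>y. \<psi> y \<in> range \<psi> \<longrightarrow> y \<in> V)"
    for \<psi> :: "complex \<times> complex \<times> complex \<times> complex \<Rightarrow> C4 \<times> C3 set"
    by (intro exI[of _ UNIV] exI[of _ "\<lambda>y. y"]) (auto simp: smooth_on_id)
  have s3: "smooth_on ?V3 (\<lambda>y. (fst y, ?a y * ?b y, 1 / ?b y, ?c y / ?b y))"
    "smooth_on ?V3 (\<lambda>y. (fst y, ?a y * ?b y, ?c y / ?b y, 1 / ?b y))"
    by (intro smooth_intros open_coord3_neq_0; simp)+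
  have s4: "smooth_on ?V4 (\<lambda>y. (fst y, ?a y * ?c y, 1 / ?c y, ?b y / ?c y))"
    "smooth_on ?V4 (\<lambda>y. (fst y, ?a y * ?c y, ?b y / ?c y, 1 / ?c y))"
    by (intro smooth_intros open_coord4_neq_0; simp)+
  show "\<exists>V \<tau>. open V \<and> smooth_on V \<tau> \<and> (\<forall>y\<in>V. \<psi> y = \<phi> (\<tau> y)) \<and> (\<forall>y. \<psi> y \<in> range \<phi> \<longrightarrow> y \<in> V)"
    if "\<psi> \<in> {blowup_param1, blowup_param2, blowup_param3}"
      "\<phi> \<in> {blowup_param1, blowup_param2, blowup_param3}" for \<psi> \<phi>
  proof -
    have "blowup_param1 y = blowup_param2 (fst y, ?a y * ?b y, 1 / ?b y, ?c y / ?b y)" if "y \<in> ?V3" for y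
      using blowup_param_transitions(1)[of "?b y" "fst y" "?a y" "?c y"] that by simp
    then have 12: "(\<forall>y\<in>?V3. blowup_param1 y = blowup_param2 (fst y, ?a y * ?b y, 1 / ?b y, ?c y / ?b y)) \<and>
        (\<forall>y. blowup_param1 y \<in> range blowup_param2 \<longrightarrow> y \<in> ?V3)"
      using blowup_param_overlaps(1) by blast
    have "blowup_param1 y = blowup_param3 (fst y, ?a y * ?c y, 1 / ?c y, ?b y / ?c y)" if "y \<in> ?V4" for y
      using blowup_param_transitions(2)[of "?c y" "fst y" "?a y" "?b y"] that by simp
    then have 13: "(\<forall>y\<in>?V4. blowup_param1 y = blowup_param3 (fst y, ?a y * ?c y, 1 / ?c y, ?b y / ?c y)) \<and>
        (\<forall>y. blowup_param1 y \<in> range blowup_param3 \<longrightarrow> y \<in> ?V4)"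
      using blowup_param_overlaps(2) by blast
    have "blowup_param2 y = blowup_param1 (fst y, ?a y * ?b y, 1 / ?b y, ?c y / ?b y)" if "y \<in> ?V3" for y
      using blowup_param_transitions(3)[of "?b y" "fst y" "?a y" "?c y"] that by simp
    then have 21: "(\<forall>y\<in>?V3. blowup_param2 y = blowup_param1 (fst y, ?a y * ?b y, 1 / ?b y, ?c y / ?b y)) \<and>
        (\<forall>y. blowup_param2 y \<in> range blowup_param1 \<longrightarrow> y \<in> ?V3)"
      using blowup_param_overlaps(3) by blast
    have "blowup_param2 y = blowup_param3 (fst y, ?a y * ?c y, ?b y / ?c y, 1 / ?c y)" if "y \<in> ?V4" for y
      using blowup_param_transitions(4)[of "?c y" "fst y" "?a y" "?b y"] that by simp
    then have 23: "(\<forall>y\<in>?V4. blowup_param2 y = blowup_param3 (fst y, ?a y * ?c y, ?b y / ?c y, 1 / ?c y)) \<and>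
        (\<forall>y. blowup_param2 y \<in> range blowup_param3 \<longrightarrow> y \<in> ?V4)"
      using blowup_param_overlaps(4) by blast
    have "blowup_param3 y = blowup_param1 (fst y, ?a y * ?b y, ?c y / ?b y, 1 / ?b y)" if "y \<in> ?V3" for y
      using blowup_param_transitions(5)[of "?b y" "fst y" "?a y" "?c y"] that by simp
    then have 31: "(\<forall>y\<in>?V3. blowup_param3 y = blowup_param1 (fst y, ?a y * ?b y, ?c y / ?b y, 1 / ?b y)) \<and>
        (\<forall>y. blowup_param3 y \<in> range blowup_param1 \<longrightarrow> y \<in> ?V3)"
      using blowup_param_overlaps(5) by blast
    have "blowup_param3 y = blowup_param2 (fst y, ?a y * ?c y, ?b y / ?c y, 1 / ?c y)" if "y \<in> ?V4" for y
      using blowup_param_transitions(6)[of "?c y" "fst y" "?a y" "?b y"] that by simp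
    then have 32: "(\<forall>y\<in>?V4. blowup_param3 y = blowup_param2 (fst y, ?a y * ?c y, ?b y / ?c y, 1 / ?c y)) \<and>
        (\<forall>y. blowup_param3 y \<in> range blowup_param2 \<longrightarrow> y \<in> ?V4)"
      using blowup_param_overlaps(6) by blast
    have overlap: "\<exists>V \<tau>. open V \<and> smooth_on V \<tau> \<and> (\<forall>y\<in>V. \<psi> y = \<phi> (\<tau> y)) \<and> (\<forall>y. \<psi> y \<in> range \<phi> \<longrightarrow> y \<in> V)"
      if "open V" "smooth_on V \<tau>" "(\<forall>y\<in>V. \<psi> y = \<phi> (\<tau> y)) \<and> (\<forall>y. \<psi> y \<in> range \<phi> \<longrightarrow> y \<in> V)"
      for V \<tau> and \<psi> \<phi> :: "complex \<times> complex \<times> complex \<times> complex \<Rightarrow> C4 \<times> C3 set"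
      using that by blast
    note overlaps = overlap[OF open_coord3_neq_0 s3(1) 12] overlap[OF open_coord4_neq_0 s4(1) 13]
      overlap[OF open_coord3_neq_0 s3(1) 21] overlap[OF open_coord4_neq_0 s4(2) 23]
      overlap[OF open_coord3_neq_0 s3(2) 31] overlap[OF open_coord4_neq_0 s4(2) 32]
    show ?thesis
      using that by (elim insertE emptyE; hypsubst) (rule id overlaps)+
  qed
qed

section \<open>The arrow space and the pair groupoid part in the first affine chart\<close>

abbreviation G_coords :: "(complex \<times> complex \<times> complex \<times> complex) set" where
  "G_coords \<equiv> {(z, a, b, c). b \<noteq> 0}"

abbreviation pair_coords :: "(complex \<times> complex \<times> complex \<times> complex) set" where
  "pair_coords \<equiv> {(z, a, b, c). a \<noteq> 0 \<and> b \<noteq> 0}"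

lemma open_G_coords: "open G_coords"
  using open_coord3_neq_0 by (simp add: case_prod_unfold)

lemma open_pair_coords: "open pair_coords"
  unfolding case_prod_unfold by (intro open_Collect_conj open_Collect_neq continuous_intros)

lemma blowup_param1_chart: "(range blowup_param1, inv blowup_param1) \<in> blowup_atlas"
  by (simp add: blowup_atlas_def)

lemma inv_blowup_param1 [simp]: "inv blowup_param1 (blowup_param1 y) = y"
  by (rule inv_f_f[OF inj_blowup_params(1)])

lemma openin_blowup_param1_image:
  assumes "open V"
  shows "openin (mtopology blowup_atlas) (blowup_param1 ` V)"
  by (rule smooth_atlas_openin_chart[OF smooth_atlas_blowup blowup_param1_chart])
    (use assms in \<open>auto simp: image_image\<close>)

text \<open>As \<open>\<psi>\<close> is defined on the whole model space, the preimage is the full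
  trace of N in the chart inverse to \<open>\<psi>\<close>.\<close>

lemma open_blowup_param_vimage:
  assumes "openin (mtopology blowup_atlas) N" "\<psi> \<in> {blowup_param1, blowup_param2, blowup_param3}"
  shows "open (\<psi> -` N)"
proof -
  have "inj \<psi>" using assms(2) inj_blowup_params by auto
  have "\<psi> -` N = inv \<psi> ` (range \<psi> \<inter> N)"
  proof
    show "\<psi> -` N \<subseteq> inv \<psi> ` (range \<psi> \<inter> N)"
    proof
      fix x assume "x \<in> \<psi> -` N"
      then show "x \<in> inv \<psi> ` (range \<psi> \<inter> N)"
        by (intro image_eqI[of _ _ "\<psi> x"]) (simp_all add: inv_f_f[OF \<open>inj \<psi>\<close>])
    qed
    show "inv \<psi> ` (range \<psi> \<inter> N) \<subseteq> \<psi> -` N"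
      by (auto simp: f_inv_into_f)
  qed
  moreover have "(range \<psi>, inv \<psi>) \<in> blowup_atlas"
    using assms(2) unfolding blowup_atlas_def by blast
  ultimately show ?thesis
    using assms(1) unfolding smooth_atlas_openin[OF smooth_atlas_blowup] by fastforce
qed

text \<open>Cell decomposition of the projective plane: lines with nonzero first coordinate, then
  those with first coordinate zero and second nonzero, then the last point. In the two lower cells
  the blow-down has first entry 0.\<close>

lemma blowup_cases:
  assumes "y \<in> blowup"
  obtains z a b c where "y = blowup_param1 (z, a, b, c)"
  | z a c where "y = blowup_param2 (z, a, 0, c)"
  | z a where "y = blowup_param3 (z, a, 0, 0)"
proof -
  from assms consider (1) x where "y = blowup_param1 x" | (2) x where "y = blowup_param2 x"
    | (3) x where "y = blowup_param3 x"
    unfolding mcarrier_blowup_atlas[symmetric] by (auto simp: mcarrier_def blowup_atlas_def)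
  then show ?thesis
  proof cases
    case (1 x) then show ?thesis using that(1) by (cases x) auto
  next
    case (2 x)
    obtain z a b c where "x = (z, a, b, c)" by (cases x) auto
    with 2 show ?thesis using that(1,2) blowup_param_transitions(3) by (cases "b = 0") auto
  next
    case (3 x)
    obtain z a b c where x: "x = (z, a, b, c)" by (cases x) auto
    consider "b \<noteq> 0" | "b = 0" "c \<noteq> 0" | "b = 0" "c = 0" by blast
    then show ?thesis
      using 3 x that blowup_param_transitions(5,6) by cases auto
  qed
qed

lemma blowup_param1_in_blowup: "blowup_param1 y \<in> blowup"
  unfolding mcarrier_blowup_atlas[symmetric] mcarrier_def blowup_atlas_def by auto

lemma blowdown_param1: "blowdown (blowup_param1 (z, a, b, c)) = ((a, z), (a * b, a * c + z))"
  by (simp add: blowdown_def blowup_param1.simps)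

lemma blowdown_param2: "blowdown (blowup_param2 (z, a, b, c)) = ((a * b, z), (a, a * c + z))"
  by (simp add: blowdown_def blowup_param2.simps)

lemma blowdown_param3: "blowdown (blowup_param3 (z, a, b, c)) = ((a * b, z), (a * c, a + z))"
  by (simp add: blowdown_def blowup_param3.simps)

text \<open>A nonzero first entry of the blow-down excludes the two lower cells; in the first chart
  the relevant entries are a and ab, so the condition is that a and b are nonzero.\<close>

lemma pair_part_eq: "pair_part = blowup_param1 ` pair_coords"
proof
  show "blowup_param1 ` pair_coords \<subseteq> pair_part"
    by (auto simp: pair_part_def blowup_param1_in_blowup blowdown_param1 punctured_def)
  show "pair_part \<subseteq> blowup_param1 ` pair_coords"
  proof
    fix y assume "y \<in> pair_part"
    then have y: "y \<in> blowup" "blowdown y \<in> punctured \<times> punctured" by (auto simp: pair_part_def)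
    from y(1) show "y \<in> blowup_param1 ` pair_coords"
      by (cases rule: blowup_cases)
        (use y(2) in \<open>auto simp: blowdown_def punctured_def blowup_param1.simps blowup_param2.simps
            blowup_param3.simps image_iff\<close>)
  qed
qed

text \<open>Supplies removed points close to a limit point: the curves used below meet the removed
  set at all but at most two parameters, and 0 is not isolated in the complex plane.\<close>

lemma near_point:
  fixes \<gamma> :: "complex \<Rightarrow> 'a::topological_space"
  assumes "isCont \<gamma> 0" "open V" "\<gamma> 0 \<in> V"
  shows "\<exists>s. s \<noteq> u \<and> s \<noteq> v \<and> \<gamma> s \<in> V"
proof -
  have "\<forall>\<^sub>F s in at 0. \<gamma> s \<in> V"
    using assms by (auto simp: isCont_def dest: topological_tendstoD)
  moreover have "\<forall>\<^sub>F s in at 0. s \<noteq> u" "\<forall>\<^sub>F s in at 0. s \<noteq> v"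
    by (rule eventually_neq_at_within)+
  ultimately have "\<forall>\<^sub>F s in at (0::complex). s \<noteq> u \<and> s \<noteq> v \<and> \<gamma> s \<in> V"
    by eventually_elim blast
  then show ?thesis by (rule eventually_happens'[rotated]) simp
qed

lemma G_space_eq: "G_space = blowup_param1 ` G_coords"
proof
  let ?R = "{y \<in> blowup. blowdown y \<in> removed}"
  let ?T = "mtopology blowup_atlas"
  have topspace: "topspace ?T = blowup"
  proof
    show "topspace ?T \<subseteq> blowup"
      using openin_topspace[of ?T] unfolding smooth_atlas_openin[OF smooth_atlas_blowup]
        mcarrier_blowup_atlas by blast
    have "openin ?T blowup"
      unfolding smooth_atlas_openin[OF smooth_atlas_blowup] mcarrier_blowup_atlas
    proof (intro conjI ballI)
      fix c :: "(C4 \<times> C3 set, complex \<times> complex \<times> complex \<times> complex) chart"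
      assume c: "c \<in> blowup_atlas"
      then have "fst c \<subseteq> blowup"
        unfolding mcarrier_blowup_atlas[symmetric] mcarrier_def by blast
      then show "open (snd c ` (fst c \<inter> blowup))"
        using smooth_atlasD(2)[OF smooth_atlas_blowup c] by (simp add: Int_absorb2)
    qed simp
    then show "blowup \<subseteq> topspace ?T" by (rule openin_subset)
  qed
  show "blowup_param1 ` G_coords \<subseteq> G_space"
  proof
    fix y assume y: "y \<in> blowup_param1 ` G_coords"
    \<comment> \<open>If b is nonzero then a and ab vanish together, while \<open>removed\<close>
      demands that exactly one of them vanishes.\<close>
    have "blowup_param1 ` G_coords \<inter> ?R = {}"
      by (auto simp: blowdown_param1 removed_def)
    moreover have "\<exists>x. x \<in> ?R \<and> x \<in> blowup_param1 ` G_coords" if "y \<in> ?T closure_of ?R"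
    proof -
      from that have "\<forall>T. y \<in> T \<and> openin ?T T \<longrightarrow> (\<exists>x. x \<in> ?R \<and> x \<in> T)"
        unfolding in_closure_of by (rule conjunct2)
      from this[THEN spec, THEN mp, OF conjI[OF y openin_blowup_param1_image[OF open_G_coords]]]
      show ?thesis .
    qed
    ultimately have "y \<notin> ?T closure_of ?R" by blast
    then show "y \<in> G_space" using y blowup_param1_in_blowup by (auto simp: G_space_def)
  qed
  have closure: "\<psi> y \<in> ?T closure_of ?R"
    if \<psi>: "\<psi> \<in> {blowup_param1, blowup_param2, blowup_param3}" "\<psi> y \<in> blowup"
      and \<gamma>: "isCont \<gamma> 0" "\<gamma> 0 = y" "\<And>s. s \<noteq> u \<Longrightarrow> s \<noteq> v \<Longrightarrow> \<psi> (\<gamma> s) \<in> ?R"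
    for \<psi> y u v and \<gamma> :: "complex \<Rightarrow> complex \<times> complex \<times> complex \<times> complex"
    unfolding in_closure_of topspace
  proof (intro conjI allI impI)
    show "\<psi> y \<in> blowup" by fact
    fix N assume N: "\<psi> y \<in> N \<and> openin ?T N"
    have "open (\<psi> -` N)" using open_blowup_param_vimage[OF _ \<psi>(1)] N by blast
    then obtain s where "s \<noteq> u" "s \<noteq> v" "\<gamma> s \<in> \<psi> -` N"
      using near_point[OF \<gamma>(1), of "\<psi> -` N" u v] N \<gamma>(2) by auto
    then show "\<exists>x. x \<in> ?R \<and> x \<in> N" using \<gamma>(3) by blast
  qed
  show "G_space \<subseteq> blowup_param1 ` G_coords"
  proof
    fix y assume "y \<in> G_space"
    then have y: "y \<in> blowup" "y \<notin> ?T closure_of ?R" by (auto simp: G_space_def)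
    have in_blowup: "blowup_param2 x \<in> blowup" "blowup_param3 x \<in> blowup" for x
      unfolding mcarrier_blowup_atlas[symmetric] mcarrier_def blowup_atlas_def by auto
    from y(1) show "y \<in> blowup_param1 ` G_coords"
    proof (cases rule: blowup_cases)
      case (1 z a b c)
      have "b \<noteq> 0"
      proof
        assume b: "b = 0"
        \<comment> \<open>With b = 0 the blow-down has third entry 0, so it lies in
          \<open>removed\<close> once the first entry a + s is nonzero.\<close>
        have "blowup_param1 (z, a, 0, c) \<in> ?T closure_of ?R"
          by (rule closure[where \<gamma> = "\<lambda>s. (z, a + s, 0, c)" and u = "- a" and v = "- a"])
            (auto simp: blowup_param1_in_blowup blowdown_param1 removed_def add_eq_0_iff
              intro!: continuous_intros)
        then show False using y(2) 1 b by simp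
      qed
      then show ?thesis using 1 by auto
    next
      case (2 z a c)
      \<comment> \<open>Here the roles are exchanged: the first entry is 0 and the third is a +
        s.\<close>
      have "blowup_param2 (z, a, 0, c) \<in> ?T closure_of ?R"
        by (rule closure[where \<gamma> = "\<lambda>s. (z, a + s, 0, c)" and u = "- a" and v = "- a"])
          (auto simp: in_blowup blowdown_param2 removed_def add_eq_0_iff
            intro!: continuous_intros)
      then show ?thesis using y(2) 2 by simp
    next
      case (3 z a)
      \<comment> \<open>At c = 0 the first and the third entry both vanish, so c has to move too:
        the third entry becomes (a + s) s, nonzero unless s is -a or 0. Moving c alone would fail
        for a = 0.\<close>
      have "blowup_param3 (z, a, 0, 0) \<in> ?T closure_of ?R"
        by (rule closure[where \<gamma> = "\<lambda>s. (z, a + s, 0, s)" and u = "- a" and v = 0])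
          (auto simp: in_blowup blowdown_param3 removed_def add_eq_0_iff
            intro!: continuous_intros)
      then show ?thesis using y(2) 3 by simp
    qed
  qed
qed

lemma pair_part_subset: "pair_part \<subseteq> G_space"
  unfolding pair_part_eq G_space_eq by auto

text \<open>Stated for an arbitrary open V because it is applied both to \<open>G_space\<close> and
  to \<open>pair_part\<close>.\<close>

lemma global_chart_blowup_param1:
  assumes "open V"
  shows "global_chart (open_submanifold blowup_atlas (blowup_param1 ` V)) (blowup_param1 ` V, inv blowup_param1)"
proof
  show "smooth_atlas (open_submanifold blowup_atlas (blowup_param1 ` V))"
    by (rule smooth_atlas_open_submanifold[OF smooth_atlas_blowup openin_blowup_param1_image[OF assms]])
  have "range blowup_param1 \<inter> blowup_param1 ` V = blowup_param1 ` V" by auto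
  then show "(blowup_param1 ` V, inv blowup_param1) \<in> open_submanifold blowup_atlas (blowup_param1 ` V)"
    unfolding open_submanifold_def by (intro image_eqI[OF _ blowup_param1_chart]) simp
  show "mcarrier (open_submanifold blowup_atlas (blowup_param1 ` V)) = fst (blowup_param1 ` V, inv blowup_param1)"
    using blowup_param1_in_blowup by (auto simp: mcarrier_open_submanifold mcarrier_blowup_atlas)
qed

text \<open>A member of \<open>G_atlas\<close> whose domain is the whole arrow space; the
  restrictions of the other two affine charts are further members.\<close>

definition G_chart :: "(C4 \<times> C3 set, complex \<times> complex \<times> complex \<times> complex) chart" where
  "G_chart = (G_space, inv blowup_param1)"

lemma global_chart_G: "global_chart G_atlas G_chart"
  unfolding G_atlas_def G_chart_def G_space_eq by (rule global_chart_blowup_param1[OF open_G_coords])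

lemma mcarrier_G: "mcarrier G_atlas = G_space"
  using global_chart.carrier[OF global_chart_G] by (simp add: G_chart_def)

lemma chart_inv_blowup_param1:
  "y \<in> V \<Longrightarrow> chart_inv (blowup_param1 ` V, inv blowup_param1) y = blowup_param1 y"
  unfolding chart_inv_def by (rule inv_into_f_eq) (auto simp: inj_on_def)

lemma G_chart_simps [simp]:
  "fst G_chart = G_space" "snd G_chart = inv blowup_param1"
  "inv blowup_param1 ` G_space = G_coords"
  "y \<in> G_coords \<Longrightarrow> chart_inv G_chart y = blowup_param1 y"
  by (simp_all add: G_chart_def G_space_eq image_image chart_inv_blowup_param1 del: case_prod_conv split_paired_All
      mem_Collect_eq)

lemma blowdown_diffeomorphism:
  "diffeomorphism (open_submanifold blowup_atlas pair_part)
    (open_submanifold euclidean_atlas (punctured \<times> punctured)) blowdown"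
proof -
  let ?A = "open_submanifold blowup_atlas pair_part" and ?c = "(pair_part, inv blowup_param1)"
  let ?P = "punctured \<times> punctured"
  let ?B = "open_submanifold euclidean_atlas ?P" and ?d = "(UNIV \<inter> ?P, id) :: (C4, C4) chart"
  have openP: "open ?P"
    unfolding punctured_def by (intro open_Times open_Diff) auto
  interpret A: global_chart ?A ?c
    unfolding pair_part_eq by (rule global_chart_blowup_param1[OF open_pair_coords])
  interpret E: global_chart "euclidean_atlas :: (C4, C4) chart set" "(UNIV, id)"
    by (rule global_chart_euclidean)
  interpret B: global_chart ?B ?d
    using E.global_chart_open_submanifold[of ?P] openP by (simp add: E.openin_iff)
  interpret AB: global_charts ?A ?c ?B ?d ..
  interpret BA: global_charts ?B ?d ?A ?c ..
  have images: "snd ?c ` fst ?c = pair_coords" "snd ?d ` fst ?d = ?P"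
    by (simp_all add: pair_part_eq image_image)
  have invs: "y \<in> pair_coords \<Longrightarrow> chart_inv ?c y = blowup_param1 y" for y
    unfolding pair_part_eq by (rule chart_inv_blowup_param1)
  have inv_d: "chart_inv ?d x = x" if "x \<in> ?P" for x
    unfolding chart_inv_def by (rule inv_into_f_eq) (use that in auto)
  \<comment> \<open>Inverse of the blow-down where p is nonzero, from solving (p, q, p', q') = (a,
    z, ab, ac + z) for z, a, b, c.\<close>
  define g where "g = (\<lambda>x::C4. (snd (fst x), fst (fst x), fst (snd x) / fst (fst x),
    (snd (snd x) - snd (fst x)) / fst (fst x)))"
  have g: "g x \<in> pair_coords" "blowdown (blowup_param1 (g x)) = x" if "x \<in> ?P" for x
    using that by (auto simp: g_def punctured_def blowdown_param1)
  have g': "blowdown (blowup_param1 y) \<in> ?P" "g (blowdown (blowup_param1 y)) = y" if "y \<in> pair_coords" for y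
    using that by (auto simp: g_def punctured_def blowdown_param1)
  have g'': "blowdown y \<in> ?P" "blowup_param1 (g (blowdown y)) = y" if y: "y \<in> pair_part" for y
  proof -
    from y obtain x where "x \<in> pair_coords" "y = blowup_param1 x"
      unfolding pair_part_eq by (rule imageE)
    then show "blowdown y \<in> ?P" "blowup_param1 (g (blowdown y)) = y" using g'[of x] by simp_all
  qed
  have bij: "bij_betw blowdown pair_part ?P"
    by (rule bij_betw_byWitness[where f' = "\<lambda>x. blowup_param1 (g x)"], intro ballI, erule g''(2),
        intro ballI, erule g(2), rule image_subsetI, erule g''(1), unfold pair_part_eq,
        rule image_subsetI, rule imageI, erule g(1))
  note inj = bij_betw_imp_inj_on[OF bij]
  have inv: "inv_into pair_part blowdown x = blowup_param1 (g x)" if "x \<in> ?P" for x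
    by (rule inv_into_f_eq[OF inj]) (use g[OF that] in \<open>auto simp: pair_part_eq\<close>)
  have carriers: "mcarrier ?A = pair_part" "mcarrier ?B = ?P"
    using A.carrier B.carrier by simp_all
  have "smooth_map ?A ?B blowdown"
    unfolding AB.smooth_map_iff images
  proof
    show "blowdown ` fst ?c \<subseteq> fst ?d" using bij by (auto simp: bij_betw_def)
    have "smooth_on pair_coords (\<lambda>y. ((fst (snd y), fst y),
        (fst (snd y) * fst (snd (snd y)), fst (snd y) * snd (snd (snd y)) + fst y)))"
      by (intro smooth_intros open_pair_coords)
    then show "smooth_on pair_coords (snd ?d \<circ> blowdown \<circ> chart_inv ?c)"
      by (rule smooth_on_cong[OF open_pair_coords]) (use invs in \<open>auto simp: blowdown_param1\<close>)
  qed
  moreover have "smooth_map ?B ?A (inv_into (mcarrier ?A) blowdown)"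
    unfolding BA.smooth_map_iff images carriers
  proof
    show "inv_into pair_part blowdown ` fst ?d \<subseteq> fst ?c"
      using inv g(1) by (auto simp: pair_part_eq)
    have "smooth_on ?P g"
      unfolding g_def by (intro smooth_intros openP) (auto simp: punctured_def)
    then show "smooth_on ?P (snd ?c \<circ> inv_into pair_part blowdown \<circ> chart_inv ?d)"
      by (rule smooth_on_cong[OF openP]) (use inv_d inv in simp)
  qed
  ultimately show ?thesis
    unfolding diffeomorphism_def carriers using bij by simp
qed

section \<open>The groupoid structure\<close>

type_synonym G_coord = "complex \<times> complex \<times> complex \<times> complex"

text \<open>For composable arrows the base point (z', a') of the second factor is (ac + z, ab),
  determined by the first. The formula is polynomial and makes sense for all pairs of
  coordinates.\<close>

fun G_mult :: "G_coord \<Rightarrow> G_coord \<Rightarrow> G_coord" where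
  "G_mult (z, a, b, c) (z', a', b', c') = (z, a, b * b', c + b * c')"

text \<open>The first two entries are the coordinates of the source, the last two describe the
  inverse of the affine map with slope b and translation c.\<close>

fun G_inverse :: "G_coord \<Rightarrow> G_coord" where
  "G_inverse (z, a, b, c) = (a * c + z, a * b, 1 / b, - c / b)"

definition G_groupoid :: "(C4 \<times> C3 set, complex \<times> complex) groupoid" where
  "G_groupoid =
    \<lparr>src = (\<lambda>g. snd (blowdown g)), tgt = (\<lambda>g. fst (blowdown g)),
     gmult = (\<lambda>g h. blowup_param1 (G_mult (inv blowup_param1 g) (inv blowup_param1 h))),
     gunit = (\<lambda>x. blowup_param1 (snd x, fst x, 1, 0)),
     ginv = (\<lambda>g. blowup_param1 (G_inverse (inv blowup_param1 g)))\<rparr>"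

lemma G_groupoid_simps [simp]:
  "src G_groupoid (blowup_param1 (z, a, b, c)) = (a * b, a * c + z)"
  "tgt G_groupoid (blowup_param1 (z, a, b, c)) = (a, z)"
  "gmult G_groupoid (blowup_param1 x) (blowup_param1 y) = blowup_param1 (G_mult x y)"
  "gunit G_groupoid u = blowup_param1 (snd u, fst u, 1, 0)"
  "ginv G_groupoid (blowup_param1 x) = blowup_param1 (G_inverse x)"
  by (simp_all add: G_groupoid_def blowdown_param1)

lemma blowup_param1_eq_iff [simp]: "blowup_param1 x = blowup_param1 y \<longleftrightarrow> x = y"
  using inj_blowup_params(1) by (rule inj_eq)

lemma in_G_space_iff [simp]: "blowup_param1 (z, a, b, c) \<in> G_space \<longleftrightarrow> b \<noteq> 0"
  by (auto simp: G_space_eq)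

lemma in_pair_part_iff [simp]: "blowup_param1 (z, a, b, c) \<in> pair_part \<longleftrightarrow> a \<noteq> 0 \<and> b \<noteq> 0"
  by (auto simp: pair_part_eq)

lemma G_space_cases:
  assumes "g \<in> G_space"
  obtains z a b c where "g = blowup_param1 (z, a, b, c)" "b \<noteq> 0"
  using assms by (auto simp: G_space_eq)

lemma blowup_param1_inv [simp]: "g \<in> G_space \<Longrightarrow> blowup_param1 (inv blowup_param1 g) = g"
  by (elim G_space_cases) simp

lemma pair_part_cases:
  assumes "g \<in> pair_part"
  obtains z a b c where "g = blowup_param1 (z, a, b, c)" "a \<noteq> 0" "b \<noteq> 0"
  using assms by (auto simp: pair_part_eq)

lemma is_groupoid_G: "is_groupoid G_space UNIV G_groupoid"
proof -
  have "src G_groupoid g \<in> UNIV \<and> tgt G_groupoid g \<in> UNIV \<and> ginv G_groupoid g \<in> G_space" if "g \<in> G_space" for g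
    using that by (cases rule: G_space_cases) simp
  moreover have "gmult G_groupoid g h \<in> G_space \<and> tgt G_groupoid (gmult G_groupoid g h) = tgt G_groupoid g \<and>
      src G_groupoid (gmult G_groupoid g h) = src G_groupoid h"
    if "(g, h) \<in> composable G_space G_groupoid" for g h
  proof -
    from that have "g \<in> G_space" "h \<in> G_space" and st: "src G_groupoid g = tgt G_groupoid h"
      by (auto simp: composable_def)
    then show ?thesis
      by (elim G_space_cases) (use st in \<open>simp add: algebra_simps\<close>)
  qed
  moreover have "gmult G_groupoid (gmult G_groupoid g h) k = gmult G_groupoid g (gmult G_groupoid h k)"
    if "(g, h) \<in> composable G_space G_groupoid" "(h, k) \<in> composable G_space G_groupoid" for g h k
  proof -
    from that have "g \<in> G_space" "h \<in> G_space" "k \<in> G_space" by (auto simp: composable_def)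
    then show ?thesis by (elim G_space_cases) (simp add: algebra_simps)
  qed
  moreover have "gmult G_groupoid (gunit G_groupoid (tgt G_groupoid g)) g = g \<and>
      gmult G_groupoid g (gunit G_groupoid (src G_groupoid g)) = g" if "g \<in> G_space" for g
    using that by (cases rule: G_space_cases) simp
  moreover have "src G_groupoid (ginv G_groupoid g) = tgt G_groupoid g \<and>
      tgt G_groupoid (ginv G_groupoid g) = src G_groupoid g \<and>
      gmult G_groupoid g (ginv G_groupoid g) = gunit G_groupoid (tgt G_groupoid g) \<and>
      gmult G_groupoid (ginv G_groupoid g) g = gunit G_groupoid (src G_groupoid g)" if "g \<in> G_space" for g
    using that by (cases rule: G_space_cases) (simp add: field_simps)
  ultimately show ?thesis
    unfolding is_groupoid_def by auto
qed

section \<open>Smoothness of the structure maps and agreement with the pair groupoid\<close>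

interpretation G: global_chart G_atlas G_chart
  by (rule global_chart_G)

interpretation C2: global_chart "euclidean_atlas :: (complex \<times> complex, complex \<times> complex) chart set" "(UNIV, id)"
  by (rule global_chart_euclidean)

interpretation GG: global_charts G_atlas G_chart G_atlas G_chart ..

interpretation GC: global_charts G_atlas G_chart
  "euclidean_atlas :: (complex \<times> complex, complex \<times> complex) chart set" "(UNIV, id)" ..

interpretation CG: global_charts "euclidean_atlas :: (complex \<times> complex, complex \<times> complex) chart set"
  "(UNIV, id)" G_atlas G_chart ..

abbreviation GG_chart :: "((C4 \<times> C3 set) \<times> (C4 \<times> C3 set), G_coord \<times> G_coord) chart" where
  "GG_chart \<equiv> (fst G_chart \<times> fst G_chart, map_prod (snd G_chart) (snd G_chart))"

interpretation P: global_chart "product_atlas G_atlas G_atlas" GG_chart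
  by (rule global_chart_product[OF global_chart_G global_chart_G])

interpretation PG: global_charts "product_atlas G_atlas G_atlas" GG_chart G_atlas G_chart ..

lemma GG_chart_image: "snd GG_chart ` fst GG_chart = G_coords \<times> G_coords"
  by (simp add: map_prod_surj_on)

lemma GG_chart_inv:
  assumes "y \<in> G_coords \<times> G_coords"
  shows "chart_inv GG_chart y = (blowup_param1 (fst y), blowup_param1 (snd y))"
proof -
  have y: "fst y \<in> G_coords" "snd y \<in> G_coords" using assms by (simp_all only: mem_Times_iff)
  have "chart_inv GG_chart y = (chart_inv G_chart (fst y), chart_inv G_chart (snd y))"
    by (rule product_chart_inv[OF G.chart_inj G.chart_inj]) (use assms GG_chart_image in simp)
  then show ?thesis
    unfolding G_chart_simps(4)[OF y(1)] G_chart_simps(4)[OF y(2)] .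
qed

lemma smooth_G_src: "smooth_map G_atlas euclidean_atlas (src G_groupoid)"
  unfolding GC.smooth_map_iff G_chart_simps
proof
  have "smooth_on G_coords (\<lambda>y. (fst (snd y) * fst (snd (snd y)), fst (snd y) * snd (snd (snd y)) + fst y))"
    by (intro smooth_intros open_G_coords)
  then show "smooth_on G_coords (snd (UNIV, id) \<circ> src G_groupoid \<circ> chart_inv G_chart)"
    by (rule smooth_on_cong[OF open_G_coords]) auto
qed simp

lemma smooth_G_tgt: "smooth_map G_atlas euclidean_atlas (tgt G_groupoid)"
  unfolding GC.smooth_map_iff G_chart_simps
proof
  have "smooth_on G_coords (\<lambda>y. (fst (snd y), fst y))"
    by (intro smooth_intros open_G_coords)
  then show "smooth_on G_coords (snd (UNIV, id) \<circ> tgt G_groupoid \<circ> chart_inv G_chart)"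
    by (rule smooth_on_cong[OF open_G_coords]) auto
qed simp

lemma smooth_G_inv: "smooth_map G_atlas G_atlas (ginv G_groupoid)"
  unfolding GG.smooth_map_iff G_chart_simps
proof
  show "ginv G_groupoid ` G_space \<subseteq> G_space"
    using is_groupoid_G by (auto simp: is_groupoid_def)
  have "smooth_on G_coords (\<lambda>y. (fst (snd y) * snd (snd (snd y)) + fst y, fst (snd y) * fst (snd (snd y)),
      1 / fst (snd (snd y)), - snd (snd (snd y)) / fst (snd (snd y))))"
    by (intro smooth_intros open_G_coords) auto
  then show "smooth_on G_coords (inv blowup_param1 \<circ> ginv G_groupoid \<circ> chart_inv G_chart)"
    by (rule smooth_on_cong[OF open_G_coords]) auto
qed

lemma smooth_G_unit: "smooth_map euclidean_atlas G_atlas (gunit G_groupoid)"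
  unfolding CG.smooth_map_iff G_chart_simps
proof
  show "gunit G_groupoid ` fst (UNIV, id) \<subseteq> G_space" by auto
  have "smooth_on UNIV (\<lambda>x. (snd x, fst x, 1, 0) :: G_coord)"
    by (intro smooth_intros open_UNIV)
  then show "smooth_on (snd (UNIV, id) ` fst (UNIV, id)) (inv blowup_param1 \<circ> gunit G_groupoid \<circ> chart_inv (UNIV, id))"
    by (simp add: comp_def)
qed

text \<open>\<open>smooth_map_on_subset\<close> asks for smooth extensions from the composable
  pairs; this one extension to all pairs of arrows serves at every point.\<close>

lemma smooth_G_mult: "smooth_map (product_atlas G_atlas G_atlas) G_atlas (\<lambda>(g, h). gmult G_groupoid g h)"
  unfolding PG.smooth_map_iff GG_chart_image
proof
  have "gmult G_groupoid g h \<in> G_space" if "g \<in> G_space" "h \<in> G_space" for g h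
    using that by (elim G_space_cases) simp
  then show "(\<lambda>(g, h). gmult G_groupoid g h) ` fst GG_chart \<subseteq> fst G_chart" by auto
  have o: "open (G_coords \<times> G_coords)" by (intro open_Times open_G_coords)
  have "smooth_on (G_coords \<times> G_coords) (\<lambda>y. (fst (fst y), fst (snd (fst y)),
      fst (snd (snd (fst y))) * fst (snd (snd (snd y))),
      snd (snd (snd (fst y))) + fst (snd (snd (fst y))) * snd (snd (snd (snd y)))))"
    by (intro smooth_intros o)
  then show "smooth_on (G_coords \<times> G_coords) (snd G_chart \<circ> (\<lambda>(g, h). gmult G_groupoid g h) \<circ> chart_inv GG_chart)"
  proof (rule smooth_on_cong[OF o])
    fix y assume y: "y \<in> G_coords \<times> G_coords"
    show "(fst (fst y), fst (snd (fst y)), fst (snd (snd (fst y))) * fst (snd (snd (snd y))),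
      snd (snd (snd (fst y))) + fst (snd (snd (fst y))) * snd (snd (snd (snd y))))
      = (snd G_chart \<circ> (\<lambda>(g, h). gmult G_groupoid g h) \<circ> chart_inv GG_chart) y"
      unfolding comp_apply GG_chart_inv[OF y] by (cases y) auto
  qed
qed

lemma src_has_derivative:
  "((\<lambda>y. src G_groupoid (chart_inv G_chart y)) has_derivative
    (\<lambda>v. (fst (snd v) * b + a * fst (snd (snd v)), fst (snd v) * c + a * snd (snd (snd v)) + fst v)))
    (at (z, a, b, c))" if "b \<noteq> 0"
proof (rule has_derivative_transform_within_open[OF _ open_G_coords])
  show "((\<lambda>y. (fst (snd y) * fst (snd (snd y)), fst (snd y) * snd (snd (snd y)) + fst y)) has_derivative
      (\<lambda>v. (fst (snd v) * b + a * fst (snd (snd v)), fst (snd v) * c + a * snd (snd (snd v)) + fst v)))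
      (at (z, a, b, c))"
    by (auto intro!: derivative_eq_intros simp: algebra_simps)
qed (use that in auto)

lemma tgt_has_derivative:
  "((\<lambda>y. tgt G_groupoid (chart_inv G_chart y)) has_derivative (\<lambda>v. (fst (snd v), fst v)))
    (at (z, a, b, c))" if "b \<noteq> 0"
proof (rule has_derivative_transform_within_open[OF _ open_G_coords])
  show "((\<lambda>y. (fst (snd y), fst y)) has_derivative (\<lambda>v. (fst (snd v), fst v))) (at (z, a, b, c))"
    by (auto intro!: derivative_eq_intros)
qed (use that in auto)

lemma lie_groupoid_G: "lie_groupoid G_atlas euclidean_atlas G_groupoid"
  unfolding lie_groupoid_def
proof (intro conjI)
  show "smooth_manifold G_atlas" by (rule G.smooth_manifold)
  show "smooth_manifold (euclidean_atlas :: (complex \<times> complex, complex \<times> complex) chart set)"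
    by (rule C2.smooth_manifold)
  show "is_groupoid (mcarrier G_atlas) (mcarrier euclidean_atlas) G_groupoid"
    using is_groupoid_G by (simp add: mcarrier_G)
  show "submersion G_atlas euclidean_atlas (src G_groupoid)"
  proof (rule G.submersion_to_euclidean[OF smooth_G_src])
    fix g assume "g \<in> fst G_chart"
    then have g: "g \<in> G_space" by simp
    let ?D = "\<lambda>(z, a, b, c) v :: G_coord. (fst (snd v) * b + a * fst (snd (snd v)),
      fst (snd v) * c + a * snd (snd (snd v)) + fst v)"
    from g obtain z a b c where g: "g = blowup_param1 (z, a, b, c)" "b \<noteq> 0" by (rule G_space_cases)
    then show "((\<lambda>y. src G_groupoid (chart_inv G_chart y)) has_derivative ?D (snd G_chart g)) (at (snd G_chart g))"
      using src_has_derivative[of b a c z] by simp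
    show "surj (?D (snd G_chart g))"
    proof (rule surjI)
      fix w :: "complex \<times> complex"
      \<comment> \<open>A preimage of w with vanishing b- and c-components; it exists because b is
        nonzero.\<close>
      show "?D (snd G_chart g) (snd w - fst w / b * c, fst w / b, 0, 0) = w"
        using g by (cases w) simp
    qed
  qed
  show "submersion G_atlas euclidean_atlas (tgt G_groupoid)"
  proof (rule G.submersion_to_euclidean[OF smooth_G_tgt])
    fix g assume "g \<in> fst G_chart"
    then have g: "g \<in> G_space" by simp
    then obtain z a b c where g: "g = blowup_param1 (z, a, b, c)" "b \<noteq> 0" by (rule G_space_cases)
    then show "((\<lambda>y. tgt G_groupoid (chart_inv G_chart y)) has_derivative (\<lambda>v. (fst (snd v), fst v)))
        (at (snd G_chart g))"
      using tgt_has_derivative[of b z a c] by simp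
    show "surj (\<lambda>v :: G_coord. (fst (snd v), fst v))"
      by (rule surjI[where f = "\<lambda>w. (snd w, fst w, 0, 0)"]) simp
  qed
  show "smooth_map_on_subset (product_atlas G_atlas G_atlas) (composable (mcarrier G_atlas) G_groupoid) G_atlas
      (\<lambda>(g, h). gmult G_groupoid g h)"
    unfolding smooth_map_on_subset_def
  proof
    fix p assume p: "p \<in> composable (mcarrier G_atlas) G_groupoid"
    have W: "openin (mtopology (product_atlas G_atlas G_atlas)) (fst GG_chart)"
      using openin_topspace P.topspace_eq by metis
    have "smooth_map (open_submanifold (product_atlas G_atlas G_atlas) (fst GG_chart)) G_atlas
        (\<lambda>(g, h). gmult G_groupoid g h)"
      using smooth_G_mult unfolding PG.smooth_map_open_submanifold_iff[OF W] PG.smooth_map_iff .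
    moreover have "p \<in> fst GG_chart" using p by (auto simp: composable_def mcarrier_G)
    ultimately show "\<exists>W F. openin (mtopology (product_atlas G_atlas G_atlas)) W \<and> p \<in> W \<and>
        smooth_map (open_submanifold (product_atlas G_atlas G_atlas) W) G_atlas F \<and>
        (\<forall>q\<in>W \<inter> composable (mcarrier G_atlas) G_groupoid. F q = (\<lambda>(g, h). gmult G_groupoid g h) q)"
      using W by blast
  qed
  show "smooth_map euclidean_atlas G_atlas (gunit G_groupoid)" by (rule smooth_G_unit)
  show "smooth_map G_atlas G_atlas (ginv G_groupoid)" by (rule smooth_G_inv)
qed

lemma extends_groupoid_G: "extends_groupoid blowdown pair_part punctured G_groupoid pair_groupoid"
proof -
  have "src G_groupoid g = src pair_groupoid (blowdown g) \<and> tgt G_groupoid g = tgt pair_groupoid (blowdown g) \<and>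
      ginv G_groupoid g \<in> pair_part \<and> blowdown (ginv G_groupoid g) = ginv pair_groupoid (blowdown g)"
    if "g \<in> pair_part" for g
    using that
    by (cases rule: pair_part_cases) (simp add: pair_groupoid_def blowdown_param1 field_simps)
  moreover have "gunit G_groupoid x \<in> pair_part \<and> blowdown (gunit G_groupoid x) = gunit pair_groupoid x"
    if "x \<in> punctured" for x
    using that by (auto simp: punctured_def pair_groupoid_def blowdown_param1)
  moreover have "gmult G_groupoid g h \<in> pair_part \<and>
      blowdown (gmult G_groupoid g h) = gmult pair_groupoid (blowdown g) (blowdown h)"
    if "(g, h) \<in> composable pair_part G_groupoid" for g h
  proof -
    from that have "g \<in> pair_part" "h \<in> pair_part" and st: "src G_groupoid g = tgt G_groupoid h"
      by (auto simp: composable_def)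
    then show ?thesis
      by (elim pair_part_cases) (use st in \<open>simp add: pair_groupoid_def blowdown_param1 algebra_simps\<close>)
  qed
  ultimately show ?thesis unfolding extends_groupoid_def by blast
qed

subsection \<open>Uniqueness\<close>

text \<open>0 is a limit point of the plane and the target is Hausdorff, so agreement on a punctured
  neighbourhood forces agreement at 0.\<close>

lemma isCont_eq_at_0:
  fixes f g :: "complex \<Rightarrow> 'a::t2_space"
  assumes "isCont f 0" "isCont g 0" "\<forall>\<^sub>F s in at 0. f s = g s"
  shows "f 0 = g 0"
proof -
  have "(f \<longlongrightarrow> g 0) (at 0)"
    using assms(2,3) tendsto_cong[of f g "at 0"] by (simp add: isCont_def)
  with assms(1) show ?thesis
    by (intro tendsto_unique[of "at 0" f]) (simp_all add: isCont_def)
qed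

lemma isCont_on_path:
  fixes \<gamma> :: "complex \<Rightarrow> 'a::t2_space" and f :: "'a \<Rightarrow> 'b::topological_space"
  assumes "continuous_on V f" "open V" "isCont \<gamma> 0" "\<gamma> 0 \<in> V"
  shows "isCont (\<lambda>s. f (\<gamma> s)) 0"
proof (rule isCont_o2[OF assms(3)])
  show "isCont f (\<gamma> 0)" using assms(1,2,4) by (simp add: continuous_on_eq_continuous_at)
qed

text \<open>Off a = 0, b and c are recovered from ab and ac + z. This converts statements about
  blown-down arrows into equalities of arrows.\<close>

lemma inj_on_blowdown_pair_part: "inj_on blowdown pair_part"
proof (rule inj_onI)
  fix g h assume "g \<in> pair_part" "h \<in> pair_part" "blowdown g = blowdown h"
  then show "g = h" by (elim pair_part_cases) (auto simp: blowdown_param1)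
qed

text \<open>Source and target come first: their agreement everywhere makes composability for
  \<open>H\<close> the same as for \<open>G_groupoid\<close>, which the comparison of products
  presupposes.\<close>

lemma extension_unique:
  assumes lie: "lie_groupoid G_atlas euclidean_atlas H"
    and ext: "extends_groupoid blowdown pair_part punctured H pair_groupoid"
  shows "same_groupoid G_space UNIV G_groupoid H"
proof -
  have grp: "is_groupoid G_space UNIV H"
    and src: "smooth_map G_atlas euclidean_atlas (src H)"
    and tgt: "smooth_map G_atlas euclidean_atlas (tgt H)"
    and mult: "smooth_map_on_subset (product_atlas G_atlas G_atlas) (composable G_space H) G_atlas (\<lambda>(g, h). gmult H g h)"
    and unit: "smooth_map euclidean_atlas G_atlas (gunit H)" and inv: "smooth_map G_atlas G_atlas (ginv H)"
    using lie by (simp_all add: lie_groupoid_def submersion_def mcarrier_G)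
  have closed: "gunit K x \<in> G_space" "g \<in> G_space \<Longrightarrow> ginv K g \<in> G_space"
      "(g, h) \<in> composable G_space K \<Longrightarrow> gmult K g h \<in> G_space"
    if "is_groupoid G_space UNIV K" for K :: "(C4 \<times> C3 set, complex \<times> complex) groupoid" and x g h
    using that unfolding is_groupoid_def by blast+
  have on_pair: "src K g = src pair_groupoid (blowdown g)" "tgt K g = tgt pair_groupoid (blowdown g)"
      "ginv K g \<in> pair_part" "blowdown (ginv K g) = ginv pair_groupoid (blowdown g)"
    if "g \<in> pair_part" "extends_groupoid blowdown pair_part punctured K pair_groupoid" for g K
    using that unfolding extends_groupoid_def by blast+
  have on_punctured: "gunit K x \<in> pair_part" "blowdown (gunit K x) = gunit pair_groupoid x"
    if "x \<in> punctured" "extends_groupoid blowdown pair_part punctured K pair_groupoid" for x K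
    using that unfolding extends_groupoid_def by blast+
  have H_pair: "src H g = src G_groupoid g" "tgt H g = tgt G_groupoid g" "ginv H g = ginv G_groupoid g"
    if g: "g \<in> pair_part" for g
    using on_pair[OF g ext] on_pair[OF g extends_groupoid_G] inj_onD[OF inj_on_blowdown_pair_part]
    by simp_all
  have H_unit: "gunit H x = gunit G_groupoid x" if x: "x \<in> punctured" for x
    by (rule inj_onD[OF inj_on_blowdown_pair_part _ on_punctured(1)[OF x ext]
          on_punctured(1)[OF x extends_groupoid_G]])
      (unfold on_punctured(2)[OF x ext] on_punctured(2)[OF x extends_groupoid_G], rule refl)
  have H_mult: "gmult H g h = gmult G_groupoid g h"
    if "g \<in> pair_part" "h \<in> pair_part" "src G_groupoid g = tgt G_groupoid h" for g h
  proof -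
    have "(g, h) \<in> composable pair_part G_groupoid" "(g, h) \<in> composable pair_part H"
      using that H_pair by (auto simp: composable_def)
    then have "gmult H g h \<in> pair_part \<and> blowdown (gmult H g h) = gmult pair_groupoid (blowdown g) (blowdown h)"
      "gmult G_groupoid g h \<in> pair_part \<and>
        blowdown (gmult G_groupoid g h) = gmult pair_groupoid (blowdown g) (blowdown h)"
      using ext extends_groupoid_G unfolding extends_groupoid_def by fast+
    then show ?thesis by (intro inj_onD[OF inj_on_blowdown_pair_part]) simp_all
  qed
  have cont: "continuous_on G_coords (\<lambda>y. f (blowup_param1 y))"
    if "smooth_map G_atlas euclidean_atlas f" for f :: "C4 \<times> C3 set \<Rightarrow> complex \<times> complex"
  proof -
    have "continuous_on G_coords (id \<circ> f \<circ> chart_inv G_chart)"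
      using that unfolding GC.smooth_map_iff G_chart_simps snd_conv
      by (elim conjE) (rule smooth_on_imp_continuous_on)
    then show ?thesis by (rule continuous_on_eq) (simp del: split_paired_All mem_Collect_eq case_prod_conv)
  qed
  have cont': "continuous_on G_coords (\<lambda>y. inv blowup_param1 (f (blowup_param1 y)))"
    if "smooth_map G_atlas G_atlas f" for f
  proof -
    have "continuous_on G_coords (inv blowup_param1 \<circ> f \<circ> chart_inv G_chart)"
      using that unfolding GG.smooth_map_iff G_chart_simps
      by (elim conjE) (rule smooth_on_imp_continuous_on)
    then show ?thesis by (rule continuous_on_eq) (simp del: split_paired_All mem_Collect_eq case_prod_conv)
  qed
  text \<open>Every arrow is the value at \<open>0\<close> of a continuous family that lies in \<open>pair_part\<close> for
    almost all parameters.\<close>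
  have ev: "\<forall>\<^sub>F s in at 0. a + s \<noteq> 0" for a :: complex
    using eventually_neq_at_within[of "- a" 0 UNIV] by eventually_elim (simp add: add_eq_0_iff)
  have path: "isCont (\<lambda>s. (z, a + s, b, c) :: G_coord) 0" for z a b c
    by (intro continuous_intros)
  have inv_eq: "g = h" if "g \<in> G_space" "h \<in> G_space" "inv blowup_param1 g = inv blowup_param1 h" for g h
    using that by (elim G_space_cases) simp
  have src_eq: "src G_groupoid g = src H g" and tgt_eq: "tgt G_groupoid g = tgt H g"
    and ginv_eq: "ginv G_groupoid g = ginv H g" if g: "g \<in> G_space" for g
  proof -
    obtain z a b c where gc: "g = blowup_param1 (z, a, b, c)" "b \<noteq> 0" using g by (rule G_space_cases)
    have eq: "F (z, a, b, c) = F' (z, a, b, c)"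
      if "continuous_on G_coords F" "continuous_on G_coords F'" "\<And>y. y \<in> pair_coords \<Longrightarrow> F y = F' y"
      for F F' :: "G_coord \<Rightarrow> 'x::t2_space"
    proof -
      \<comment> \<open>Writing a + 0 presents the point as the value of the curve at parameter
        0.\<close>
      have "F (z, a + 0, b, c) = F' (z, a + 0, b, c)"
      proof (rule isCont_eq_at_0)
        show "isCont (\<lambda>s. F (z, a + s, b, c)) 0" "isCont (\<lambda>s. F' (z, a + s, b, c)) 0"
          by (rule isCont_on_path[OF that(1) open_G_coords path] isCont_on_path[OF that(2) open_G_coords path];
              use gc in simp)+
        show "\<forall>\<^sub>F s in at 0. F (z, a + s, b, c) = F' (z, a + s, b, c)"
          using ev[of a] by eventually_elim (use that(3) gc in simp)
      qed
      then show ?thesis by simp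
    qed
    have on_coords: "src G_groupoid (blowup_param1 y) = src H (blowup_param1 y)"
      "tgt G_groupoid (blowup_param1 y) = tgt H (blowup_param1 y)"
      "inv blowup_param1 (ginv G_groupoid (blowup_param1 y)) = inv blowup_param1 (ginv H (blowup_param1 y))"
      if "y \<in> pair_coords" for y
    proof -
      have "blowup_param1 y \<in> pair_part" unfolding pair_part_eq using that by (rule imageI)
      note H_pair[OF this]
      then show "src G_groupoid (blowup_param1 y) = src H (blowup_param1 y)"
        "tgt G_groupoid (blowup_param1 y) = tgt H (blowup_param1 y)"
        "inv blowup_param1 (ginv G_groupoid (blowup_param1 y)) = inv blowup_param1 (ginv H (blowup_param1 y))"
        by simp_all
    qed
    show "src G_groupoid g = src H g" "tgt G_groupoid g = tgt H g"
      unfolding gc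
      by (rule eq[OF cont[OF smooth_G_src] cont[OF src] on_coords(1)], assumption)
        (rule eq[OF cont[OF smooth_G_tgt] cont[OF tgt] on_coords(2)], assumption)
    have "inv blowup_param1 (ginv G_groupoid g) = inv blowup_param1 (ginv H g)"
      unfolding gc by (rule eq[OF cont'[OF smooth_G_inv] cont'[OF inv] on_coords(3)])
    then show "ginv G_groupoid g = ginv H g"
      using closed(2)[OF is_groupoid_G g] closed(2)[OF grp g] by (intro inv_eq)
  qed
  have unit_eq: "gunit G_groupoid x = gunit H x" for x
  proof -
    obtain p q where x: "x = (p, q)" by (cases x)
    have c: "continuous_on UNIV (\<lambda>x. inv blowup_param1 (f x))"
      if "smooth_map euclidean_atlas G_atlas f" for f :: "complex \<times> complex \<Rightarrow> C4 \<times> C3 set"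
      using that unfolding CG.smooth_map_iff G_chart_simps
      by (auto simp: comp_def dest: smooth_on_imp_continuous_on)
    have "inv blowup_param1 (gunit G_groupoid (p + 0, q)) = inv blowup_param1 (gunit H (p + 0, q))"
    proof (rule isCont_eq_at_0)
      have path: "isCont (\<lambda>s. (p + s, q)) 0" by (intro continuous_intros)
      show "isCont (\<lambda>s. inv blowup_param1 (gunit G_groupoid (p + s, q))) 0"
        by (rule isCont_on_path[OF c[OF smooth_G_unit] open_UNIV path]) simp
      show "isCont (\<lambda>s. inv blowup_param1 (gunit H (p + s, q))) 0"
        by (rule isCont_on_path[OF c[OF unit] open_UNIV path]) simp
      show "\<forall>\<^sub>F s in at 0. inv blowup_param1 (gunit G_groupoid (p + s, q)) = inv blowup_param1 (gunit H (p + s, q))"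
        using ev[of p] by eventually_elim (use H_unit in \<open>simp add: punctured_def\<close>)
    qed
    then show ?thesis
      unfolding x using closed(1)[OF grp] closed(1)[OF is_groupoid_G] by (intro inv_eq) (simp_all only: add_0_right)
  qed
  have mult_eq: "gmult G_groupoid g h = gmult H g h" if gh: "(g, h) \<in> composable G_space G_groupoid" for g h
  proof -
    from gh have g: "g \<in> G_space" and h: "h \<in> G_space" and st: "src G_groupoid g = tgt G_groupoid h"
      by (auto simp: composable_def)
    obtain z a b c where gc: "g = blowup_param1 (z, a, b, c)" "b \<noteq> 0" using g by (rule G_space_cases)
    obtain z' a' b' c' where hc: "h = blowup_param1 (z', a', b', c')" "b' \<noteq> 0" using h by (rule G_space_cases)
    have a': "a' = a * b" "z' = a * c + z" using st by (simp_all add: gc hc)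
    define \<gamma> where "\<gamma> = (\<lambda>s. (z, a + s, b, c) :: G_coord)"
    \<comment> \<open>The base point of the second arrow follows the source of the first, so the
      pair stays composable for every s; both arrows lie in \<open>pair_part\<close> as soon as a +
      s is nonzero.\<close>
    define \<delta> where "\<delta> = (\<lambda>s. ((a + s) * c + z, (a + s) * b, b', c') :: G_coord)"
    have \<gamma>\<delta>0: "blowup_param1 (\<gamma> 0) = g" "blowup_param1 (\<delta> 0) = h"
      by (simp_all add: \<gamma>_def \<delta>_def gc hc a')
    have in_G: "blowup_param1 (\<gamma> s) \<in> G_space" "blowup_param1 (\<delta> s) \<in> G_space" "(\<gamma> s, \<delta> s) \<in> G_coords \<times> G_coords"
      for s by (simp_all add: \<gamma>_def \<delta>_def gc hc)
    have st': "src G_groupoid (blowup_param1 (\<gamma> s)) = tgt G_groupoid (blowup_param1 (\<delta> s))" for s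
      by (simp add: \<gamma>_def \<delta>_def)
    have cH: "(blowup_param1 (\<gamma> s), blowup_param1 (\<delta> s)) \<in> composable G_space H" for s
      using in_G st' src_eq tgt_eq by (simp add: composable_def)
    have ghH: "(g, h) \<in> composable G_space H" using cH[of 0] unfolding \<gamma>\<delta>0 .
    obtain W F where W: "openin (mtopology (product_atlas G_atlas G_atlas)) W" "(g, h) \<in> W"
      and F: "smooth_map (open_submanifold (product_atlas G_atlas G_atlas) W) G_atlas F"
      and F_eq: "\<And>q. q \<in> W \<inter> composable G_space H \<Longrightarrow> F q = (\<lambda>(g, h). gmult H g h) q"
      using mult[unfolded smooth_map_on_subset_def, THEN bspec, OF ghH] by blast
    have oW: "open (snd GG_chart ` W)" and W_sub: "W \<subseteq> fst GG_chart" using W(1) by (simp_all add: P.openin_iff)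
    have contF: "continuous_on (snd GG_chart ` W) (snd G_chart \<circ> F \<circ> chart_inv GG_chart)"
      using F unfolding PG.smooth_map_open_submanifold_iff[OF W(1)]
      by (elim conjE) (rule smooth_on_imp_continuous_on)
    have path: "isCont (\<lambda>s. (\<gamma> s, \<delta> s)) 0"
      unfolding \<gamma>_def \<delta>_def by (intro continuous_intros)
    have in_W: "(\<gamma> 0, \<delta> 0) \<in> snd GG_chart ` W"
      using W(2) by (intro image_eqI[of _ _ "(g, h)"]) (simp_all flip: \<gamma>\<delta>0)
    have W_iff: "(blowup_param1 (\<gamma> s), blowup_param1 (\<delta> s)) \<in> W" if "(\<gamma> s, \<delta> s) \<in> snd GG_chart ` W" for s
    proof -
      from that obtain k l where kl: "(k, l) \<in> W" "\<gamma> s = inv blowup_param1 k" "\<delta> s = inv blowup_param1 l" by auto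
      then have "k \<in> G_space" "l \<in> G_space" using W_sub by auto
      then have "blowup_param1 (\<gamma> s) = k" "blowup_param1 (\<delta> s) = l"
        using kl(2,3) by simp_all
      then show ?thesis using kl by simp
    qed
    have F_path: "(snd G_chart \<circ> F \<circ> chart_inv GG_chart) (\<gamma> s, \<delta> s) =
        inv blowup_param1 (gmult H (blowup_param1 (\<gamma> s)) (blowup_param1 (\<delta> s)))"
      if "(\<gamma> s, \<delta> s) \<in> snd GG_chart ` W" for s
      unfolding comp_apply GG_chart_inv[OF in_G(3)]
      using F_eq[OF IntI[OF W_iff[OF that] cH]] by simp
    \<comment> \<open>\<open>F\<close> represents the product of \<open>H\<close> on composable
      pairs and is an arbitrary smooth extension off them; its continuity is therefore used along
      this curve.\<close>
    have "G_mult (\<gamma> 0) (\<delta> 0) = (snd G_chart \<circ> F \<circ> chart_inv GG_chart) (\<gamma> 0, \<delta> 0)"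
    proof (rule isCont_eq_at_0)
      show "isCont (\<lambda>s. G_mult (\<gamma> s) (\<delta> s)) 0"
        unfolding \<gamma>_def \<delta>_def G_mult.simps by (intro continuous_intros)
      show "isCont (\<lambda>s. (snd G_chart \<circ> F \<circ> chart_inv GG_chart) (\<gamma> s, \<delta> s)) 0"
        by (rule isCont_on_path[OF contF oW path in_W])
      have "\<forall>\<^sub>F s in at 0. (\<gamma> s, \<delta> s) \<in> snd GG_chart ` W"
        using path oW in_W unfolding isCont_def by (rule topological_tendstoD)
      then show "\<forall>\<^sub>F s in at 0. G_mult (\<gamma> s) (\<delta> s) = (snd G_chart \<circ> F \<circ> chart_inv GG_chart) (\<gamma> s, \<delta> s)"
        using ev[of a]
      proof eventually_elim
        case (elim s)
        have "blowup_param1 (\<gamma> s) \<in> pair_part" "blowup_param1 (\<delta> s) \<in> pair_part"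
          using elim(2) gc hc by (simp_all add: \<gamma>_def \<delta>_def)
        then have "gmult H (blowup_param1 (\<gamma> s)) (blowup_param1 (\<delta> s)) = blowup_param1 (G_mult (\<gamma> s) (\<delta> s))"
          using H_mult st' by simp
        then show ?case unfolding F_path[OF elim(1)] by simp
      qed
    qed
    then have "inv blowup_param1 (gmult G_groupoid g h) = inv blowup_param1 (gmult H g h)"
      unfolding F_path[OF in_W] \<gamma>\<delta>0 by (simp flip: \<gamma>\<delta>0)
    moreover have "gmult G_groupoid g h \<in> G_space" "gmult H g h \<in> G_space"
      using closed(3)[OF is_groupoid_G gh] closed(3)[OF grp ghH] by blast+
    ultimately show ?thesis by (intro inv_eq)
  qed
  show ?thesis
    unfolding same_groupoid_def using src_eq tgt_eq ginv_eq unit_eq mult_eq by blast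
qed

interpretation R4: global_chart "euclidean_atlas :: (real^4, real^4) chart set" "(UNIV, id)"
  by (rule global_chart_euclidean)

interpretation RC: global_charts "euclidean_atlas :: (real^4, real^4) chart set" "(UNIV, id)"
  "euclidean_atlas :: (complex \<times> complex, complex \<times> complex) chart set" "(UNIV, id)" ..

interpretation CR: global_charts "euclidean_atlas :: (complex \<times> complex, complex \<times> complex) chart set"
  "(UNIV, id)" "euclidean_atlas :: (real^4, real^4) chart set" "(UNIV, id)" ..

section \<open>The Koszul bracket\<close>

text \<open>Linearity in the base point holds because the coefficients of r d/dr and d/dtheta are
  linear in x1 and x2.\<close>

lemma bounded_bilinear_poisson_sharp: "bounded_bilinear poisson_sharp"
  unfolding bilinear_conv_bounded_bilinear[symmetric] bilinear_def
  by (auto intro!: linearI simp: poisson_sharp_eq vec_eq_iff forall_4 algebra_simps)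

lemma poisson_sharp_skew: "\<alpha> \<bullet> poisson_sharp x \<beta> = - (\<beta> \<bullet> poisson_sharp x \<alpha>)"
  by (simp add: poisson_sharp_eq inner_vec_def sum_4 algebra_simps)

text \<open>Pairings of b with the derivative of the sharp of a occur in the first Lie derivative
  and in the exterior derivative, and cancel. The leftover terms with b' along a basis vector cancel
  by skew symmetry, so besides the two directional derivatives only the dependence of pi on the base
  point survives.\<close>

lemma koszul_bracket_eq:
  assumes a: "(a has_derivative a') (at x)" and b: "(b has_derivative b') (at x)"
  shows "koszul_bracket a b x = b' (poisson_sharp x (a x)) - a' (poisson_sharp x (b x)) -
    (\<chi> j. a x \<bullet> poisson_sharp (axis j 1) (b x))"
proof -
  have sharp: "((\<lambda>y. poisson_sharp y (f y)) has_derivative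
      (\<lambda>h. poisson_sharp x (f' h) + poisson_sharp h (f x))) (at x)"
    if "(f has_derivative f') (at x)" for f f'
    using bounded_bilinear.FDERIV[OF bounded_bilinear_poisson_sharp has_derivative_ident that] by simp
  have pairing: "((\<lambda>y. b y \<bullet> poisson_sharp y (a y)) has_derivative
      (\<lambda>h. b x \<bullet> (poisson_sharp x (a' h) + poisson_sharp h (a x)) + b' h \<bullet> poisson_sharp x (a x))) (at x)"
    by (rule has_derivative_inner[OF b sharp[OF a]])
  note D = frechet_derivative_at[OF a, symmetric] frechet_derivative_at[OF b, symmetric]
    frechet_derivative_at[OF sharp[OF a], symmetric] frechet_derivative_at[OF sharp[OF b], symmetric]
    frechet_derivative_at[OF pairing, symmetric]
  have skew: "a x \<bullet> poisson_sharp x (b' h) = - (b' h \<bullet> poisson_sharp x (a x))" for h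
    by (rule poisson_sharp_skew)
  show ?thesis
    by (simp add: vec_eq_iff koszul_bracket_def lie_derivative_def ext_d_def D inner_add_right skew)
qed

section \<open>The Lie algebroid of the groupoid\<close>

definition base_map :: "real^4 \<Rightarrow> complex \<times> complex" where
  "base_map = complex_coordinates \<circ> reflection"

definition base_map_inv :: "complex \<times> complex \<Rightarrow> real^4" where
  "base_map_inv y = vector [Re (fst y), Im (fst y), Re (snd y), - Im (snd y)]"

lemma base_map_eq: "base_map x = (Complex (x$1) (x$2), Complex (x$3) (- (x$4)))"
  by (simp add: base_map_def complex_coordinates_def reflection_def)

lemma base_map_inverse [simp]: "base_map_inv (base_map x) = x" "base_map (base_map_inv y) = y"
  by (simp_all add: base_map_eq base_map_inv_def vec_eq_iff forall_4)

lemma bounded_linear_base_map: "bounded_linear base_map"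
  unfolding linear_conv_bounded_linear[symmetric]
  by (rule linearI) (simp_all add: base_map_eq complex_eq_iff)

lemma bounded_linear_base_map_inv: "bounded_linear base_map_inv"
  unfolding linear_conv_bounded_linear[symmetric] base_map_inv_def
  by (rule linearI) (simp_all add: vec_eq_iff forall_4)

lemma bij_base_map: "bij base_map"
  by (rule bij_betw_byWitness[where f' = base_map_inv]) auto

lemma inv_into_base_map: "inv_into UNIV base_map = base_map_inv"
  by (rule inv_equality) simp_all

text \<open>A covector \<open>\<alpha>\<close> corresponds to the vector in \<open>ker(ds)\<close> at a unit \<open>(q, p, 1, 0)\<close> whose \<open>(b, c)\<close>-part
  is \<open>(b_part \<alpha>, c_part \<alpha>)\<close>; its \<open>(z, a)\<close>-part is then determined by \<open>ds = 0\<close>.\<close>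

definition b_part :: "real^4 \<Rightarrow> complex" where
  "b_part \<alpha> = - Complex (\<alpha>$3) (\<alpha>$4)"

definition c_part :: "real^4 \<Rightarrow> complex" where
  "c_part \<alpha> = Complex (\<alpha>$1) (- (\<alpha>$2))"

definition ker_coords :: "complex \<Rightarrow> real^4 \<Rightarrow> G_coord" where
  "ker_coords p \<alpha> = (- (p * c_part \<alpha>), - (p * b_part \<alpha>), b_part \<alpha>, c_part \<alpha>)"

definition covector_of :: "complex \<Rightarrow> complex \<Rightarrow> real^4" where
  "covector_of \<beta> \<gamma> = vector [Re \<gamma>, - Im \<gamma>, - Re \<beta>, - Im \<beta>]"

lemma bounded_linear_b_part: "bounded_linear b_part"
  unfolding linear_conv_bounded_linear[symmetric] b_part_def
  by (rule linearI) (simp_all add: complex_eq_iff)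

lemma bounded_linear_c_part: "bounded_linear c_part"
  unfolding linear_conv_bounded_linear[symmetric] c_part_def
  by (rule linearI) (simp_all add: complex_eq_iff)

lemma bounded_linear_covector_of: "bounded_linear (\<lambda>y. covector_of (fst y) (snd y))"
  unfolding linear_conv_bounded_linear[symmetric] covector_of_def
  by (rule linearI) (simp_all add: vec_eq_iff forall_4)

lemma covector_parts [simp]:
  "b_part (covector_of \<beta> \<gamma>) = \<beta>" "c_part (covector_of \<beta> \<gamma>) = \<gamma>"
  "covector_of (b_part \<alpha>) (c_part \<alpha>) = \<alpha>"
  by (simp_all add: b_part_def c_part_def covector_of_def complex_eq_iff vec_eq_iff forall_4)

lemma linear_ker_coords: "linear (ker_coords p)"
  using bounded_linear.linear[OF bounded_linear_b_part] bounded_linear.linear[OF bounded_linear_c_part]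
  by (intro linearI) (simp_all add: ker_coords_def linear_add linear_cmul algebra_simps)

lemma ker_coords_inj: "ker_coords p \<alpha> = ker_coords p \<beta> \<longleftrightarrow> \<alpha> = \<beta>"
  by (metis covector_parts(3) ker_coords_def prod.inject)

lemma smooth_on_ker_coords:
  assumes "open S" "smooth_on S f" "smooth_on S g"
  shows "smooth_on S (\<lambda>x. ker_coords (f x) (g x))"
  unfolding ker_coords_def
  by (intro smooth_on_Pair smooth_on_minus smooth_on_mult assms
      smooth_on_bounded_linear_compose[OF bounded_linear_b_part]
      smooth_on_bounded_linear_compose[OF bounded_linear_c_part])

abbreviation G_unit :: "complex \<times> complex \<Rightarrow> C4 \<times> C3 set" where
  "G_unit y \<equiv> blowup_param1 (snd y, fst y, 1, 0)"

abbreviation "G_tangent \<equiv> tangent_in_chart G_atlas G_chart"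

text \<open>At the unit (q, p, 1, 0) the differential of the source sends (dz, da, db, dc) to (da +
  p db, p dc + dz), so db and dc are free; with two real parts each they match the four components
  of a covector.\<close>

lemma ker_ds_iff:
  "v \<in> ker_ds G_atlas euclidean_atlas G_groupoid y \<longleftrightarrow> (\<exists>\<alpha>. G_tangent (G_unit y) v = ker_coords (fst y) \<alpha>)"
proof -
  obtain p q where y: "y = (p, q)" by (cases y)
  have D: "((\<lambda>u. src G_groupoid (chart_inv G_chart u)) has_derivative
      (\<lambda>v. (fst (snd v) + p * fst (snd (snd v)), p * snd (snd (snd v)) + fst v)))
      (at (snd G_chart (G_unit y)))"
    using src_has_derivative[of 1 p 0 q] by (simp add: y)
  have "differential G_atlas euclidean_atlas (src G_groupoid) (G_unit y) v =
      (let t = G_tangent (G_unit y) v in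
        (fst (snd t) + p * fst (snd (snd t)), p * snd (snd (snd t)) + fst t))"
    by (subst G.differential_to_euclidean[OF _ D]) (simp_all add: Let_def)
  moreover obtain t1 t2 t3 t4 where t: "G_tangent (G_unit y) v = (t1, t2, t3, t4)"
    by (metis prod.exhaust)
  ultimately have "v \<in> ker_ds G_atlas euclidean_atlas G_groupoid y \<longleftrightarrow> t2 = - (p * t3) \<and> t1 = - (p * t4)"
    by (auto simp: ker_ds_def Let_def zero_prod_def eq_neg_iff_add_eq_0 add.commute)
  also have "\<dots> \<longleftrightarrow> (\<exists>\<alpha>. G_tangent (G_unit y) v = ker_coords (fst y) \<alpha>)"
    unfolding t
  proof
    assume "t2 = - (p * t3) \<and> t1 = - (p * t4)"
    then show "\<exists>\<alpha>. (t1, t2, t3, t4) = ker_coords (fst y) \<alpha>"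
      by (intro exI[of _ "covector_of t3 t4"]) (simp add: ker_coords_def y)
  qed (auto simp: ker_coords_def y)
  finally show ?thesis .
qed

text \<open>The fibrewise isomorphism. Kernel vectors are stored in the chart that
  \<open>chart_at\<close> selects at the unit, so the coordinate formula is carried there from
  \<open>G_chart\<close>.\<close>

definition ker_vector :: "complex \<times> complex \<Rightarrow> real^4 \<Rightarrow> G_coord" where
  "ker_vector y \<alpha> = G.tangent_from_chart (G_unit y) (ker_coords (fst y) \<alpha>)"

lemma G_tangent_ker_vector [simp]: "G_tangent (G_unit y) (ker_vector y \<alpha>) = ker_coords (fst y) \<alpha>"
  unfolding ker_vector_def by (rule G.tangent_in_from) simp

lemma ker_vector_in_ker [simp]: "ker_vector y \<alpha> \<in> ker_ds G_atlas euclidean_atlas G_groupoid y"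
  unfolding ker_ds_iff by (auto intro: exI[of _ \<alpha>])

lemma bij_ker_vector: "bij_betw (ker_vector y) UNIV (ker_ds G_atlas euclidean_atlas G_groupoid y)"
proof (rule bij_betwI')
  show "ker_vector y \<alpha> = ker_vector y \<beta> \<longleftrightarrow> \<alpha> = \<beta>" for \<alpha> \<beta>
    using G_tangent_ker_vector ker_coords_inj by metis
  show "\<exists>\<alpha>\<in>UNIV. v = ker_vector y \<alpha>" if v: "v \<in> ker_ds G_atlas euclidean_atlas G_groupoid y" for v
  proof -
    obtain \<alpha> where \<alpha>: "G_tangent (G_unit y) v = ker_coords (fst y) \<alpha>" using v ker_ds_iff by blast
    have "v = G.tangent_from_chart (G_unit y) (G_tangent (G_unit y) v)"
      by (rule G.tangent_from_in[symmetric]) simp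
    then show ?thesis unfolding \<alpha> ker_vector_def by blast
  qed
qed simp

lemma linear_ker_vector: "linear (ker_vector y)"
proof -
  have "linear (G.tangent_from_chart (G_unit y))" by (rule G.linear_tangent_from_chart) simp
  from linear_compose[OF linear_ker_coords this, of "fst y"] show ?thesis
    by (simp add: comp_def ker_vector_def[abs_def])
qed

lemma anchor_ker_vector:
  "differential G_atlas euclidean_atlas (tgt G_groupoid) (G_unit y) (ker_vector y \<alpha>)
    = (- (fst y * b_part \<alpha>), - (fst y * c_part \<alpha>))"
proof -
  have D: "((\<lambda>u. tgt G_groupoid (chart_inv G_chart u)) has_derivative (\<lambda>v. (fst (snd v), fst v)))
      (at (snd G_chart (G_unit y)))"
    using tgt_has_derivative[of 1 "snd y" "fst y" 0] by simp
  show ?thesis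
    by (subst G.differential_to_euclidean[OF _ D]) (simp_all add: ker_coords_def)
qed

text \<open>Here the reflection enters: both complex components of the anchor become the base
  coordinate p times a function of the covector, whereas without it the second would involve the
  conjugate of p. The value is the one in \<open>anchor_ker_vector\<close>.\<close>

lemma base_map_poisson_sharp:
  "base_map (poisson_sharp x \<alpha>) = (- (fst (base_map x) * b_part \<alpha>), - (fst (base_map x) * c_part \<alpha>))"
  by (simp add: base_map_eq poisson_sharp_eq b_part_def c_part_def complex_eq_iff)

lemma differential_base_map:
  "differential euclidean_atlas euclidean_atlas base_map x v = base_map v"
proof -
  have "((\<lambda>y. base_map (chart_inv (UNIV, id) y)) has_derivative base_map) (at (snd (UNIV, id) x))"
    using bounded_linear_imp_has_derivative[OF bounded_linear_base_map] by simp
  from R4.differential_to_euclidean[OF _ this, of v] show ?thesis by simp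
qed

lemma diffeomorphism_base_map: "diffeomorphism euclidean_atlas euclidean_atlas base_map"
proof -
  have "smooth_map euclidean_atlas euclidean_atlas base_map"
    unfolding RC.smooth_map_iff
    using smooth_on_bounded_linear[OF bounded_linear_base_map open_UNIV] by simp
  moreover have "smooth_map euclidean_atlas euclidean_atlas base_map_inv"
    unfolding CR.smooth_map_iff
    using smooth_on_bounded_linear[OF bounded_linear_base_map_inv open_UNIV] by simp
  ultimately show ?thesis
    unfolding diffeomorphism_def mcarrier_euclidean inv_into_base_map using bij_base_map by blast
qed

lemma push_section_base_map:
  "push_section UNIV base_map (\<lambda>x. ker_vector (base_map x)) a y = ker_vector y (a (base_map_inv y))"
  unfolding push_section_def inv_into_base_map by simp

subsection \<open>Sections\<close>

lemma smooth_map_open_euclidean: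
  fixes f :: "complex \<times> complex \<Rightarrow> 'f::euclidean_space"
  assumes "open W"
  shows "smooth_map (open_submanifold euclidean_atlas W) euclidean_atlas f \<longleftrightarrow> smooth_on W f"
proof -
  interpret E: global_charts "euclidean_atlas :: (complex \<times> complex, complex \<times> complex) chart set"
    "(UNIV, id)" "euclidean_atlas :: ('f, 'f) chart set" "(UNIV, id)"
    by (intro global_charts.intro global_chart_euclidean)
  have "openin (mtopology euclidean_atlas) W" using assms by (simp add: C2.openin_iff)
  from E.smooth_map_open_submanifold_iff[OF this] show ?thesis by simp
qed

text \<open>In the global chart the section is \<open>ker_coords\<close>, whose last two entries
  determine the covector, so this one chart gives back smoothness of \<open>a\<close>. Conversely,
  any other chart contributes a transition derivative evaluated along the units.\<close>

lemma sections_iff: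
  "push_section UNIV base_map (\<lambda>x. ker_vector (base_map x)) a
      \<in> sections (algebroid_of_groupoid G_atlas euclidean_atlas G_groupoid) \<longleftrightarrow> smooth_on UNIV a"
proof -
  define s where "s = push_section UNIV base_map (\<lambda>x. ker_vector (base_map x)) a"
  have s: "s y = ker_vector y (a (base_map_inv y))" for y
    by (simp only: s_def push_section_base_map)
  define U where "U = (\<lambda>y :: complex \<times> complex. (snd y, fst y, 1, 0) :: G_coord)"
  have U: "smooth_on UNIV U" unfolding U_def by (intro smooth_intros open_UNIV)
  have snd_unit: "snd G_chart (G_unit y) = U y" for y by (simp add: U_def)
  have sections: "s \<in> sections (algebroid_of_groupoid G_atlas euclidean_atlas G_groupoid) \<longleftrightarrow>
      (\<forall>c\<in>G_atlas. smooth_map (open_submanifold euclidean_atlas {y. G_unit y \<in> fst c}) euclidean_atlas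
        (\<lambda>y. tangent_in_chart G_atlas c (G_unit y) (s y)))"
    by (simp add: algebroid_of_groupoid_def s)
  have tangent: "tangent_in_chart G_atlas c (G_unit y) (s y) =
      frechet_derivative (snd c \<circ> chart_inv G_chart) (at (U y)) (ker_coords (fst y) (a (base_map_inv y)))"
    if "c \<in> G_atlas" "G_unit y \<in> fst c" for c y
    using G.tangent_in_chart_trans[OF G.chart that(1) _ that(2), of "s y"] snd_unit[of y] by (simp add: s)
  have openW: "open {y. G_unit y \<in> fst c}" "U ` {y. G_unit y \<in> fst c} \<subseteq> snd G_chart ` fst c"
    if c: "c \<in> G_atlas" for c
  proof -
    have "{y. G_unit y \<in> fst c} = U -` (snd G_chart ` fst c)"
    proof (rule set_eqI)
      fix y
      have "G_unit y \<in> fst c" if "U y \<in> inv blowup_param1 ` fst c"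
      proof -
        from that obtain g where g: "g \<in> fst c" "U y = inv blowup_param1 g" by blast
        then have "blowup_param1 (U y) = g" using G.domain_subset[OF c] by auto
        with g show ?thesis by (simp add: U_def)
      qed
      moreover have "U y \<in> inv blowup_param1 ` fst c" if "G_unit y \<in> fst c"
        using that by (intro image_eqI[of _ _ "G_unit y"]) (simp_all add: U_def)
      ultimately show "y \<in> {y. G_unit y \<in> fst c} \<longleftrightarrow> y \<in> U -` (snd G_chart ` fst c)"
        by auto
    qed
    then show "open {y. G_unit y \<in> fst c}" "U ` {y. G_unit y \<in> fst c} \<subseteq> snd G_chart ` fst c"
      using G.to_chart(1)[OF c] smooth_on_imp_continuous_on[OF U] continuous_on_open_vimage[of UNIV U]
      by auto
  qed
  show ?thesis
    unfolding s_def[symmetric] sections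
  proof
    assume "\<forall>c\<in>G_atlas. smooth_map (open_submanifold euclidean_atlas {y. G_unit y \<in> fst c}) euclidean_atlas
        (\<lambda>y. tangent_in_chart G_atlas c (G_unit y) (s y))"
    from this[THEN bspec, OF G.chart]
    have "smooth_on UNIV (\<lambda>y. ker_coords (fst y) (a (base_map_inv y)))"
      by (simp add: s smooth_map_open_euclidean)
    from smooth_on_snd[OF open_UNIV smooth_on_snd[OF open_UNIV this]]
    have "smooth_on UNIV (\<lambda>y. (b_part (a (base_map_inv y)), c_part (a (base_map_inv y))))"
      by (simp add: ker_coords_def)
    from smooth_on_bounded_linear_compose[OF bounded_linear_covector_of open_UNIV this]
    have "smooth_on UNIV (\<lambda>y. a (base_map_inv y))" by simp
    from smooth_on_compose[OF open_UNIV open_UNIV _ smooth_on_bounded_linear[OF bounded_linear_base_map open_UNIV] this]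
    show "smooth_on UNIV a" by simp
  next
    assume a: "smooth_on UNIV a"
    have a': "smooth_on UNIV (\<lambda>y. a (base_map_inv y))"
      by (rule smooth_on_compose[OF open_UNIV open_UNIV _
            smooth_on_bounded_linear[OF bounded_linear_base_map_inv open_UNIV] a]) simp
    show "\<forall>c\<in>G_atlas. smooth_map (open_submanifold euclidean_atlas {y. G_unit y \<in> fst c}) euclidean_atlas
        (\<lambda>y. tangent_in_chart G_atlas c (G_unit y) (s y))"
    proof
      fix c assume c: "c \<in> G_atlas"
      let ?W = "{y. G_unit y \<in> fst c}"
      note W = openW[OF c]
      have "smooth_on ?W (\<lambda>y. frechet_derivative (snd c \<circ> chart_inv G_chart) (at (U y))
          (ker_coords (fst y) (a (base_map_inv y))))"
        by (rule smooth_on_derivative_apply[OF W(1) G.to_chart(1)[OF c] G.to_chart(2)[OF c]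
              smooth_on_subset[OF U subset_UNIV] W(2)],
            rule smooth_on_ker_coords[OF W(1)], rule smooth_on_fst[OF W(1) smooth_on_id[OF W(1)]],
            rule smooth_on_subset[OF a' subset_UNIV])
      then have "smooth_on ?W (\<lambda>y. tangent_in_chart G_atlas c (G_unit y) (s y))"
        by (rule smooth_on_cong[OF W(1)]) (simp add: tangent[OF c])
      then show "smooth_map (open_submanifold euclidean_atlas ?W) euclidean_atlas
          (\<lambda>y. tangent_in_chart G_atlas c (G_unit y) (s y))"
        by (simp only: smooth_map_open_euclidean[OF W(1)])
    qed
  qed
qed

subsection \<open>Right-invariant vector fields\<close>

definition G_right :: "G_coord \<Rightarrow> G_coord \<Rightarrow> G_coord" where
  "G_right g v = (fst v, fst (snd v), fst (snd (snd v)) * fst (snd (snd g)),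
    snd (snd (snd v)) + fst (snd (snd v)) * snd (snd (snd g)))"

text \<open>In coordinates the map h -> h g is linear in h, so it is its own derivative at every
  point.\<close>

lemma G_mult_has_derivative: "((\<lambda>h. G_mult h g) has_derivative G_right g) (at x)"
proof -
  have "(\<lambda>h. G_mult h g) = G_right g"
    by (cases g) (auto simp: G_right_def fun_eq_iff)
  moreover have "bounded_linear (G_right g)"
    unfolding linear_conv_bounded_linear[symmetric] G_right_def
    by (rule linearI) (simp_all add: algebra_simps)
  ultimately show ?thesis by (simp add: bounded_linear_imp_has_derivative)
qed

text \<open>The source fibre over \<open>y\<close> is the image of a retraction \<open>R\<close>, which determines the derivative of right
  translation on \<open>ker(ds)\<close>.\<close>

lemma right_translate_G:
  assumes g: "g \<in> G_space" and y: "tgt G_groupoid g = y"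
  shows "G_tangent g (right_translate G_atlas G_groupoid g (ker_vector y \<alpha>)) =
    G_right (inv blowup_param1 g) (ker_coords (fst y) \<alpha>)"
proof -
  obtain p q where pq: "y = (p, q)" by (cases y)
  define gc where "gc = inv blowup_param1 g"
  have g_eq: "g = blowup_param1 gc" using g by (simp add: gc_def)
  define u where "u = ((q, p, 1, 0) :: G_coord)"
  have unit: "gunit G_groupoid (tgt G_groupoid g) = blowup_param1 u" by (simp add: y pq u_def)
  have u: "G_unit y = blowup_param1 u" "blowup_param1 u \<in> G_space" "inv blowup_param1 (blowup_param1 u) = u"
    "u \<in> G_coords" by (simp_all add: pq u_def)
  have unit_mult: "gmult G_groupoid (blowup_param1 u) g = g"
    using is_groupoid_G g unit unfolding is_groupoid_def by metis
  have G_open: "openin (mtopology G_atlas) G_space"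
    using openin_topspace[of "mtopology G_atlas"] by (simp add: G.topspace_eq)
  define V where "V = G.tangent_from_chart g (G_right gc (ker_coords p \<alpha>))"
  have diff: "differential G_atlas G_atlas F (blowup_param1 u) (ker_vector y \<alpha>)
      = G.tangent_from_chart (F (blowup_param1 u)) (D (ker_coords p \<alpha>))"
    if "openin (mtopology G_atlas) W" "blowup_param1 u \<in> W" "F ` W \<subseteq> G_space"
      "((\<lambda>h. inv blowup_param1 (F (chart_inv G_chart h))) has_derivative D) (at u)" for F W D
    using GG.differential_local[of W F "blowup_param1 u" D "ker_vector y \<alpha>"] that u
      G_tangent_ker_vector[of y \<alpha>] by (simp add: pq)
  have "right_translate G_atlas G_groupoid g (ker_vector y \<alpha>) = V"
    unfolding right_translate_def unit
  proof (rule the_equality)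
    \<comment> \<open>Existence: the coordinate formula for right multiplication by g makes sense
      for every arrow, so this global map is an admissible extension.\<close>
    let ?F = "\<lambda>h. gmult G_groupoid h g"
    have F: "smooth_map (open_submanifold G_atlas G_space) G_atlas ?F"
      unfolding GG.smooth_map_open_submanifold_iff[OF G_open]
    proof
      show "?F ` G_space \<subseteq> fst G_chart"
        using g by (auto elim!: G_space_cases)
      obtain z a b c where gc: "gc = (z, a, b, c)" by (metis prod.exhaust)
      have "smooth_on G_coords (\<lambda>h. (fst h, fst (snd h), fst (snd (snd h)) * b,
          snd (snd (snd h)) + fst (snd (snd h)) * c))"
        by (intro smooth_intros open_G_coords)
      then show "smooth_on (snd G_chart ` G_space) (snd G_chart \<circ> ?F \<circ> chart_inv G_chart)"
        unfolding G_chart_simps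
        by (rule smooth_on_cong[OF open_G_coords]) (auto simp: g_eq gc)
    qed
    have "((\<lambda>h. inv blowup_param1 (?F (chart_inv G_chart h))) has_derivative G_right gc) (at u)"
      by (rule has_derivative_transform_within_open[OF G_mult_has_derivative[of gc u] open_G_coords u(4)])
        (simp add: g_eq del: split_paired_All mem_Collect_eq case_prod_conv)
    from diff[OF G_open u(2) _ this] F
    have "V = differential G_atlas G_atlas ?F (blowup_param1 u) (ker_vector y \<alpha>)"
      unfolding GG.smooth_map_open_submanifold_iff[OF G_open] by (simp add: V_def unit_mult)
    then show "\<exists>W F. openin (mtopology G_atlas) W \<and> blowup_param1 u \<in> W \<and>
        smooth_map (open_submanifold G_atlas W) G_atlas F \<and>
        (\<forall>h\<in>W. src G_groupoid h = tgt G_groupoid g \<longrightarrow> F h = gmult G_groupoid h g) \<and>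
        V = differential G_atlas G_atlas F (blowup_param1 u) (ker_vector y \<alpha>)"
      using G_open F u(2) by blast
  next
    fix w
    assume "\<exists>W F. openin (mtopology G_atlas) W \<and> blowup_param1 u \<in> W \<and>
        smooth_map (open_submanifold G_atlas W) G_atlas F \<and>
        (\<forall>h\<in>W. src G_groupoid h = tgt G_groupoid g \<longrightarrow> F h = gmult G_groupoid h g) \<and>
        w = differential G_atlas G_atlas F (blowup_param1 u) (ker_vector y \<alpha>)"
    then obtain W F where W: "openin (mtopology G_atlas) W" "blowup_param1 u \<in> W"
      and F: "smooth_map (open_submanifold G_atlas W) G_atlas F"
      and F_eq: "\<And>h. h \<in> W \<Longrightarrow> src G_groupoid h = y \<Longrightarrow> F h = gmult G_groupoid h g"
      and w: "w = differential G_atlas G_atlas F (blowup_param1 u) (ker_vector y \<alpha>)"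
      unfolding y by blast
    define Fc where "Fc = (\<lambda>h. inv blowup_param1 (F (chart_inv G_chart h)))"
    have W': "open (inv blowup_param1 ` W)" "W \<subseteq> G_space" "u \<in> inv blowup_param1 ` W"
      using W u(3) unfolding G.openin_iff by (auto intro: image_eqI[of _ _ "blowup_param1 u"])
    have F': "F ` W \<subseteq> G_space" "smooth_on (inv blowup_param1 ` W) Fc"
      using F unfolding GG.smooth_map_open_submanifold_iff[OF W(1)] by (simp_all add: Fc_def comp_def)
    have D: "(Fc has_derivative frechet_derivative Fc (at u)) (at u)"
      by (rule smooth_on_has_derivative[OF F'(2) W'(3)])
    \<comment> \<open>\<open>R\<close> keeps b and c and solves ab = p, ac + z = q for the base
      point, so it retracts the coordinates onto the source fibre over y and fixes u. On that fibre
      any extension \<open>F\<close> is multiplication by g.\<close>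
    define R where "R = (\<lambda>h :: G_coord. (q - p * snd (snd (snd h)) / fst (snd (snd h)),
      p / fst (snd (snd h)), fst (snd (snd h)), snd (snd (snd h))))"
    define R' where "R' = (\<lambda>v :: G_coord. (- (p * snd (snd (snd v))), - (p * fst (snd (snd v))),
      fst (snd (snd v)), snd (snd (snd v))))"
    have R: "(R has_derivative R') (at u)"
      unfolding R_def R'_def u_def by (auto intro!: derivative_eq_intros simp: fun_eq_iff)
    have Ru: "R u = u" by (simp add: R_def u_def)
    have cont: "continuous_on G_coords R"
      unfolding R_def by (intro continuous_intros) auto
    \<comment> \<open>On this neighbourhood of u the retraction lands in W, where \<open>F\<close>
      is prescribed on the source fibre.\<close>
    define N where "N = G_coords \<inter> R -` (inv blowup_param1 ` W)"
    have N: "open N" "u \<in> N"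
      using continuous_open_preimage[OF cont open_G_coords W'(1)] u(4) Ru W'(3) by (simp_all add: N_def)
    have eq: "Fc (R h) = G_mult (R h) gc" if h: "h \<in> N" for h
    proof -
      obtain h1 h2 h3 h4 where hh: "h = (h1, h2, h3, h4)" "h3 \<noteq> 0" using h by (auto simp: N_def)
      from h obtain k where k: "k \<in> W" "R h = inv blowup_param1 k" by (auto simp: N_def)
      then have "blowup_param1 (R h) = k" using W'(2) by auto
      then have "blowup_param1 (R h) \<in> W" using k by simp
      moreover have "src G_groupoid (blowup_param1 (R h)) = y"
        using hh by (simp add: R_def pq)
      ultimately have "F (blowup_param1 (R h)) = blowup_param1 (G_mult (R h) gc)"
        using F_eq by (simp add: g_eq)
      moreover have "R h \<in> G_coords" using hh by (simp add: R_def)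
      ultimately show ?thesis
        by (simp add: Fc_def del: split_paired_All mem_Collect_eq case_prod_conv)
    qed
    have D1: "((\<lambda>h. Fc (R h)) has_derivative (\<lambda>v. frechet_derivative Fc (at u) (R' v))) (at u)"
      by (rule has_derivative_compose[OF R]) (unfold Ru, rule D)
    have D2: "((\<lambda>h. G_mult (R h) gc) has_derivative (\<lambda>v. G_right gc (R' v))) (at u)"
      by (rule has_derivative_compose[OF R G_mult_has_derivative])
    have "((\<lambda>h. G_mult (R h) gc) has_derivative (\<lambda>v. frechet_derivative Fc (at u) (R' v))) (at u)"
      by (rule has_derivative_transform_within_open[OF D1 N eq])
    \<comment> \<open>\<open>R'\<close> fixes \<open>ker_coords p \<alpha>\<close>, so the
      derivative of the extension on this vector is forced, whichever extension was taken.\<close>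
    from fun_cong[OF has_derivative_unique[OF this D2], of "ker_coords p \<alpha>"]
    have "frechet_derivative Fc (at u) (ker_coords p \<alpha>) = G_right gc (ker_coords p \<alpha>)"
      by (simp add: R'_def ker_coords_def)
    moreover have "F (blowup_param1 u) = g"
      using F_eq[OF W(2)] unit_mult by (simp add: u_def pq)
    ultimately show "w = V"
      using diff[OF W F'(1) D[unfolded Fc_def]] unfolding w V_def Fc_def by simp
  qed
  then show ?thesis
    using G.tangent_in_from[of g] g by (simp add: V_def gc_def pq)
qed

text \<open>\<open>G_right\<close> at the arrow is applied to the kernel vector over the target (a,
  z), so the covector enters through the target.\<close>

lemma right_invariant_vf_coords:
  assumes "b \<noteq> 0" and s: "\<And>y. s y = ker_vector y (f y)"
  shows "vf_in_chart G_atlas G_chart (right_invariant_vf G_atlas G_groupoid s) (z, a, b, c) =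
    (- (a * c_part (f (a, z))), - (a * b_part (f (a, z))), b * b_part (f (a, z)),
      c_part (f (a, z)) + c * b_part (f (a, z)))"
proof -
  have "vf_in_chart G_atlas G_chart (right_invariant_vf G_atlas G_groupoid s) (z, a, b, c) =
      G_right (z, a, b, c) (ker_coords a (f (a, z)))"
    using right_translate_G[of "blowup_param1 (z, a, b, c)" "(a, z)" "f (a, z)"] assms(1)
    by (simp add: vf_in_chart_def right_invariant_vf_def s)
  then show ?thesis by (simp add: G_right_def ker_coords_def mult.commute)
qed

text \<open>Product rule at a unit, where b = 1 and c = 0. The covector is composed with the target,
  so only the first two entries of the direction h reach the derivative of \<open>f\<close>.\<close>

lemma right_invariant_vf_has_derivative:
  assumes s: "\<And>y. s y = ker_vector y (f (base_map_inv y))"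
    and f: "(f has_derivative f') (at (base_map_inv (p, q)))"
  defines "\<alpha> \<equiv> f (base_map_inv (p, q))" and "\<delta> \<equiv> \<lambda>h. f' (base_map_inv (fst (snd h), fst h))"
  shows "(vf_in_chart G_atlas G_chart (right_invariant_vf G_atlas G_groupoid s) has_derivative
    (\<lambda>h. (- (fst (snd h) * c_part \<alpha> + p * c_part (\<delta> h)), - (fst (snd h) * b_part \<alpha> + p * b_part (\<delta> h)),
      fst (snd (snd h)) * b_part \<alpha> + b_part (\<delta> h),
      c_part (\<delta> h) + snd (snd (snd h)) * b_part \<alpha>))) (at (q, p, 1, 0))"
proof (rule has_derivative_transform_within_open[OF _ open_G_coords])
  let ?f = "\<lambda>h :: G_coord. f (base_map_inv (fst (snd h), fst h))"
  have base: "((\<lambda>h :: G_coord. base_map_inv (fst (snd h), fst h)) has_derivative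
      (\<lambda>h. base_map_inv (fst (snd h), fst h))) (at (q, p, 1, 0))"
    by (rule bounded_linear.has_derivative[OF bounded_linear_base_map_inv]) (auto intro!: derivative_eq_intros)
  have F: "(?f has_derivative \<delta>) (at (q, p, 1, 0))"
    unfolding \<delta>_def by (rule has_derivative_compose[OF base]) (simp add: f)
  note B = bounded_linear.has_derivative[OF bounded_linear_b_part F]
  note C = bounded_linear.has_derivative[OF bounded_linear_c_part F]
  show "((\<lambda>h. (- (fst (snd h) * c_part (?f h)), - (fst (snd h) * b_part (?f h)),
      fst (snd (snd h)) * b_part (?f h), c_part (?f h) + snd (snd (snd h)) * b_part (?f h))) has_derivative
    (\<lambda>h. (- (fst (snd h) * c_part \<alpha> + p * c_part (\<delta> h)), - (fst (snd h) * b_part \<alpha> + p * b_part (\<delta> h)),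
      fst (snd (snd h)) * b_part \<alpha> + b_part (\<delta> h),
      c_part (\<delta> h) + snd (snd (snd h)) * b_part \<alpha>))) (at (q, p, 1, 0))"
    by (auto intro!: derivative_eq_intros B C simp: \<alpha>_def algebra_simps fun_eq_iff)
  show "(- (fst (snd h) * c_part (?f h)), - (fst (snd h) * b_part (?f h)),
      fst (snd (snd h)) * b_part (?f h), c_part (?f h) + snd (snd (snd h)) * b_part (?f h))
    = vf_in_chart G_atlas G_chart (right_invariant_vf G_atlas G_groupoid s) h" if "h \<in> G_coords" for h
    using that right_invariant_vf_coords[OF _ s] by (cases h) auto
qed auto

text \<open>Both brackets split in the same way: derivatives of the covector fields along the
  anchors, and a term algebraic in the two covectors, here produced by differentiating the
  coefficients of the right-invariant fields.\<close>

lemma bracket_base_map: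
  assumes a: "smooth_on UNIV a" and b: "smooth_on UNIV b"
    and s: "\<And>y. s y = ker_vector y (a (base_map_inv y))"
    and t: "\<And>y. t y = ker_vector y (b (base_map_inv y))"
  shows "vf_bracket G_atlas (right_invariant_vf G_atlas G_groupoid s) (right_invariant_vf G_atlas G_groupoid t)
      (G_unit y) = ker_vector y (koszul_bracket a b (base_map_inv y))"
proof -
  obtain p q where y: "y = (p, q)" by (cases y)
  define x where "x = base_map_inv y"
  define a' where "a' = frechet_derivative a (at x)"
  define b' where "b' = frechet_derivative b (at x)"
  have Da: "(a has_derivative a') (at x)" and Db: "(b has_derivative b') (at x)"
    using smooth_on_has_derivative[OF a] smooth_on_has_derivative[OF b] by (simp_all add: a'_def b'_def)
  \<comment> \<open>In real coordinates the base component of a kernel vector is the anchor, so the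
    derivatives of the covector fields along the right-invariant fields are those of the Koszul
    bracket.\<close>
  have sharp: "base_map_inv (- (p * b_part \<alpha>), - (p * c_part \<alpha>)) = poisson_sharp x \<alpha>" for \<alpha>
    using base_map_poisson_sharp[of x \<alpha>] base_map_inverse(1)[of "poisson_sharp x \<alpha>"]
    by (simp add: x_def y)
  define X where "X = right_invariant_vf G_atlas G_groupoid s"
  define Y where "Y = right_invariant_vf G_atlas G_groupoid t"
  define \<alpha> where "\<alpha> = a x"
  define \<beta> where "\<beta> = b x"
  define a1 where "a1 = a' (poisson_sharp x \<beta>)"
  define b1 where "b1 = b' (poisson_sharp x \<alpha>)"
  note parts = bounded_linear.linear[OF bounded_linear_b_part] bounded_linear.linear[OF bounded_linear_c_part]
  have at_unit: "snd G_chart (G_unit y) = (q, p, 1, 0)" by (simp add: y)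
  have X0: "vf_in_chart G_atlas G_chart X (q, p, 1, 0) = ker_coords p \<alpha>"
    using right_invariant_vf_coords[OF _ s, of 1 q p 0] by (simp add: X_def ker_coords_def \<alpha>_def x_def y)
  have Y0: "vf_in_chart G_atlas G_chart Y (q, p, 1, 0) = ker_coords p \<beta>"
    using right_invariant_vf_coords[OF _ t, of 1 q p 0] by (simp add: Y_def ker_coords_def \<beta>_def x_def y)
  have "G_tangent (G_unit y) (vf_bracket G_atlas X Y (G_unit y)) =
      (p * (b_part \<alpha> * c_part \<beta> - b_part \<beta> * c_part \<alpha>) - p * c_part (b1 - a1), - (p * b_part (b1 - a1)),
       b_part (b1 - a1), c_part (b1 - a1) + (c_part \<alpha> * b_part \<beta> - c_part \<beta> * b_part \<alpha>))"
    unfolding G.vf_bracket_global[of "G_unit y" X _ Y, unfolded at_unit, OF _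
        right_invariant_vf_has_derivative[OF s, of _ p q, folded y, folded x_def, OF Da, folded X_def]
        right_invariant_vf_has_derivative[OF t, of _ p q, folded y, folded x_def, OF Db, folded Y_def], simplified]
      X0 Y0
    by (simp add: ker_coords_def sharp algebra_simps linear_diff[OF parts(1)] linear_diff[OF parts(2)]
        flip: \<alpha>_def \<beta>_def a1_def b1_def)
  also have "\<dots> = ker_coords p (b1 - a1 - (\<chi> j. \<alpha> \<bullet> poisson_sharp (axis j 1) \<beta>))"
  proof -
    define k where "k = (\<chi> j. \<alpha> \<bullet> poisson_sharp (axis j 1) \<beta>)"
    \<comment> \<open>The third and fourth components of \<open>k\<close> vanish since pi does not
      depend on x3 and x4; its c-part is, up to sign, the bracket of the affine Lie algebra of the
      complex line.\<close>
    have "b_part k = 0" "c_part k = c_part \<beta> * b_part \<alpha> - c_part \<alpha> * b_part \<beta>"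
      by (simp_all add: k_def b_part_def c_part_def complex_eq_iff poisson_sharp_eq axis_def inner_vec_def sum_4
          algebra_simps)
    moreover have "b_part (b1 - a1 - k) = b_part (b1 - a1) - b_part k" "c_part (b1 - a1 - k) = c_part (b1 - a1) - c_part k"
      by (rule linear_diff[OF parts(1)] linear_diff[OF parts(2)])+
    ultimately show ?thesis
      unfolding k_def[symmetric] ker_coords_def by (simp only:) (simp add: algebra_simps)
  qed
  also have "\<dots> = ker_coords (fst y) (koszul_bracket a b x)"
    unfolding koszul_bracket_eq[OF Da Db] by (simp add: a1_def b1_def \<alpha>_def \<beta>_def y)
  finally have eq: "G_tangent (G_unit y) (vf_bracket G_atlas X Y (G_unit y)) = ker_coords (fst y) (koszul_bracket a b x)" .
  have "vf_bracket G_atlas X Y (G_unit y) =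
      G.tangent_from_chart (G_unit y) (G_tangent (G_unit y) (vf_bracket G_atlas X Y (G_unit y)))"
    by (rule G.tangent_from_in[symmetric]) simp
  also have "\<dots> = ker_vector y (koszul_bracket a b x)" unfolding eq ker_vector_def ..
  finally show ?thesis by (simp add: X_def Y_def x_def)
qed

lemma integrates_G:
  "integrates_over base_map G_atlas euclidean_atlas G_groupoid cotangent_algebroid"
proof -
  let ?B = "algebroid_of_groupoid G_atlas euclidean_atlas G_groupoid"
  let ?\<Phi> = "\<lambda>x. ker_vector (base_map x)"
  have base: "base cotangent_algebroid = euclidean_atlas" "base ?B = euclidean_atlas"
    and fibre: "fibre cotangent_algebroid x = UNIV" "fibre ?B y = ker_ds G_atlas euclidean_atlas G_groupoid y"
    and anchor: "anchor cotangent_algebroid = poisson_sharp"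
      "anchor ?B y v = differential G_atlas euclidean_atlas (tgt G_groupoid) (G_unit y) v"
    and bracket: "bracket cotangent_algebroid = koszul_bracket"
      "bracket ?B s t y = vf_bracket G_atlas (right_invariant_vf G_atlas G_groupoid s)
        (right_invariant_vf G_atlas G_groupoid t) (G_unit y)"
    and sections: "sections cotangent_algebroid = {\<alpha>. smooth_on UNIV \<alpha>}" for x y v s t
    by (simp_all add: cotangent_algebroid_def algebroid_of_groupoid_def)
  have "lie_algebroid_iso cotangent_algebroid ?B base_map ?\<Phi>"
    unfolding lie_algebroid_iso_def base mcarrier_euclidean fibre anchor bracket(1) sections
  proof (intro conjI ballI allI impI)
    show "diffeomorphism euclidean_atlas euclidean_atlas base_map" by (rule diffeomorphism_base_map)
    show "bij_betw (?\<Phi> x) UNIV (ker_ds G_atlas euclidean_atlas G_groupoid (base_map x))" for x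
      by (rule bij_ker_vector)
    show "?\<Phi> x (r *\<^sub>R e + r' *\<^sub>R e') = r *\<^sub>R ?\<Phi> x e + r' *\<^sub>R ?\<Phi> x e'" for x e e' r r'
      using linear_ker_vector by (simp add: linear_add linear_cmul)
    show "differential G_atlas euclidean_atlas (tgt G_groupoid) (G_unit (base_map x)) (?\<Phi> x e) =
        differential euclidean_atlas euclidean_atlas base_map x (poisson_sharp x e)" for x e
      unfolding anchor_ker_vector differential_base_map base_map_poisson_sharp ..
    show "a \<in> {\<alpha>. smooth_on UNIV \<alpha>} \<longleftrightarrow> push_section UNIV base_map ?\<Phi> a \<in> sections ?B" for a
      unfolding sections_iff mem_Collect_eq ..
    show "?\<Phi> x (koszul_bracket a b x) =
        bracket ?B (push_section UNIV base_map ?\<Phi> a) (push_section UNIV base_map ?\<Phi> b) (base_map x)"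
      if "a \<in> {\<alpha>. smooth_on UNIV \<alpha>}" "b \<in> {\<alpha>. smooth_on UNIV \<alpha>}" for a b x
      using that bracket_base_map[of a b "push_section UNIV base_map ?\<Phi> a" "push_section UNIV base_map ?\<Phi> b"
          "base_map x", OF _ _ push_section_base_map push_section_base_map]
      unfolding bracket(2) by simp
  qed
  then show ?thesis unfolding integrates_over_def by blast
qed

theorem theorem8p10:
  shows "pair_part \<subseteq> G_space \<and>
    diffeomorphism (open_submanifold blowup_atlas pair_part)
      (open_submanifold euclidean_atlas (punctured \<times> punctured)) blowdown \<and>
    (\<exists>\<G> :: (C4 \<times> C3 set, complex \<times> complex) groupoid.
      lie_groupoid G_atlas euclidean_atlas \<G> \<and>
      extends_groupoid blowdown pair_part punctured \<G> pair_groupoid \<and>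
      (\<forall>\<H>. lie_groupoid G_atlas euclidean_atlas \<H> \<and>
         extends_groupoid blowdown pair_part punctured \<H> pair_groupoid \<longrightarrow>
         same_groupoid G_space UNIV \<G> \<H>) \<and>
      integrates_over (complex_coordinates \<circ> reflection) G_atlas euclidean_atlas \<G>
        cotangent_algebroid)"
  using pair_part_subset blowdown_diffeomorphism lie_groupoid_G extends_groupoid_G extension_unique integrates_G
  unfolding base_map_def by blast

end
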